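(* Let $\|\cdot\|$ be a smooth and admissible norm on $\mathbb{R}^3$ with unit ball $B$ and unit sphere $\partial B$, and assume that the auxiliary Euclidean structure of $\mathbb{R}^3$ is re-scaled so that the Euclidean unit sphere bounds the largest Euclidean closed ball (centered at the origin) contained in $B$. Let $\rho(\partial B)$ denote the perimeter of the normed space $(\mathbb{R}^3,\|\cdot\|)$. Then $$\rho(\partial B)\le\frac{2\pi}{\sqrt m},$$ where $m=\inf_{q\in\partial B}K_{\partial B}(q)$.
   Context: A norm $\|\cdot\|$ on $\mathbb{R}^3$ is admissible if its unit sphere $\partial B=\{x\in\mathbb{R}^3:\|x\|=1\}$ has strictly positive Gaussian curvature in the Euclidean geometry of $\mathbb{R}^3$; $B=\{x\in\mathbb{R}^3:\|x\|\le1\}$. $K_{\partial B}(q)$ is the Gaussian curvature of $\partial B$ at $q$ with respect to the (re-scaled) Euclidean structure. The Minkowski length of a piecewise smooth curve $\sigma:[a,b]\to\partial B$ is $l(\sigma)=\int_a^b\|\sigma'(t)\|\,dt$, and the induced Minkowski distance on $\partial B$ is $d(p,q)=\inf_\sigma l(\sigma)$ over all piecewise smooth curves in $\partial B$ connecting $p$ and $q$. The perimeter of the normed space is twice the supremum of the induced Minkowski distances between antipodal points of its unit sphere: $\rho(\partial B)=2\sup_{p\in\partial B}d(p,-p)$. *)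

theory Defs
  imports "HOL-Analysis.Analysis"
begin

section \<open>Norms on three-space\<close>

definition is_norm :: "(real^3 \<Rightarrow> real) \<Rightarrow> bool" where
  "is_norm N \<longleftrightarrow>
     (\<forall>x. 0 \<le> N x) \<and> (\<forall>x. N x = 0 \<longleftrightarrow> x = 0) \<and>
     (\<forall>a x. N (a *\<^sub>R x) = \<bar>a\<bar> * N x) \<and> (\<forall>x y. N (x + y) \<le> N x + N y)"

definition unit_ball :: "(real^3 \<Rightarrow> real) \<Rightarrow> (real^3) set" where
  "unit_ball N = {x. N x \<le> 1}"

definition unit_sphere :: "(real^3 \<Rightarrow> real) \<Rightarrow> (real^3) set" where
  "unit_sphere N = {x. N x = 1}"

text \<open>The sets \<open>S\<close> used below are open sets and intervals; on a closed interval the derivatives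
  at the end points are one-sided.\<close>

primrec Ck_on ::
  "nat \<Rightarrow> ('a::real_normed_vector \<Rightarrow> 'b::real_normed_vector) \<Rightarrow> 'a set \<Rightarrow> bool" where
  "Ck_on 0 f S \<longleftrightarrow> continuous_on S f"
| "Ck_on (Suc k) f S \<longleftrightarrow>
     (\<exists>f'. (\<forall>x\<in>S. (f has_derivative f' x) (at x within S)) \<and> (\<forall>v. Ck_on k (\<lambda>x. f' x v) S))"

definition smooth_on :: "('a::real_normed_vector \<Rightarrow> 'b::real_normed_vector) \<Rightarrow> 'a set \<Rightarrow> bool" where
  "smooth_on f S \<longleftrightarrow> (\<forall>k. Ck_on k f S)"

text \<open>No norm is differentiable at the origin.\<close>

definition smooth_norm :: "(real^3 \<Rightarrow> real) \<Rightarrow> bool" where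
  "smooth_norm N \<longleftrightarrow> is_norm N \<and> smooth_on N (- {0})"


section \<open>Gaussian curvature of the unit sphere\<close>

text \<open>The Euclidean structure obtained from the standard one by multiplying all lengths by \<open>c > 0\<close>.\<close>

definition euclid_inner :: "real \<Rightarrow> real^3 \<Rightarrow> real^3 \<Rightarrow> real" where
  "euclid_inner c x y = c\<^sup>2 * (x \<bullet> y)"

definition euclid_norm :: "real \<Rightarrow> real^3 \<Rightarrow> real" where
  "euclid_norm c x = sqrt (euclid_inner c x x)"

definition euclid_cball :: "real \<Rightarrow> real \<Rightarrow> (real^3) set" where
  "euclid_cball c r = {x. euclid_norm c x \<le> r}"

definition gradient :: "(real^3 \<Rightarrow> real) \<Rightarrow> real^3 \<Rightarrow> real^3" where
  "gradient f x = (THE d. GDERIV f x :> d)"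

text \<open>The outward unit normal of the unit sphere. The gradients of \<open>N\<close> for the various \<open>c\<close> are
  positive multiples of one another, so the standard gradient can be normalized. The formula
  extends the Gauss map from the sphere to the complement of the origin; its derivative in tangential
  directions depends only on its values on the sphere.\<close>

definition gauss_map :: "real \<Rightarrow> (real^3 \<Rightarrow> real) \<Rightarrow> real^3 \<Rightarrow> real^3" where
  "gauss_map c N x = (1 / euclid_norm c (gradient N x)) *\<^sub>R gradient N x"

definition tangent_plane :: "(real^3 \<Rightarrow> real) \<Rightarrow> real^3 \<Rightarrow> (real^3) set" where
  "tangent_plane N q = {v. euclid_inner 1 (gradient N q) v = 0}"

text \<open>The determinant of a linear endomorphism \<open>L\<close> of a plane \<open>T\<close> through the origin is the
  number \<open>k\<close> with \<open>L u \<and> L v = k (u \<and> v)\<close> for all \<open>u\<close>, \<open>v\<close> in \<open>T\<close>. The wedge product is written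
  as a cross product; since it occurs on both sides, \<open>k\<close> depends neither on an orientation nor on
  the choice of Euclidean structure.\<close>

definition plane_det :: "(real^3) set \<Rightarrow> (real^3 \<Rightarrow> real^3) \<Rightarrow> real" where
  "plane_det T L = (THE k. \<forall>u\<in>T. \<forall>v\<in>T. cross3 (L u) (L v) = k *\<^sub>R cross3 u v)"

definition gaussian_curvature :: "real \<Rightarrow> (real^3 \<Rightarrow> real) \<Rightarrow> real^3 \<Rightarrow> real" where
  "gaussian_curvature c N q =
     plane_det (tangent_plane N q) (frechet_derivative (gauss_map c N) (at q))"

definition admissible_norm :: "(real^3 \<Rightarrow> real) \<Rightarrow> bool" where
  "admissible_norm N \<longleftrightarrow> (\<forall>q\<in>unit_sphere N. 0 < gaussian_curvature 1 N q)"


section \<open>Minkowski length, induced distance and perimeter\<close>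

definition piecewise_smooth :: "real \<Rightarrow> real \<Rightarrow> (real \<Rightarrow> real^3) \<Rightarrow> bool" where
  "piecewise_smooth a b \<sigma> \<longleftrightarrow>
     (\<exists>(n::nat) t. t 0 = a \<and> t n = b \<and>
        (\<forall>i<n. t i < t (Suc i) \<and> smooth_on \<sigma> {t i..t (Suc i)}))"

text \<open>At the finitely many break points, and at \<open>a\<close> and \<open>b\<close>, the value of the integrand is
  irrelevant.\<close>

definition mink_length :: "(real^3 \<Rightarrow> real) \<Rightarrow> real \<Rightarrow> real \<Rightarrow> (real \<Rightarrow> real^3) \<Rightarrow> real" where
  "mink_length N a b \<sigma> = integral {a..b} (\<lambda>t. N (vector_derivative \<sigma> (at t)))"

definition mink_dist :: "(real^3 \<Rightarrow> real) \<Rightarrow> real^3 \<Rightarrow> real^3 \<Rightarrow> real" where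
  "mink_dist N p q =
     Inf {mink_length N a b \<sigma> | a b \<sigma>.
            a \<le> b \<and> piecewise_smooth a b \<sigma> \<and> \<sigma> ` {a..b} \<subseteq> unit_sphere N \<and> \<sigma> a = p \<and> \<sigma> b = q}"

definition perimeter :: "(real^3 \<Rightarrow> real) \<Rightarrow> real" where
  "perimeter N = 2 * (SUP p\<in>unit_sphere N. mink_dist N p (- p))"

end

theory Submission
  imports Defs
begin

text \<open>Every point of the ball of radius \<open>1\<close> of the re-scaled Euclidean structure has norm at most \<open>1\<close>, so a
Minkowski length never exceeds the re-scaled Euclidean length of the same curve. It is
therefore enough to join \<open>p\<close> and \<open>-p\<close> on the unit sphere by curves of Euclidean length arbitrarily close
to \<open>pi / sqrt m\<close>; in other words, to prove the diameter bound of Bonnet and Myers for a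
closed surface whose Gaussian curvature is at least \<open>m > 0\<close>. (The infimum \<open>m\<close> is positive because the
curvature is a positive continuous function on a compact surface.)

The bound is proved without geodesics or differential equations, by replacing geodesics with polygons.
Among all chains \<open>x 0 = p, x 1, \<dots>, x n = -p\<close> of points of the surface, one minimizes
\<open>energy n x\<close>, the sum of the squared edge lengths; it exists by compactness. Write \<open>u i\<close> for the
edge from \<open>x i\<close> to \<open>x (i + 1)\<close>, and \<open>\<nu>\<close> and \<open>A\<close> for the unit normal and the shape operator. If \<open>x + z\<close> is
another chain with the same end points, then minimality says, after summation by parts, that the sum of
\<open>|z (i + 1) - z i|\<^sup>2\<close> is at least twice the sum of \<open>z i \<bullet> (u i - u (i - 1))\<close>,
an inequality without remainder (\<open>minimal_chain_variation\<close>). Taking \<open>z\<close> tangent to the surface to first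
order gives both variation formulas:
 \<^item> \<open>u i - u (i - 1) = l i \<nu> (x i)\<close> for some number \<open>l i\<close>, which is the discrete geodesic equation;
 \<^item> the sum of \<open>|v (i + 1) - v i|\<^sup>2\<close> is at least that of \<open>- l i * (v i \<bullet> A (x i) (v i))\<close> for all tangent fields
   \<open>v\<close> that vanish at the ends. Here \<open>- l i\<close> is close to \<open>u i \<bullet> A (x i) (u i)\<close>.

The classical argument uses a parallel normal field along the geodesic. Its discrete substitute is
\<open>w i = \<nu> (x i) \<times> u i\<close>. By the discrete geodesic equation it is also equal to \<open>\<nu> (x i) \<times> u (i - 1)\<close>, so that
\<open>w (i + 1) - w i = (\<nu> (x (i + 1)) - \<nu> (x i)) \<times> u i\<close> exactly. This is approximately \<open>A u \<times> u\<close>, of length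
\<open>|A u \<bullet> w|\<close>. For \<open>v i = sin (pi i / n) w i\<close> the squares \<open>(A u \<bullet> w)\<^sup>2\<close> on the left meet the products
\<open>(A u \<bullet> u) (A w \<bullet> w)\<close> on the right, and the difference is the Gaussian curvature times \<open>|u|\<^sup>4\<close>. All edges of
a minimal chain are nearly equal (\<open>nearly_equal_terms\<close>), so the inequality reads, for the common
edge length \<open>h\<close>, \<open>(pi / n)\<^sup>2 h\<^sup>2 \<ge> m h\<^sup>4\<close> up to terms of smaller order, that is, \<open>n h \<le> pi / sqrt m\<close> in the limit
(\<open>minimal_chain_edge_bound\<close>).

It remains to project the chords of such a chain radially onto the sphere: this gives piecewise
smooth curves, and the projection lengthens short chords by a factor close to \<open>1\<close>
(\<open>projected_chord_speed\<close>).\<close>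

unbundle cross3_syntax

section \<open>Sums of squared sines and nearly constant sequences\<close>

lemma sum_cos_equally_spaced:
  fixes n :: nat and c :: real
  assumes "n \<ge> 2"
  shows "(\<Sum>i<n. cos (c + 2 * pi * real i / real n)) = 0"
proof -
  define g where "g i = sin (c + 2 * pi * real i / real n - pi / real n)" for i :: nat
  have step: "2 * sin (pi / real n) * cos (c + 2 * pi * real i / real n) = g (Suc i) - g i" for i
  proof -
    have e: "c + 2 * pi * real (Suc i) / real n - pi / real n = (c + 2 * pi * real i / real n) + pi / real n"
      using assms by (simp add: field_simps)
    show ?thesis unfolding g_def e by (simp add: sin_add sin_diff)
  qed
  have "2 * sin (pi / real n) * (\<Sum>i<n. cos (c + 2 * pi * real i / real n)) = (\<Sum>i<n. g (Suc i) - g i)"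
    by (simp add: sum_distrib_left step)
  also have "\<dots> = g n - g 0" by (rule sum_lessThan_telescope)
  also have "\<dots> = 0"
  proof -
    have "c + 2 * pi * real n / real n - pi / real n = (c - pi / real n) + 2 * pi"
      using assms by simp
    then show ?thesis unfolding g_def by (simp only: sin_periodic) simp
  qed
  finally have *: "2 * sin (pi / real n) * (\<Sum>i<n. cos (c + 2 * pi * real i / real n)) = 0" .
  have "sin (pi / real n) > 0" using assms by (intro sin_gt_zero) (auto simp: field_simps)
  then show ?thesis using * by simp
qed

lemma sum_sin_squared:
  fixes n :: nat
  assumes "n \<ge> 2"
  shows "(\<Sum>i<n. (sin (pi * real i / real n))\<^sup>2) = real n / 2"
proof -
  have "(sin (pi * real i / real n))\<^sup>2 = 1/2 - cos (0 + 2 * pi * real i / real n) / 2" for i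
  proof -
    have "cos (2 * (pi * real i / real n)) = 1 - 2 * (sin (pi * real i / real n))\<^sup>2"
      by (rule cos_double_sin)
    moreover have "0 + 2 * pi * real i / real n = 2 * (pi * real i / real n)" by simp
    ultimately show ?thesis by (simp only:) (simp add: diff_divide_distrib)
  qed
  then show ?thesis
    by (simp add: sum_subtractf sum_divide_distrib[symmetric] sum_cos_equally_spaced[OF assms, of 0, simplified])
qed

text \<open>The sine is the first Dirichlet eigenvector of the discrete Laplacian, which makes this the optimal
Rayleigh quotient when compared with the preceding sum; the constant \<open>pi\<close> of the theorem originates here.\<close>

lemma sum_sin_diff_squared:
  fixes n :: nat
  assumes "n \<ge> 2"
  shows "(\<Sum>i<n. (sin (pi * real (Suc i) / real n) - sin (pi * real i / real n))\<^sup>2)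
    \<le> (pi / real n)\<^sup>2 * (real n / 2)"
proof -
  define c where "c = pi / real n"
  have "(sin (pi * real (Suc i) / real n) - sin (pi * real i / real n))\<^sup>2
     = (2 * sin (c / 2))\<^sup>2 * (1/2 + cos (c + 2 * pi * real i / real n) / 2)" for i
  proof -
    have "sin (pi * real (Suc i) / real n) - sin (pi * real i / real n)
      = 2 * sin (c / 2) * cos (pi * (real i + 1/2) / real n)"
      unfolding sin_diff_sin c_def using assms by (simp add: field_simps)
    moreover have "(cos (pi * (real i + 1/2) / real n))\<^sup>2 = 1/2 + cos (c + 2 * pi * real i / real n) / 2"
    proof -
      have "c + 2 * pi * real i / real n = 2 * (pi * (real i + 1/2) / real n)"
        unfolding c_def using assms by (simp add: field_simps)
      then show ?thesis by (simp only: cos_double_cos) (simp add: diff_divide_distrib)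
    qed
    ultimately show ?thesis by (simp add: power_mult_distrib)
  qed
  then have "(\<Sum>i<n. (sin (pi * real (Suc i) / real n) - sin (pi * real i / real n))\<^sup>2)
    = (2 * sin (c / 2))\<^sup>2 * (\<Sum>i<n. 1/2 + cos (c + 2 * pi * real i / real n) / 2)"
    by (simp only: sum_distrib_left)
  also have "(\<Sum>i<n. 1/2 + cos (c + 2 * pi * real i / real n) / 2) = real n / 2"
    using sum_cos_equally_spaced[OF assms, of c] by (simp add: sum.distrib sum_divide_distrib[symmetric])
  also have "(2 * sin (c / 2))\<^sup>2 * (real n / 2) \<le> c\<^sup>2 * (real n / 2)"
  proof -
    have "\<bar>2 * sin (c / 2)\<bar> \<le> \<bar>c\<bar>" using abs_sin_le_one abs_sin_x_le_abs_x[of "c/2"] by simp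
    then have "(2 * sin (c / 2))\<^sup>2 \<le> c\<^sup>2" by (simp only: abs_le_square_iff)
    then show ?thesis by (rule mult_right_mono) simp
  qed
  finally show ?thesis by (simp add: c_def)
qed

text \<open>Applied to the squared edge lengths of a minimal chain. The total bounds every term by \<open>C / n\<close>, so the
hypothesis on consecutive terms becomes a relative error of order \<open>1 / n\<close>; over \<open>n\<close> steps this accumulates to
a bounded factor, and hence every term is of order \<open>1 / n\<^sup>2\<close>. With this better bound the same hypothesis
makes the terms equal up to order \<open>1 / n\<^sup>3\<close>.\<close>

lemma nearly_equal_terms:
  fixes q :: "nat \<Rightarrow> real" and B C :: real and n :: nat
  assumes q0: "\<And>i. 0 \<le> q i" and B: "B \<ge> 0" and n: "n > 0" "4 * B * C \<le> real n"
    and tot: "(\<Sum>i<n. q i) \<le> C / real n"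
    and step: "\<And>i. Suc i < n \<Longrightarrow> \<bar>q (Suc i) - q i\<bar> \<le> B * (q (Suc i) + q i)\<^sup>2"
    and ij: "i < n" "j < n"
  defines "K \<equiv> C * exp (8 * B * C)"
  shows "q i \<le> K / (real n)\<^sup>2" "\<bar>q i - q j\<bar> \<le> 4 * B * K\<^sup>2 / (real n)^3"
proof -
  have C: "C \<ge> 0"
    using sum_nonneg[of "{..<n}" q] q0 tot n by (auto simp: field_simps)
      (smt (verit) mult_nonneg_nonneg of_nat_0_le_iff zero_le_divide_iff of_nat_0_less_iff)
  have le: "q k \<le> C / real n" if "k < n" for k
    using member_le_sum[of k "{..<n}" q] that q0 tot by force
  define \<theta> where "\<theta> = 2 * B * C / real n"
  have th: "0 \<le> \<theta>" "\<theta> \<le> 1/2" using B C n by (auto simp: \<theta>_def field_simps)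
  have close: "q (Suc k) \<le> (1 + 4 * \<theta>) * q k \<and> q k \<le> (1 + 4 * \<theta>) * q (Suc k)" if "Suc k < n" for k
  proof -
    have s: "q (Suc k) + q k \<le> 2 * C / real n" using le[of k] le[of "Suc k"] that by simp
    have "B * (q (Suc k) + q k)\<^sup>2 \<le> B * ((2 * C / real n) * (q (Suc k) + q k))"
      unfolding power2_eq_square by (intro mult_left_mono mult_right_mono s) (use B q0 in auto)
    then have *: "\<bar>q (Suc k) - q k\<bar> \<le> \<theta> * (q (Suc k) + q k)"
      using step[OF that] by (simp add: \<theta>_def algebra_simps)
    have gen: "b \<le> (1 + 4 * \<theta>) * a" if "b - a \<le> \<theta> * (b + a)" "0 \<le> a" "0 \<le> b" for a b
    proof -
      have "(1 - \<theta>) * b \<le> (1 + \<theta>) * a" using that by (simp add: algebra_simps)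
      also have "\<dots> \<le> (1 - \<theta>) * ((1 + 4 * \<theta>) * a)"
      proof -
        have "(1 - \<theta>) * (1 + 4 * \<theta>) - (1 + \<theta>) = 2 * \<theta> * (1 - 2 * \<theta>)" by (simp add: algebra_simps)
        also have "\<dots> \<ge> 0" using th by simp
        finally have "1 + \<theta> \<le> (1 - \<theta>) * (1 + 4 * \<theta>)" by simp
        from mult_right_mono[OF this that(2)] show ?thesis by (simp add: mult.assoc)
      qed
      finally show ?thesis using th by simp
    qed
    show ?thesis using gen[of "q (Suc k)" "q k"] gen[of "q k" "q (Suc k)"] * q0 by (auto simp: add.commute)
  qed
  have up: "q (k + l) \<le> (1 + 4 * \<theta>) ^ l * q k \<and> q k \<le> (1 + 4 * \<theta>) ^ l * q (k + l)" if "k + l < n" for k l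
    using that
  proof (induction l)
    case (Suc l)
    then have IH: "q (k + l) \<le> (1 + 4 * \<theta>) ^ l * q k" "q k \<le> (1 + 4 * \<theta>) ^ l * q (k + l)" by auto
    have c: "q (Suc (k + l)) \<le> (1 + 4 * \<theta>) * q (k + l)" "q (k + l) \<le> (1 + 4 * \<theta>) * q (Suc (k + l))"
      using close[of "k + l"] Suc by auto
    have "q (Suc (k + l)) \<le> (1 + 4 * \<theta>) * ((1 + 4 * \<theta>) ^ l * q k)"
      by (rule order_trans[OF c(1)], rule mult_left_mono[OF IH(1)]) (use th in auto)
    moreover have "q k \<le> (1 + 4 * \<theta>) ^ l * ((1 + 4 * \<theta>) * q (Suc (k + l)))"
      by (rule order_trans[OF IH(2)], rule mult_left_mono[OF c(2)]) (use th in auto)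
    ultimately show ?case by (simp add: mult_ac)
  qed simp
  have exp_bd: "(1 + 4 * \<theta>) ^ l \<le> exp (8 * B * C)" if "l \<le> n" for l
  proof -
    have "(1 + 4 * \<theta>) ^ l \<le> (1 + 4 * \<theta>) ^ n" using th that by (intro power_increasing) auto
    also have "\<dots> \<le> exp (4 * \<theta>) ^ n" using th by (intro power_mono exp_ge_add_one_self) auto
    also have "\<dots> = exp (real n * (4 * \<theta>))" by (simp add: exp_of_nat_mult)
    also have "real n * (4 * \<theta>) = 8 * B * C" using n by (simp add: \<theta>_def)
    finally show ?thesis .
  qed
  have comp: "q k \<le> exp (8 * B * C) * q l" if "k < n" "l < n" for k l
  proof -
    define d where "d = (if k \<le> l then l - k else k - l)"
    have "d \<le> n" using that by (auto simp: d_def)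
    have "q k \<le> (1 + 4 * \<theta>) ^ d * q l"
    proof (cases "k \<le> l")
      case True then show ?thesis using up[of k "l - k"] that by (auto simp: d_def)
    next
      case False then show ?thesis using up[of l "k - l"] that by (auto simp: d_def)
    qed
    also have "\<dots> \<le> exp (8 * B * C) * q l" by (intro mult_right_mono exp_bd \<open>d \<le> n\<close> q0)
    finally show ?thesis .
  qed
  have bd: "q k \<le> K / (real n)\<^sup>2" if "k < n" for k
  proof -
    have "real n * q k = (\<Sum>l<n. q k)" by simp
    also have "\<dots> \<le> (\<Sum>l<n. exp (8 * B * C) * q l)" by (intro sum_mono comp that) auto
    also have "\<dots> = exp (8 * B * C) * (\<Sum>l<n. q l)" by (simp add: sum_distrib_left)
    also have "\<dots> \<le> exp (8 * B * C) * (C / real n)" by (intro mult_left_mono tot) auto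
    finally show ?thesis using n by (simp add: K_def field_simps power2_eq_square)
  qed
  show "q i \<le> K / (real n)\<^sup>2" using bd ij by auto
  have stepK: "\<bar>q (Suc k) - q k\<bar> \<le> 4 * B * K\<^sup>2 / (real n)^4" if "Suc k < n" for k
  proof -
    have "q (Suc k) + q k \<le> 2 * K / (real n)\<^sup>2" using bd[of k] bd[of "Suc k"] that by simp
    then have "(q (Suc k) + q k)\<^sup>2 \<le> (2 * K / (real n)\<^sup>2)\<^sup>2" by (intro power_mono) (use q0 in auto)
    then have "B * (q (Suc k) + q k)\<^sup>2 \<le> B * (2 * K / (real n)\<^sup>2)\<^sup>2" by (rule mult_left_mono[OF _ B])
    moreover have "B * (2 * K / (real n)\<^sup>2)\<^sup>2 = 4 * B * K\<^sup>2 / (real n)^4"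
      by (simp add: power_divide power_mult_distrib)
    ultimately show ?thesis using step[OF that] by linarith
  qed
  define E where "E = 4 * B * K\<^sup>2 / (real n)^4"
  have E0: "E \<ge> 0" using B by (simp add: E_def)
  have acc: "\<bar>q (k + l) - q k\<bar> \<le> real l * E" if "k + l < n" for k l
    using that
  proof (induction l)
    case (Suc l)
    then have "\<bar>q (k + l) - q k\<bar> \<le> real l * E" by simp
    moreover have "\<bar>q (Suc (k + l)) - q (k + l)\<bar> \<le> E" using stepK[of "k + l"] Suc by (simp add: E_def)
    ultimately show ?case by (simp add: algebra_simps)
  qed simp
  have "\<bar>q i - q j\<bar> \<le> real n * E"
  proof (cases "i \<le> j")
    case True
    then have "\<bar>q j - q i\<bar> \<le> real (j - i) * E" using acc[of i "j - i"] ij by auto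
    also have "\<dots> \<le> real n * E" using ij E0 by (intro mult_right_mono) auto
    finally show ?thesis by (simp add: abs_minus_commute)
  next
    case False
    then have "\<bar>q i - q j\<bar> \<le> real (i - j) * E" using acc[of j "i - j"] ij by auto
    also have "\<dots> \<le> real n * E" using ij E0 by (intro mult_right_mono) auto
    finally show ?thesis .
  qed
  also have "real n * E = 4 * B * K\<^sup>2 / (real n)^3" using n by (simp add: E_def field_simps power_numeral_reduce)
  finally show "\<bar>q i - q j\<bar> \<le> 4 * B * K\<^sup>2 / (real n)^3" .
qed

section \<open>The two local estimates for the test field\<close>

lemma norm_cross_of_orthogonal:
  fixes a p u :: "real^3"
  assumes "norm a = 1" "a \<bullet> p = 0"
  shows "(norm (p \<times> u))\<^sup>2 = (p \<bullet> (a \<times> u))\<^sup>2 + (norm p)\<^sup>2 * (a \<bullet> u)\<^sup>2"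
proof -
  have "(norm (a \<times> (p \<times> u)))\<^sup>2 = (norm (p \<times> u))\<^sup>2 - (a \<bullet> (p \<times> u))\<^sup>2"
    by (simp add: norm_cross assms)
  moreover have "a \<times> (p \<times> u) = (a \<bullet> u) *\<^sub>R p" by (simp add: Lagrange assms)
  moreover have "a \<bullet> (p \<times> u) = - (p \<bullet> (a \<times> u))" by (simp add: cross3_simps)
  ultimately show ?thesis by (simp add: power_mult_distrib mult.commute)
qed

lemma norm_cross_le: "norm ((x::real^3) \<times> y) \<le> norm x * norm y"
proof -
  have "(norm (x \<times> y))\<^sup>2 \<le> (norm x * norm y)\<^sup>2" using norm_cross_dot[of x y] by (metis le_add_same_cancel1 zero_le_power2)
  then show ?thesis by (rule power2_le_imp_le) simp
qed

text \<open>The contribution of one edge \<open>u\<close> to the left-hand side of the second variation inequality. The vectors \<open>a\<close>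
and \<open>b\<close> are the unit normals at the ends of the edge, \<open>L\<close> is the shape operator at its start, and \<open>s\<close>, \<open>t\<close>
are the values of the sine at the two ends. The identity
\<open>|t \<beta> - s \<alpha>|\<^sup>2 = s t |\<beta> - \<alpha>|\<^sup>2 + (t - s) (t |\<beta>|\<^sup>2 - s |\<alpha>|\<^sup>2)\<close> separates the turning of the field from the variation of
its size; since \<open>|\<alpha>|\<^sup>2\<close> and \<open>|\<beta>|\<^sup>2\<close> both equal \<open>|u|\<^sup>2\<close> up to fourth order, the cross terms are negligible.\<close>

lemma edge_estimate:
  fixes a b u :: "real^3" and L :: "real^3 \<Rightarrow> real^3"
  assumes a: "norm a = 1" and b: "norm b = 1"
    and La: "a \<bullet> L u = 0" and LM: "norm (L u) \<le> M * norm u" and M: "M \<ge> 1"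
    and exp: "norm (b - a - L u) \<le> e * norm u" and e: "e \<ge> 0"
    and ab: "norm (b - a) \<le> M * norm u"
    and au: "\<bar>a \<bullet> u\<bar> \<le> M * (norm u)\<^sup>2" and bu: "\<bar>b \<bullet> u\<bar> \<le> M * (norm u)\<^sup>2"
    and s: "0 \<le> s" "s \<le> 1" "0 \<le> t" "t \<le> 1" "\<bar>t - s\<bar> \<le> d"
  defines "q \<equiv> (norm u)\<^sup>2"
  shows "(norm (t *\<^sub>R (b \<times> u) - s *\<^sub>R (a \<times> u)))\<^sup>2
    \<le> (t - s)\<^sup>2 * q + s\<^sup>2 * (L u \<bullet> (a \<times> u))\<^sup>2 + (3 * d * M\<^sup>2 + 2 * M * e + e\<^sup>2) * q\<^sup>2 + M^4 * q^3"
proof -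
  define \<alpha> where "\<alpha> = a \<times> u"
  define \<beta> where "\<beta> = b \<times> u"
  have q: "q \<ge> 0" by (simp add: q_def)
  have nu: "norm u * norm u = q" by (simp add: q_def power2_eq_square)
  have d: "d \<ge> 0" using s by linarith
  have na: "(norm \<alpha>)\<^sup>2 = q - (a \<bullet> u)\<^sup>2" by (simp add: \<alpha>_def norm_cross a q_def)
  have nb: "(norm \<beta>)\<^sup>2 = q - (b \<bullet> u)\<^sup>2" by (simp add: \<beta>_def norm_cross b q_def)
  have sq: "(a \<bullet> u)\<^sup>2 \<le> M\<^sup>2 * q\<^sup>2" "(b \<bullet> u)\<^sup>2 \<le> M\<^sup>2 * q\<^sup>2"
    using power_mono[OF au, of 2] power_mono[OF bu, of 2] by (simp_all add: q_def power_mult_distrib)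
  have id: "(norm (t *\<^sub>R \<beta> - s *\<^sub>R \<alpha>))\<^sup>2
     = s * t * (norm (\<beta> - \<alpha>))\<^sup>2 + (t - s) * (t * (norm \<beta>)\<^sup>2 - s * (norm \<alpha>)\<^sup>2)"
    unfolding power2_norm_eq_inner by (simp add: algebra_simps inner_commute)
  have diff: "\<beta> - \<alpha> = L u \<times> u + (b - a - L u) \<times> u"
    by (simp add: \<alpha>_def \<beta>_def Cross3.left_diff_distrib)
  have "norm (\<beta> - \<alpha>) \<le> M * q"
  proof -
    have "\<beta> - \<alpha> = (b - a) \<times> u" by (simp add: \<alpha>_def \<beta>_def Cross3.left_diff_distrib)
    then have "norm (\<beta> - \<alpha>) \<le> norm (b - a) * norm u" by (simp add: norm_cross_le)
    also have "\<dots> \<le> (M * norm u) * norm u" by (intro mult_right_mono ab) simp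
    finally show ?thesis by (simp add: nu mult.assoc)
  qed
  then have crude: "(norm (\<beta> - \<alpha>))\<^sup>2 \<le> M\<^sup>2 * q\<^sup>2"
    using power_mono[of "norm (\<beta> - \<alpha>)" "M * q" 2] by (simp add: power_mult_distrib)
  have r: "norm ((b - a - L u) \<times> u) \<le> e * q"
  proof -
    have "norm ((b - a - L u) \<times> u) \<le> (e * norm u) * norm u"
      by (rule order_trans[OF norm_cross_le]) (intro mult_right_mono exp, simp)
    then show ?thesis by (simp add: nu mult.assoc)
  qed
  have l: "norm (L u \<times> u) \<le> M * q"
  proof -
    have "norm (L u \<times> u) \<le> (M * norm u) * norm u"
      by (rule order_trans[OF norm_cross_le]) (intro mult_right_mono LM, simp)
    then show ?thesis by (simp add: nu mult.assoc)
  qed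
  have l2: "(norm (L u \<times> u))\<^sup>2 \<le> (L u \<bullet> \<alpha>)\<^sup>2 + M^4 * q^3"
  proof -
    have "(norm (L u))\<^sup>2 \<le> M\<^sup>2 * q" using power_mono[OF LM, of 2] by (simp add: q_def power_mult_distrib)
    then have "(norm (L u))\<^sup>2 * (a \<bullet> u)\<^sup>2 \<le> (M\<^sup>2 * q) * (M\<^sup>2 * q\<^sup>2)"
      by (intro mult_mono sq) (use q in auto)
    also have "\<dots> = M^4 * q^3" by (simp add: power_numeral_reduce)
    finally show ?thesis using norm_cross_of_orthogonal[OF a La, of u] by (simp add: \<alpha>_def)
  qed
  have fine: "(norm (\<beta> - \<alpha>))\<^sup>2 \<le> (L u \<bullet> \<alpha>)\<^sup>2 + M^4 * q^3 + (2 * M * e + e\<^sup>2) * q\<^sup>2"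
  proof -
    have "norm (\<beta> - \<alpha>) \<le> norm (L u \<times> u) + e * q" unfolding diff using r norm_triangle_ineq by (smt (verit))
    then have "(norm (\<beta> - \<alpha>))\<^sup>2 \<le> (norm (L u \<times> u) + e * q)\<^sup>2" by (rule power_mono) simp
    also have "\<dots> = (norm (L u \<times> u))\<^sup>2 + 2 * norm (L u \<times> u) * (e * q) + e\<^sup>2 * q\<^sup>2"
      by (simp add: power2_sum power_mult_distrib)
    also have "\<dots> \<le> (norm (L u \<times> u))\<^sup>2 + 2 * (M * q) * (e * q) + e\<^sup>2 * q\<^sup>2"
      using mult_right_mono[OF l, of "e * q"] e q by simp
    finally show ?thesis using l2 by (simp add: algebra_simps power2_eq_square)
  qed
  have t1: "s * t * (norm (\<beta> - \<alpha>))\<^sup>2 \<le> s\<^sup>2 * (L u \<bullet> \<alpha>)\<^sup>2 + M^4 * q^3 + (2 * M * e + e\<^sup>2) * q\<^sup>2 + d * M\<^sup>2 * q\<^sup>2"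
  proof -
    have "s * t = s\<^sup>2 + s * (t - s)" by (simp add: power2_eq_square algebra_simps)
    moreover have "s * (t - s) \<le> s * d" "s * d \<le> 1 * d" using s d by (intro mult_left_mono mult_right_mono; auto)+
    ultimately have "s * t \<le> s\<^sup>2 + d" by simp
    then have "s * t * (norm (\<beta> - \<alpha>))\<^sup>2 \<le> (s\<^sup>2 + d) * (norm (\<beta> - \<alpha>))\<^sup>2" by (rule mult_right_mono) simp
    also have "\<dots> \<le> s\<^sup>2 * ((L u \<bullet> \<alpha>)\<^sup>2 + (M^4 * q^3 + (2 * M * e + e\<^sup>2) * q\<^sup>2)) + d * (M\<^sup>2 * q\<^sup>2)"
      unfolding distrib_right[of "s\<^sup>2"]
      by (intro add_mono mult_left_mono) (use fine crude d in \<open>auto simp: add.assoc\<close>)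
    also have "\<dots> \<le> s\<^sup>2 * (L u \<bullet> \<alpha>)\<^sup>2 + 1 * (M^4 * q^3 + (2 * M * e + e\<^sup>2) * q\<^sup>2) + d * (M\<^sup>2 * q\<^sup>2)"
    proof -
      have "s\<^sup>2 \<le> 1" using s by (simp add: power_le_one)
      moreover have "M^4 * q^3 + (2 * M * e + e\<^sup>2) * q\<^sup>2 \<ge> 0" using M e q by simp
      ultimately have "s\<^sup>2 * (M^4 * q^3 + (2 * M * e + e\<^sup>2) * q\<^sup>2) \<le> 1 * (M^4 * q^3 + (2 * M * e + e\<^sup>2) * q\<^sup>2)"
        by (intro mult_right_mono)
      then show ?thesis by (simp only: distrib_left)
    qed
    finally show ?thesis by simp
  qed
  have t2: "(t - s) * (t * (norm \<beta>)\<^sup>2 - s * (norm \<alpha>)\<^sup>2) \<le> (t - s)\<^sup>2 * q + 2 * d * M\<^sup>2 * q\<^sup>2"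
  proof -
    have "(t - s) * (t * (norm \<beta>)\<^sup>2 - s * (norm \<alpha>)\<^sup>2)
      = (t - s)\<^sup>2 * q + (t - s) * (s * (a \<bullet> u)\<^sup>2 - t * (b \<bullet> u)\<^sup>2)"
      unfolding na nb by (simp add: algebra_simps power2_eq_square)
    also have "(t - s) * (s * (a \<bullet> u)\<^sup>2 - t * (b \<bullet> u)\<^sup>2) \<le> d * (2 * (M\<^sup>2 * q\<^sup>2))"
    proof -
      have "\<bar>s * (a \<bullet> u)\<^sup>2 - t * (b \<bullet> u)\<^sup>2\<bar> \<le> s * (a \<bullet> u)\<^sup>2 + t * (b \<bullet> u)\<^sup>2"
      proof -
        have "0 \<le> s * (a \<bullet> u)\<^sup>2" "0 \<le> t * (b \<bullet> u)\<^sup>2" using s by auto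
        then show ?thesis by linarith
      qed
      also have "\<dots> \<le> 1 * (M\<^sup>2 * q\<^sup>2) + 1 * (M\<^sup>2 * q\<^sup>2)"
        by (intro add_mono mult_mono sq) (use s in auto)
      finally have x: "\<bar>s * (a \<bullet> u)\<^sup>2 - t * (b \<bullet> u)\<^sup>2\<bar> \<le> 2 * (M\<^sup>2 * q\<^sup>2)" by simp
      have "(t - s) * (s * (a \<bullet> u)\<^sup>2 - t * (b \<bullet> u)\<^sup>2) \<le> \<bar>t - s\<bar> * \<bar>s * (a \<bullet> u)\<^sup>2 - t * (b \<bullet> u)\<^sup>2\<bar>"
        by (metis abs_ge_self abs_mult)
      also have "\<dots> \<le> d * (2 * (M\<^sup>2 * q\<^sup>2))" by (intro mult_mono x s) (use d in auto)
      finally show ?thesis .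
    qed
    finally show ?thesis by simp
  qed
  show ?thesis using id t1 t2 unfolding \<alpha>_def \<beta>_def by (simp add: algebra_simps)
qed

text \<open>The contribution of one vertex to the right-hand side. The vector \<open>a\<close> is the normal at the vertex, and \<open>u'\<close>
and \<open>u\<close> are the edges that arrive and leave. Because \<open>L\<close> annihilates \<open>a\<close>, both edges have the same second
fundamental form \<open>u \<bullet> L u\<close>, and the two contact estimates add up to \<open>- l \<approx> u \<bullet> L u\<close>. The curvature enters through the
tangential part of \<open>u\<close>, which has the same \<open>w\<close> and the same \<open>L u\<close>.\<close>

lemma vertex_estimate:
  fixes a u u' :: "real^3" and L :: "real^3 \<Rightarrow> real^3"
  assumes a: "norm a = 1" and lin: "linear L" and sym: "\<And>v w. L v \<bullet> w = v \<bullet> L w" and La: "L a = 0"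
    and LM: "\<And>v. norm (L v) \<le> M * norm v" and M: "M \<ge> 1"
    and u': "u - u' = l *\<^sub>R a"
    and c1: "\<bar>a \<bullet> u + u \<bullet> L u / 2\<bar> \<le> e * (norm u)\<^sup>2"
    and c2: "\<bar>a \<bullet> (- u') + u' \<bullet> L u' / 2\<bar> \<le> e * (norm u')\<^sup>2"
    and au: "\<bar>a \<bullet> u\<bar> \<le> M * (norm u)\<^sup>2"
    and curv: "\<And>v. v \<bullet> a = 0 \<Longrightarrow> (L v \<bullet> v) * (L (a \<times> v) \<bullet> (a \<times> v)) - (L v \<bullet> (a \<times> v))\<^sup>2 \<ge> m * (norm v)^4"
    and m: "m > 0"
  defines "q \<equiv> (norm u)\<^sup>2" and "q' \<equiv> (norm u')\<^sup>2" and "w \<equiv> a \<times> u"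
  shows "- l * (w \<bullet> L w) \<ge> m * q\<^sup>2 + (L u \<bullet> w)\<^sup>2 - (2 * m * M\<^sup>2 * q^3 + e * M * q * (q + q'))"
proof -
  have q: "q \<ge> 0" "q' \<ge> 0" by (auto simp: q_def q'_def)
  have aa: "a \<bullet> a = 1" using a by (simp add: power2_norm_eq_inner[symmetric])
  have Ladd: "L (x + k *\<^sub>R a) = L x" for x k using lin La by (simp add: linear_add linear_scale)
  have aL: "a \<bullet> L v = 0" for v using sym[of a v] La by simp
  have u'e: "u' = u + (- l) *\<^sub>R a" using u' by (simp add: algebra_simps)
  have Lu': "u' \<bullet> L u' = u \<bullet> L u" unfolding u'e Ladd by (simp add: inner_diff_left aL)
  have l: "l = a \<bullet> u - a \<bullet> u'" using aa by (simp add: u'e inner_diff_right)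
  have lapp: "\<bar>- l - u \<bullet> L u\<bar> \<le> e * (q + q')"
    using c1 c2 unfolding Lu' l q_def q'_def by (simp add: algebra_simps abs_le_iff)
  have nw: "(norm w)\<^sup>2 = q - (a \<bullet> u)\<^sup>2" by (simp add: w_def norm_cross a q_def)
  have wL: "\<bar>w \<bullet> L w\<bar> \<le> M * q"
  proof -
    have "\<bar>w \<bullet> L w\<bar> \<le> norm w * norm (L w)" by (rule Cauchy_Schwarz_ineq2)
    also have "\<dots> \<le> norm w * (M * norm w)" by (intro mult_left_mono LM) simp
    also have "\<dots> = M * (norm w)\<^sup>2" by (simp add: power2_eq_square)
    also have "\<dots> \<le> M * q" using M by (intro mult_left_mono) (auto simp: nw)
    finally show ?thesis .
  qed
  \<comment> \<open>The tangential part of \<open>u\<close>.\<close>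
  define v where "v = u + (- (a \<bullet> u)) *\<^sub>R a"
  have va: "v \<bullet> a = 0" by (simp add: v_def inner_diff_left aa inner_commute[of u a])
  have av: "a \<times> v = w" by (simp add: v_def w_def Cross3.right_diff_distrib cross_mult_right)
  have Lv: "L v = L u" by (simp only: v_def Ladd)
  have Lvv: "L v \<bullet> v = u \<bullet> L u" unfolding Lv by (simp add: v_def inner_diff_right inner_commute aL)
  have nv: "(norm v)\<^sup>2 = q - (a \<bullet> u)\<^sup>2"
    by (simp add: v_def q_def power2_norm_eq_inner inner_diff_left inner_diff_right aa inner_commute)
       (simp add: power2_eq_square)
  have "(norm v)^4 = ((norm v)\<^sup>2)\<^sup>2" by simp
  also have "\<dots> = q\<^sup>2 - 2 * q * (a \<bullet> u)\<^sup>2 + ((a \<bullet> u)\<^sup>2)\<^sup>2" unfolding nv by (simp add: power2_diff)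
  also have "\<dots> \<ge> q\<^sup>2 - 2 * q * (M\<^sup>2 * q\<^sup>2)"
  proof -
    have "(a \<bullet> u)\<^sup>2 \<le> M\<^sup>2 * q\<^sup>2" using power_mono[OF au, of 2] by (simp add: q_def power_mult_distrib)
    then have "2 * q * (a \<bullet> u)\<^sup>2 \<le> 2 * q * (M\<^sup>2 * q\<^sup>2)" using q by (intro mult_left_mono) auto
    then show ?thesis by (smt (verit) zero_le_power2)
  qed
  finally have "(norm v)^4 \<ge> q\<^sup>2 - 2 * M\<^sup>2 * q^3" by (simp add: power_numeral_reduce algebra_simps)
  then have "m * (norm v)^4 \<ge> m * (q\<^sup>2 - 2 * M\<^sup>2 * q^3)" using m by (intro mult_left_mono) auto
  then have main: "(u \<bullet> L u) * (w \<bullet> L w) \<ge> (L u \<bullet> w)\<^sup>2 + m * q\<^sup>2 - 2 * m * M\<^sup>2 * q^3"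
    using curv[OF va] unfolding av Lvv unfolding Lv by (simp add: algebra_simps inner_commute)
  have "\<bar>(- l - u \<bullet> L u) * (w \<bullet> L w)\<bar> \<le> (e * (q + q')) * (M * q)"
    unfolding abs_mult by (intro mult_mono lapp wL) (use lapp q in \<open>auto intro: order_trans[OF abs_ge_zero]\<close>)
  then have "- l * (w \<bullet> L w) \<ge> (u \<bullet> L u) * (w \<bullet> L w) - e * M * q * (q + q')"
    by (simp add: abs_le_iff algebra_simps)
  then show ?thesis using main by simp
qed

section \<open>Chains of minimal energy\<close>

definition chain :: "'a set \<Rightarrow> 'a \<Rightarrow> 'a \<Rightarrow> nat \<Rightarrow> (nat \<Rightarrow> 'a) \<Rightarrow> bool" where
  "chain S a b n x \<longleftrightarrow> x 0 = a \<and> x n = b \<and> (\<forall>i\<le>n. x i \<in> S)"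

definition edge :: "(nat \<Rightarrow> 'a::real_normed_vector) \<Rightarrow> nat \<Rightarrow> 'a" where
  "edge x i = x (Suc i) - x i"

definition energy :: "nat \<Rightarrow> (nat \<Rightarrow> 'a::real_normed_vector) \<Rightarrow> real" where
  "energy n x = (\<Sum>i<n. (norm (edge x i))\<^sup>2)"

definition minimal_chain :: "'a::real_normed_vector set \<Rightarrow> 'a \<Rightarrow> 'a \<Rightarrow> nat \<Rightarrow> (nat \<Rightarrow> 'a) \<Rightarrow> bool" where
  "minimal_chain S a b n x \<longleftrightarrow> chain S a b n x \<and> (\<forall>y. chain S a b n y \<longrightarrow> energy n x \<le> energy n y)"

text \<open>A chain only constrains the points with index at most \<open>n\<close>. Letting all further points range over \<open>S\<close> as
well turns the set of chains into a product of compact sets, so that Tychonoff's theorem applies.\<close>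

lemma minimal_chain_exists:
  fixes S :: "'a::real_normed_vector set"
  assumes S: "compact S" and ab: "a \<in> S" "b \<in> S" and n: "n \<ge> 1"
  shows "\<exists>x. minimal_chain S a b n x"
proof -
  define T where "T i = (if i = 0 then {a} else if i = n then {b} else S)" for i :: nat
  define X where "X = (\<Pi>\<^sub>E i\<in>UNIV. T i)"
  have "compactin (product_topology (\<lambda>i::nat. euclidean) UNIV) X"
    unfolding X_def compactin_PiE using S by (auto simp: T_def)
  then have X: "compact X" by (simp add: euclidean_product_topology)
  have ne: "X \<noteq> {}" using ab by (auto simp: X_def T_def PiE_eq_empty_iff)
  have cont: "continuous_on X (energy n)"
    unfolding energy_def edge_def by (intro continuous_intros continuous_on_product_coordinates[THEN continuous_on_subset]) auto
  obtain x where x: "x \<in> X" "\<And>y. y \<in> X \<Longrightarrow> energy n x \<le> energy n y"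
    using continuous_attains_inf[OF X ne cont] by blast
  have "chain S a b n x"
    using x(1) ab n unfolding chain_def X_def T_def PiE_UNIV_domain by (fastforce simp: Pi_iff split: if_splits)
  moreover have "energy n x \<le> energy n y" if y: "chain S a b n y" for y
  proof -
    define z where "z i = (if i \<le> n then y i else a)" for i
    have "z \<in> X" using y ab n unfolding chain_def X_def T_def z_def by auto
    moreover have "energy n z = energy n y" unfolding energy_def edge_def z_def by (intro sum.cong) auto
    ultimately show ?thesis using x(2) by force
  qed
  ultimately show ?thesis unfolding minimal_chain_def by blast
qed

text \<open>No derivative is taken: the energy is a quadratic polynomial of the chain, and its linear part is rewritten by
summation by parts. The field \<open>z\<close> vanishes at the ends, so the edge \<open>edge x n\<close> beyond the end
of the chain has coefficient \<open>0\<close> in the last summand.\<close>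

lemma minimal_chain_variation:
  fixes S :: "'a::real_inner set"
  assumes x: "minimal_chain S a b n x" and y: "chain S a b n y"
  defines "z \<equiv> \<lambda>i. y i - x i"
  shows "2 * (\<Sum>i<n. z (Suc i) \<bullet> (edge x (Suc i) - edge x i)) \<le> (\<Sum>i<n. (norm (edge z i))\<^sup>2)"
proof -
  have z0: "z 0 = 0" "z n = 0" using x y by (auto simp: z_def chain_def minimal_chain_def)
  have "energy n y = (\<Sum>i<n. (norm (edge x i))\<^sup>2 + (norm (edge z i))\<^sup>2 + 2 * (edge x i \<bullet> edge z i))"
    unfolding energy_def
  proof (intro sum.cong refl)
    fix i
    have "edge y i = edge x i + edge z i" by (simp add: edge_def z_def)
    then show "(norm (edge y i))\<^sup>2 = (norm (edge x i))\<^sup>2 + (norm (edge z i))\<^sup>2 + 2 * (edge x i \<bullet> edge z i)"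
      by (simp add: power2_norm_eq_inner inner_add_left inner_add_right inner_commute)
  qed
  also have "\<dots> = energy n x + (\<Sum>i<n. (norm (edge z i))\<^sup>2) + 2 * (\<Sum>i<n. edge x i \<bullet> edge z i)"
    by (simp add: energy_def sum.distrib sum_distrib_left)
  also have "(\<Sum>i<n. edge x i \<bullet> edge z i) = - (\<Sum>i<n. z (Suc i) \<bullet> (edge x (Suc i) - edge x i))"
  proof -
    have "edge x i \<bullet> edge z i + z (Suc i) \<bullet> (edge x (Suc i) - edge x i)
        = edge x (Suc i) \<bullet> z (Suc i) - edge x i \<bullet> z i" for i
      by (simp add: edge_def inner_diff_left inner_diff_right inner_commute)
    then have "(\<Sum>i<n. edge x i \<bullet> edge z i) + (\<Sum>i<n. z (Suc i) \<bullet> (edge x (Suc i) - edge x i))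
       = (\<Sum>i<n. edge x (Suc i) \<bullet> z (Suc i) - edge x i \<bullet> z i)"
      by (simp add: sum.distrib[symmetric])
    also have "\<dots> = edge x n \<bullet> z n - edge x 0 \<bullet> z 0"
      by (rule sum_lessThan_telescope[of "\<lambda>i. edge x i \<bullet> z i"])
    finally show ?thesis using z0 by simp
  qed
  finally have "energy n y = energy n x + (\<Sum>i<n. (norm (edge z i))\<^sup>2)
     - 2 * (\<Sum>i<n. z (Suc i) \<bullet> (edge x (Suc i) - edge x i))" by simp
  then show ?thesis using x y unfolding minimal_chain_def by force
qed

section \<open>Surfaces with curvature bounded below\<close>

text \<open>The properties of a compact smooth surface that the argument uses: \<open>\<nu>\<close> is the unit normal, and \<open>A\<close> is the shape operator,
extended from the tangent plane to a symmetric operator on space by \<open>A x (\<nu> x) = 0\<close>. With this extension no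
vector has to be projected to a tangent plane before \<open>A\<close> is applied. Smoothness appears only as
uniform first order contact of \<open>\<nu>\<close> with its derivative and uniform second order contact of the surface with its
osculating paraboloid. In \<open>curvature_ge\<close> the vectors \<open>v\<close> and \<open>\<nu> x \<times> v\<close> are orthogonal and of the same length, so the
left-hand side is the determinant of \<open>A x\<close> on the tangent plane times \<open>|v|\<^sup>4\<close>.\<close>

locale curved_surface =
  fixes S :: "(real^3) set" and \<nu> :: "real^3 \<Rightarrow> real^3" and A :: "real^3 \<Rightarrow> real^3 \<Rightarrow> real^3"
    and m :: real
  assumes normal_unit: "x \<in> S \<Longrightarrow> norm (\<nu> x) = 1"
    and shape_linear: "x \<in> S \<Longrightarrow> linear (A x)"
    and shape_symmetric: "x \<in> S \<Longrightarrow> A x v \<bullet> w = v \<bullet> A x w"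
    and shape_normal: "x \<in> S \<Longrightarrow> A x (\<nu> x) = 0"
    and shape_bounded: "\<exists>M. \<forall>x\<in>S. \<forall>v. norm (A x v) \<le> M * norm v"
    and normal_expansion: "e > 0 \<Longrightarrow> \<exists>d>0. \<forall>x\<in>S. \<forall>y\<in>S. norm (y - x) < d \<longrightarrow>
          norm (\<nu> y - \<nu> x - A x (y - x)) \<le> e * norm (y - x)"
    and contact: "e > 0 \<Longrightarrow> \<exists>d>0. \<forall>x\<in>S. \<forall>y\<in>S. norm (y - x) < d \<longrightarrow>
          \<bar>\<nu> x \<bullet> (y - x) + (y - x) \<bullet> A x (y - x) / 2\<bar> \<le> e * (norm (y - x))\<^sup>2"
    and tangent_curve: "x \<in> S \<Longrightarrow> v \<bullet> \<nu> x = 0 \<Longrightarrow>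
          \<exists>y. y 0 = x \<and> (\<forall>s. y s \<in> S) \<and> (y has_vector_derivative v) (at (0::real))"
    and curvature_ge: "x \<in> S \<Longrightarrow> v \<bullet> \<nu> x = 0 \<Longrightarrow>
          (A x v \<bullet> v) * (A x (\<nu> x \<times> v) \<bullet> (\<nu> x \<times> v)) - (A x v \<bullet> (\<nu> x \<times> v))\<^sup>2 \<ge> m * (norm v)^4"
    and m_pos: "m > 0"
begin

text \<open>The two contact properties give these bounds for nearby points; for points at a distance bounded below they
hold by boundedness of the normal once \<open>M\<close> is large enough.\<close>

lemma uniform_bounds:
  obtains M where "M \<ge> 1" "\<And>x v. x \<in> S \<Longrightarrow> norm (A x v) \<le> M * norm v"
    "\<And>x y. x \<in> S \<Longrightarrow> y \<in> S \<Longrightarrow> \<bar>\<nu> x \<bullet> (y - x)\<bar> \<le> M * (norm (y - x))\<^sup>2"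
    "\<And>x y. x \<in> S \<Longrightarrow> y \<in> S \<Longrightarrow> norm (\<nu> y - \<nu> x) \<le> M * norm (y - x)"
proof -
  obtain M0 where "\<forall>x\<in>S. \<forall>v. norm (A x v) \<le> M0 * norm v" using shape_bounded by blast
  define M1 where "M1 = max M0 1"
  have M1: "norm (A x v) \<le> M1 * norm v" if "x \<in> S" for x v
  proof -
    have "M0 * norm v \<le> M1 * norm v" by (intro mult_right_mono) (auto simp: M1_def)
    then show ?thesis using \<open>\<forall>x\<in>S. _\<close> that by (meson order_trans)
  qed
  have M11: "M1 \<ge> 1" by (simp add: M1_def)
  obtain d1 where d1: "d1 > 0" "\<And>x y. x \<in> S \<Longrightarrow> y \<in> S \<Longrightarrow> norm (y - x) < d1 \<Longrightarrow>
      \<bar>\<nu> x \<bullet> (y - x) + (y - x) \<bullet> A x (y - x) / 2\<bar> \<le> 1 * (norm (y - x))\<^sup>2"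
    using contact[of 1] by auto
  obtain d2 where d2: "d2 > 0" "\<And>x y. x \<in> S \<Longrightarrow> y \<in> S \<Longrightarrow> norm (y - x) < d2 \<Longrightarrow>
      norm (\<nu> y - \<nu> x - A x (y - x)) \<le> 1 * norm (y - x)"
    using normal_expansion[of 1] by auto
  define M where "M = M1 + 1 + 1/d1 + 2/d2"
  have MM1: "M \<ge> M1 + 1" "M \<ge> 1/d1" "M \<ge> 2/d2" using d1(1) d2(1) M11 by (auto simp: M_def)
  show ?thesis
  proof (rule that[of M])
    show "M \<ge> 1" using MM1 M11 by simp
    fix x assume x: "x \<in> S"
    show "norm (A x v) \<le> M * norm v" for v
      using M1[OF x, of v] mult_right_mono[of M1 M "norm v"] MM1 by simp
    fix y assume y: "y \<in> S"
    show "\<bar>\<nu> x \<bullet> (y - x)\<bar> \<le> M * (norm (y - x))\<^sup>2"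
    proof (cases "norm (y - x) < d1")
      case True
      have "\<bar>(y - x) \<bullet> A x (y - x)\<bar> \<le> norm (y - x) * (M1 * norm (y - x))"
        by (rule order_trans[OF Cauchy_Schwarz_ineq2]) (intro mult_left_mono M1 x, simp)
      then have "\<bar>(y - x) \<bullet> A x (y - x)\<bar> \<le> M1 * (norm (y - x))\<^sup>2" by (simp add: power2_eq_square mult_ac)
      then have "\<bar>\<nu> x \<bullet> (y - x)\<bar> \<le> (M1 + 1) * (norm (y - x))\<^sup>2"
        using d1(2)[OF x y True] zero_le_power2[of "norm (y - x)"] M11 unfolding distrib_right
        by (smt (verit) mult_nonneg_nonneg field_sum_of_halves)
      also have "\<dots> \<le> M * (norm (y - x))\<^sup>2" using MM1 by (intro mult_right_mono) auto
      finally show ?thesis .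
    next
      case False
      have "\<bar>\<nu> x \<bullet> (y - x)\<bar> \<le> norm (y - x)"
        using Cauchy_Schwarz_ineq2[of "\<nu> x" "y - x"] normal_unit[OF x] by simp
      also have "\<dots> \<le> (1/d1) * (norm (y - x))\<^sup>2"
        using False d1(1) mult_right_mono[of d1 "norm (y - x)" "norm (y - x)"]
        by (simp add: field_simps power2_eq_square)
      also have "\<dots> \<le> M * (norm (y - x))\<^sup>2" using MM1 by (intro mult_right_mono) auto
      finally show ?thesis .
    qed
    show "norm (\<nu> y - \<nu> x) \<le> M * norm (y - x)"
    proof (cases "norm (y - x) < d2")
      case True
      have "norm (\<nu> y - \<nu> x) \<le> norm (A x (y - x)) + norm (\<nu> y - \<nu> x - A x (y - x))"
        by (metis add.commute diff_add_cancel norm_triangle_ineq)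
      also have "\<dots> \<le> (M1 + 1) * norm (y - x)" using M1[OF x, of "y - x"] d2(2)[OF x y True] by (simp add: algebra_simps)
      also have "\<dots> \<le> M * norm (y - x)" using MM1 by (intro mult_right_mono) auto
      finally show ?thesis .
    next
      case False
      have "norm (\<nu> y - \<nu> x) \<le> 2" using norm_triangle_ineq4[of "\<nu> y" "\<nu> x"] normal_unit x y by simp
      also have "\<dots> \<le> (2/d2) * norm (y - x)" using False d2(1) by (simp add: field_simps)
      also have "\<dots> \<le> M * norm (y - x)" using MM1 by (intro mult_right_mono) auto
      finally show ?thesis .
    qed
  qed
qed

text \<open>Moving each point of a chain along a curve on the surface gives a one-parameter family of chains with a prescribed
tangent field. Where \<open>v\<close> vanishes the point is kept fixed, so the end points do not move.\<close>

lemma tangent_field_variation: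
  assumes xn: "chain S a b n x"
    and v: "v 0 = 0" "v n = 0" "\<And>i. i \<le> n \<Longrightarrow> v i \<bullet> \<nu> (x i) = 0"
  obtains z where "\<And>s. chain S a b n (\<lambda>i. x i + z s i)"
    "\<And>i. i \<le> n \<Longrightarrow> ((\<lambda>s. z s i /\<^sub>R s) \<longlongrightarrow> v i) (at_right 0)"
proof -
  have "\<exists>y. y 0 = x i \<and> (\<forall>s. y s \<in> S) \<and> (y has_vector_derivative v i) (at (0::real)) \<and> (v i = 0 \<longrightarrow> (\<forall>s. y s = x i))"
    if "i \<le> n" for i
  proof (cases "v i = 0")
    case True
    then show ?thesis using xn that by (intro exI[of _ "\<lambda>_. x i"]) (auto simp: chain_def)
  next
    case False
    then show ?thesis using tangent_curve[of "x i" "v i"] xn v that by (auto simp: chain_def)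
  qed
  then obtain y where y: "\<And>i. i \<le> n \<Longrightarrow> y i 0 = x i \<and> (\<forall>s. y i s \<in> S) \<and> (y i has_vector_derivative v i) (at (0::real)) \<and> (v i = 0 \<longrightarrow> (\<forall>s. y i s = x i))"
    by metis
  show ?thesis
  proof (rule that[of "\<lambda>s i. y i s - x i"])
    show "chain S a b n (\<lambda>i. x i + (y i s - x i))" for s
      using y xn v(1,2) unfolding chain_def by auto
    fix i assume i: "i \<le> n"
    have "(y i has_vector_derivative v i) (at_right 0)" using y[OF i] has_vector_derivative_at_within by blast
    then have "((\<lambda>s. (1 / norm s) *\<^sub>R (y i s - (x i + s *\<^sub>R v i)) + v i) \<longlongrightarrow> 0 + v i) (at_right 0)"
      unfolding has_vector_derivative_def has_derivative_within using y[OF i]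
      by (intro tendsto_intros) simp
    then have lim: "((\<lambda>s. (1 / norm s) *\<^sub>R (y i s - (x i + s *\<^sub>R v i)) + v i) \<longlongrightarrow> v i) (at_right 0)" by simp
    have "\<forall>\<^sub>F s::real in at_right 0. s > 0" by (simp add: eventually_at_right_less)
    then have "\<forall>\<^sub>F s in at_right 0. (1 / norm s) *\<^sub>R (y i s - (x i + s *\<^sub>R v i)) + v i = (y i s - x i) /\<^sub>R s"
      by eventually_elim (simp add: divide_inverse scaleR_diff_right scaleR_add_right)
    from Lim_transform_eventually[OF lim this]
    show "((\<lambda>s. (y i s - x i) /\<^sub>R s) \<longlongrightarrow> v i) (at_right 0)" .
  qed
qed

text \<open>The discrete geodesic equation. The test field is the tangential part of the difference of consecutive edges;
dividing the variation inequality by the parameter and letting it tend to \<open>0\<close> shows that its squares sum to at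
most \<open>0\<close>.\<close>

lemma minimal_chain_first_order:
  assumes x: "minimal_chain S a b n x" and i: "Suc i < n"
  shows "edge x (Suc i) - edge x i = (\<nu> (x (Suc i)) \<bullet> (edge x (Suc i) - edge x i)) *\<^sub>R \<nu> (x (Suc i))"
proof -
  have ch: "chain S a b n x" using x by (simp add: minimal_chain_def)
  define D where "D i = edge x i - edge x (i - 1)" for i
  define v where "v i = (if i = 0 \<or> i \<ge> n then 0 else D i - (\<nu> (x i) \<bullet> D i) *\<^sub>R \<nu> (x i))" for i
  have unit: "\<nu> (x i) \<bullet> \<nu> (x i) = 1" if "i \<le> n" for i
    using normal_unit[of "x i"] ch that by (simp add: chain_def power2_norm_eq_inner[symmetric])
  have tang: "v i \<bullet> \<nu> (x i) = 0" if "i \<le> n" for i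
    using unit[OF that] by (auto simp: v_def inner_diff_left inner_commute[of "D i"])
  have v0: "v 0 = 0" "v n = 0" by (auto simp: v_def)
  obtain z where z: "\<And>s. chain S a b n (\<lambda>i. x i + z s i)"
    "\<And>i. i \<le> n \<Longrightarrow> ((\<lambda>s. z s i /\<^sub>R s) \<longlongrightarrow> v i) (at_right 0)"
    using tangent_field_variation[OF ch v0 tang] by blast
  have ineq: "2 * (\<Sum>i<n. (z s (Suc i) /\<^sub>R s) \<bullet> D (Suc i)) \<le> s * (\<Sum>i<n. (norm (z s (Suc i) /\<^sub>R s - z s i /\<^sub>R s))\<^sup>2)"
    if "s > 0" for s
  proof -
    have "2 * (\<Sum>i<n. z s (Suc i) \<bullet> D (Suc i)) \<le> (\<Sum>i<n. (norm (edge (z s) i))\<^sup>2)"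
      using minimal_chain_variation[OF x z(1)[of s]] by (simp add: D_def)
    then have "(2 * (\<Sum>i<n. z s (Suc i) \<bullet> D (Suc i))) / s \<le> (\<Sum>i<n. (norm (edge (z s) i))\<^sup>2) / s"
      by (rule divide_right_mono) (use that in simp)
    moreover have "s * (norm (z s (Suc i) /\<^sub>R s - z s i /\<^sub>R s))\<^sup>2 = (norm (edge (z s) i))\<^sup>2 / s" for i
      using that
      by (simp add: edge_def scaleR_diff_right[symmetric] power_mult_distrib divide_inverse power_inverse power2_eq_square)
    ultimately show ?thesis
      by (simp add: sum_divide_distrib sum_distrib_left divide_inverse mult_ac)
  qed
  have "2 * (\<Sum>i<n. v (Suc i) \<bullet> D (Suc i)) \<le> 0 * (\<Sum>i<n. (norm (v (Suc i) - v i))\<^sup>2)"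
  proof (rule tendsto_le[of "at_right (0::real)"])
    show "((\<lambda>s. 2 * (\<Sum>i<n. (z s (Suc i) /\<^sub>R s) \<bullet> D (Suc i))) \<longlongrightarrow> 2 * (\<Sum>i<n. v (Suc i) \<bullet> D (Suc i))) (at_right 0)"
      by (intro tendsto_intros z) auto
    show "((\<lambda>s. s * (\<Sum>i<n. (norm (z s (Suc i) /\<^sub>R s - z s i /\<^sub>R s))\<^sup>2)) \<longlongrightarrow> 0 * (\<Sum>i<n. (norm (v (Suc i) - v i))\<^sup>2)) (at_right 0)"
      by (intro tendsto_intros z) auto
    show "\<forall>\<^sub>F s in at_right 0. 2 * (\<Sum>i<n. (z s (Suc i) /\<^sub>R s) \<bullet> D (Suc i)) \<le> s * (\<Sum>i<n. (norm (z s (Suc i) /\<^sub>R s - z s i /\<^sub>R s))\<^sup>2)"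
      using ineq by (auto simp: eventually_at_right_field intro: exI[of _ 1])
  qed auto
  then have le0: "(\<Sum>i<n. v (Suc i) \<bullet> D (Suc i)) \<le> 0" by simp
  have sq: "v (Suc i) \<bullet> D (Suc i) = (norm (v (Suc i)))\<^sup>2" if "i < n" for i
  proof (cases "Suc i < n")
    case True
    then have "D (Suc i) = v (Suc i) + (\<nu> (x (Suc i)) \<bullet> D (Suc i)) *\<^sub>R \<nu> (x (Suc i))" by (simp add: v_def)
    then have "v (Suc i) \<bullet> D (Suc i) = v (Suc i) \<bullet> v (Suc i) + (\<nu> (x (Suc i)) \<bullet> D (Suc i)) * (v (Suc i) \<bullet> \<nu> (x (Suc i)))"
      by (metis inner_add_right inner_scaleR_right)
    then show ?thesis using tang[of "Suc i"] True by (simp add: power2_norm_eq_inner)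
  qed (auto simp: v_def)
  have "(\<Sum>i<n. (norm (v (Suc i)))\<^sup>2) \<le> 0" using le0 sq by simp
  then have "(norm (v (Suc i)))\<^sup>2 = 0" if "i < n" for i
    using that sum_nonneg_eq_0_iff[of "{..<n}" "\<lambda>i. (norm (v (Suc i)))\<^sup>2"]
    by (metis (no_types, lifting) antisym finite_lessThan lessThan_iff sum_nonneg zero_le_power2)
  then have "v (Suc i) = 0" using i by simp
  then show ?thesis using i by (simp add: v_def D_def)
qed

text \<open>The normal component of a curve on the surface is of second order and is governed by the second fundamental
form. This is how the curvature enters the second variation.\<close>

lemma contact_limit:
  assumes x: "x \<in> S" and y: "\<And>s. x + z s \<in> S" and lim: "((\<lambda>s. z s /\<^sub>R s) \<longlongrightarrow> v) (at_right (0::real))"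
  shows "((\<lambda>s. (\<nu> x \<bullet> z s) / s\<^sup>2) \<longlongrightarrow> - (v \<bullet> A x v) / 2) (at_right 0)"
proof -
  interpret L: linear "A x" by (rule shape_linear[OF x])
  have blA: "bounded_linear (A x)" using shape_linear[OF x] by (simp add: linear_conv_bounded_linear)
  have spos: "\<forall>\<^sub>F s::real in at_right 0. s > 0" by (simp add: eventually_at_right_less)
  have z0: "(z \<longlongrightarrow> 0) (at_right 0)"
  proof -
    have "((\<lambda>s. s *\<^sub>R (z s /\<^sub>R s)) \<longlongrightarrow> 0 *\<^sub>R v) (at_right 0)" by (intro tendsto_intros lim)
    moreover have "\<forall>\<^sub>F s in at_right 0. s *\<^sub>R (z s /\<^sub>R s) = z s" using spos by eventually_elim simp
    ultimately show ?thesis using Lim_transform_eventually by fastforce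
  qed
  have quad: "((\<lambda>s. (z s \<bullet> A x (z s)) / s\<^sup>2) \<longlongrightarrow> v \<bullet> A x v) (at_right 0)"
  proof -
    have "((\<lambda>s. (z s /\<^sub>R s) \<bullet> A x (z s /\<^sub>R s)) \<longlongrightarrow> v \<bullet> A x v) (at_right 0)"
      by (intro tendsto_intros lim bounded_linear.tendsto[OF blA])
    moreover have "(z s /\<^sub>R s) \<bullet> A x (z s /\<^sub>R s) = (z s \<bullet> A x (z s)) / s\<^sup>2" for s
      by (simp add: L.scale divide_inverse power2_eq_square)
    ultimately show ?thesis by simp
  qed
  have "((\<lambda>s. (\<nu> x \<bullet> z s + z s \<bullet> A x (z s) / 2) / s\<^sup>2) \<longlongrightarrow> 0) (at_right 0)"
  proof (rule tendstoI)
    fix r :: real assume r: "r > 0"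
    define e where "e = r / (2 * ((norm v)\<^sup>2 + 1))"
    have e: "e > 0" using r by (simp add: e_def add_nonneg_pos)
    obtain d where d: "d > 0" "\<And>y. y \<in> S \<Longrightarrow> norm (y - x) < d \<Longrightarrow>
       \<bar>\<nu> x \<bullet> (y - x) + (y - x) \<bullet> A x (y - x) / 2\<bar> \<le> e * (norm (y - x))\<^sup>2"
      using contact[OF e] x by blast
    have ev1: "\<forall>\<^sub>F s in at_right 0. norm (z s) < d" using tendstoD[OF z0 d(1)] by simp
    have "((\<lambda>s. (norm (z s /\<^sub>R s))\<^sup>2) \<longlongrightarrow> (norm v)\<^sup>2) (at_right 0)" by (intro tendsto_intros lim)
    then have ev2: "\<forall>\<^sub>F s in at_right 0. (norm (z s /\<^sub>R s))\<^sup>2 < (norm v)\<^sup>2 + 1" by (rule order_tendstoD) simp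
    show "\<forall>\<^sub>F s in at_right 0. dist ((\<nu> x \<bullet> z s + z s \<bullet> A x (z s) / 2) / s\<^sup>2) 0 < r"
      using ev1 ev2 spos
    proof eventually_elim
      case (elim s)
      have "\<bar>\<nu> x \<bullet> z s + z s \<bullet> A x (z s) / 2\<bar> \<le> e * (norm (z s))\<^sup>2" using d(2)[OF y[of s]] elim by simp
      then have "\<bar>\<nu> x \<bullet> z s + z s \<bullet> A x (z s) / 2\<bar> / s\<^sup>2 \<le> e * (norm (z s))\<^sup>2 / s\<^sup>2"
        by (rule divide_right_mono) simp
      also have "\<dots> = e * (norm (z s /\<^sub>R s))\<^sup>2" by (simp add: power_mult_distrib divide_inverse power_inverse)
      also have "\<dots> \<le> e * ((norm v)\<^sup>2 + 1)" using elim e by (intro mult_left_mono) auto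
      also have "\<dots> = r / 2"
      proof -
        have *: "r / (2 * c) * c = r / 2" if "c > 0" for c :: real using that by simp
        show ?thesis unfolding e_def by (rule *) (simp add: add_nonneg_pos)
      qed
      finally have "\<bar>\<nu> x \<bullet> z s + z s \<bullet> A x (z s) / 2\<bar> / s\<^sup>2 \<le> r / 2" .
      moreover have "dist (t / s\<^sup>2) 0 = \<bar>t\<bar> / s\<^sup>2" for t by (simp add: dist_real_def abs_divide)
      ultimately show ?case using r by (simp only:)
    qed
  qed
  from tendsto_diff[OF this tendsto_divide[OF quad tendsto_const[of 2]]]
  show ?thesis by (simp add: add_divide_distrib diff_divide_distrib)
qed

text \<open>The variation inequality divided by the square of the parameter. The curves in
the direction of the field need only be known to first order, because the right-hand side sees
only their normal component, which \<open>contact_limit\<close> supplies.\<close>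

lemma minimal_chain_second_order:
  assumes x: "minimal_chain S a b n x"
    and v: "v 0 = 0" "v n = 0" "\<And>i. i \<le> n \<Longrightarrow> v i \<bullet> \<nu> (x i) = 0"
  shows "(\<Sum>i<n. - (\<nu> (x (Suc i)) \<bullet> (edge x (Suc i) - edge x i)) * (v (Suc i) \<bullet> A (x (Suc i)) (v (Suc i))))
    \<le> (\<Sum>i<n. (norm (edge v i))\<^sup>2)"
proof -
  have ch: "chain S a b n x" using x by (simp add: minimal_chain_def)
  have xS: "x i \<in> S" if "i \<le> n" for i using ch that by (simp add: chain_def)
  obtain z where z: "\<And>s. chain S a b n (\<lambda>i. x i + z s i)"
    "\<And>i. i \<le> n \<Longrightarrow> ((\<lambda>s. z s i /\<^sub>R s) \<longlongrightarrow> v i) (at_right 0)"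
    using tangent_field_variation[OF ch v] by blast
  define l where "l i = \<nu> (x (Suc i)) \<bullet> (edge x (Suc i) - edge x i)" for i
  have zn: "z s n = 0" for s using z(1)[of s] ch by (simp add: chain_def)
  have ineq: "2 * (\<Sum>i<n. l i * ((\<nu> (x (Suc i)) \<bullet> z s (Suc i)) / s\<^sup>2)) \<le> (\<Sum>i<n. (norm (z s (Suc i) /\<^sub>R s - z s i /\<^sub>R s))\<^sup>2)"
    if "s > 0" for s
  proof -
    have "z s (Suc i) \<bullet> (edge x (Suc i) - edge x i) = l i * (\<nu> (x (Suc i)) \<bullet> z s (Suc i))" if "i < n" for i
    proof (cases "Suc i < n")
      case True
      show ?thesis by (subst minimal_chain_first_order[OF x True]) (simp add: l_def inner_commute)
    next
      case False
      then have "Suc i = n" using that by simp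
      then show ?thesis using zn by simp
    qed
    then have "2 * (\<Sum>i<n. l i * (\<nu> (x (Suc i)) \<bullet> z s (Suc i))) \<le> (\<Sum>i<n. (norm (edge (z s) i))\<^sup>2)"
      using minimal_chain_variation[OF x z(1)[of s]] by simp
    then have "(2 * (\<Sum>i<n. l i * (\<nu> (x (Suc i)) \<bullet> z s (Suc i)))) / s\<^sup>2 \<le> (\<Sum>i<n. (norm (edge (z s) i))\<^sup>2) / s\<^sup>2"
      by (rule divide_right_mono) simp
    moreover have "(norm (z s (Suc i) /\<^sub>R s - z s i /\<^sub>R s))\<^sup>2 = (norm (edge (z s) i))\<^sup>2 / s\<^sup>2" for i
      by (simp add: edge_def scaleR_diff_right[symmetric] power_mult_distrib divide_inverse power_inverse)
    ultimately show ?thesis by (simp add: sum_divide_distrib sum_distrib_left)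
  qed
  have "2 * (\<Sum>i<n. l i * (- (v (Suc i) \<bullet> A (x (Suc i)) (v (Suc i))) / 2)) \<le> (\<Sum>i<n. (norm (v (Suc i) - v i))\<^sup>2)"
  proof (rule tendsto_le[of "at_right (0::real)"])
    show "((\<lambda>s. 2 * (\<Sum>i<n. l i * ((\<nu> (x (Suc i)) \<bullet> z s (Suc i)) / s\<^sup>2))) \<longlongrightarrow>
        2 * (\<Sum>i<n. l i * (- (v (Suc i) \<bullet> A (x (Suc i)) (v (Suc i))) / 2))) (at_right 0)"
      by (intro tendsto_intros contact_limit z xS) (use z(1) in \<open>auto simp: chain_def\<close>)
    show "((\<lambda>s. \<Sum>i<n. (norm (z s (Suc i) /\<^sub>R s - z s i /\<^sub>R s))\<^sup>2) \<longlongrightarrow> (\<Sum>i<n. (norm (v (Suc i) - v i))\<^sup>2)) (at_right 0)"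
      by (intro tendsto_intros z) auto
    show "\<forall>\<^sub>F s in at_right 0. 2 * (\<Sum>i<n. l i * ((\<nu> (x (Suc i)) \<bullet> z s (Suc i)) / s\<^sup>2)) \<le> (\<Sum>i<n. (norm (z s (Suc i) /\<^sub>R s - z s i /\<^sub>R s))\<^sup>2)"
      using ineq by (auto simp: eventually_at_right_field intro: exI[of _ 1])
  qed auto
  then show ?thesis by (simp add: l_def edge_def sum_distrib_left sum_negf)
qed

text \<open>Consecutive edges differ by a multiple of the normal, and both the multiple and the normal components of the
edges are quadratic in the edge lengths. Hence the difference of the squared lengths is of fourth order.\<close>

lemma edge_length_variation:
  assumes x: "minimal_chain S a b n x" and i: "Suc i < n"
    and M: "\<And>x y. x \<in> S \<Longrightarrow> y \<in> S \<Longrightarrow> \<bar>\<nu> x \<bullet> (y - x)\<bar> \<le> M * (norm (y - x))\<^sup>2" "M \<ge> 0"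
  shows "\<bar>(norm (edge x (Suc i)))\<^sup>2 - (norm (edge x i))\<^sup>2\<bar>
    \<le> M\<^sup>2 * ((norm (edge x (Suc i)))\<^sup>2 + (norm (edge x i))\<^sup>2)\<^sup>2"
proof -
  define p where "p = x (Suc i)"
  define u where "u = edge x (Suc i)"
  define u' where "u' = edge x i"
  define l where "l = \<nu> p \<bullet> (u - u')"
  have S: "p \<in> S" "x (Suc (Suc i)) \<in> S" "x i \<in> S" using x i by (auto simp: minimal_chain_def chain_def p_def)
  have b1: "\<bar>\<nu> p \<bullet> u\<bar> \<le> M * (norm u)\<^sup>2" using M(1)[OF S(1) S(2)] by (simp add: p_def u_def edge_def)
  have b2: "\<bar>\<nu> p \<bullet> u'\<bar> \<le> M * (norm u')\<^sup>2"
  proof -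
    have "x i - p = - u'" by (simp add: p_def u'_def edge_def)
    then show ?thesis using M(1)[OF S(1) S(3)] by simp
  qed
  have f: "u - u' = l *\<^sub>R \<nu> p" using minimal_chain_first_order[OF x i] by (simp add: l_def p_def u_def u'_def)
  have "(norm u)\<^sup>2 - (norm u')\<^sup>2 = (u - u') \<bullet> (u + u')"
    by (simp add: power2_norm_eq_inner inner_diff_left inner_add_right inner_commute[of u' u])
  also have "\<dots> = l * (\<nu> p \<bullet> u + \<nu> p \<bullet> u')" by (simp add: f inner_add_right distrib_left)
  finally have "\<bar>(norm u)\<^sup>2 - (norm u')\<^sup>2\<bar> = \<bar>l\<bar> * \<bar>\<nu> p \<bullet> u + \<nu> p \<bullet> u'\<bar>" by (simp add: abs_mult)
  also have "\<dots> \<le> (M * ((norm u)\<^sup>2 + (norm u')\<^sup>2)) * (M * ((norm u)\<^sup>2 + (norm u')\<^sup>2))"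
    by (intro mult_mono) (use b1 b2 M(2) in \<open>auto simp: l_def inner_diff_right abs_le_iff algebra_simps\<close>)
  finally show ?thesis by (simp add: u_def u'_def power2_eq_square mult_ac)
qed

section \<open>The discrete Bonnet-Myers bound\<close>

text \<open>The second variation inequality for \<open>v i = sin (pi i / n) (\<nu> (x i) \<times> u i)\<close>, after cancellation of the terms
\<open>(A u \<bullet> (\<nu> \<times> u))\<^sup>2\<close>. The numbers \<open>d\<close> and \<open>e\<close> measure the quality of the contact, and \<open>k\<close> bounds the squared
edge lengths; for edges of order \<open>1 / n\<close> and small \<open>e\<close> the last summand is small compared with the other sums.\<close>

lemma minimal_chain_sine_test:
  assumes x: "minimal_chain S a b n x" and n: "n \<ge> 2"
    and M: "M \<ge> 1" "\<And>x v. x \<in> S \<Longrightarrow> norm (A x v) \<le> M * norm v"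
      "\<And>x y. x \<in> S \<Longrightarrow> y \<in> S \<Longrightarrow> \<bar>\<nu> x \<bullet> (y - x)\<bar> \<le> M * (norm (y - x))\<^sup>2"
      "\<And>x y. x \<in> S \<Longrightarrow> y \<in> S \<Longrightarrow> norm (\<nu> y - \<nu> x) \<le> M * norm (y - x)"
    and e: "e \<ge> 0"
    and ne: "\<And>x y. x \<in> S \<Longrightarrow> y \<in> S \<Longrightarrow> norm (y - x) < d \<Longrightarrow> norm (\<nu> y - \<nu> x - A x (y - x)) \<le> e * norm (y - x)"
    and ct: "\<And>x y. x \<in> S \<Longrightarrow> y \<in> S \<Longrightarrow> norm (y - x) < d \<Longrightarrow>
          \<bar>\<nu> x \<bullet> (y - x) + (y - x) \<bullet> A x (y - x) / 2\<bar> \<le> e * (norm (y - x))\<^sup>2"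
    and small: "\<And>i. i < n \<Longrightarrow> norm (edge x i) < d" "\<And>i. i < n \<Longrightarrow> (norm (edge x i))\<^sup>2 \<le> k"
  defines "q \<equiv> \<lambda>i. (norm (edge x i))\<^sup>2" and "\<phi> \<equiv> \<lambda>i. sin (pi * real i / real n)"
  shows "m * (\<Sum>i<n. (\<phi> i)\<^sup>2 * (q i)\<^sup>2) \<le> (\<Sum>i<n. (\<phi> (Suc i) - \<phi> i)\<^sup>2 * q i)
    + real n * ((3 * (pi / real n) * M\<^sup>2 + 4 * M * e + e\<^sup>2) * k\<^sup>2 + (M^4 + 2 * m * M\<^sup>2) * k^3)"
proof -
  have ch: "chain S a b n x" using x by (simp add: minimal_chain_def)
  have xS: "x i \<in> S" if "i \<le> n" for i using ch that by (simp add: chain_def)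
  have q0: "q i \<ge> 0" for i by (simp add: q_def)
  have qk: "q i \<le> k" if "i < n" for i using small(2) that by (simp add: q_def)
  have k0: "k \<ge> 0" using qk[of 0] q0[of 0] n by linarith
  have \<phi>01: "0 \<le> \<phi> i" "\<phi> i \<le> 1" if "i \<le> n" for i
  proof -
    have "pi * real i / real n \<le> pi" using that n by (simp add: field_simps)
    then show "0 \<le> \<phi> i" unfolding \<phi>_def by (intro sin_ge_zero) auto
  qed (simp add: \<phi>_def)
  have \<phi>_ends: "\<phi> 0 = 0" "\<phi> n = 0" using n by (simp_all add: \<phi>_def)
  have \<phi>_step: "\<bar>\<phi> (Suc i) - \<phi> i\<bar> \<le> pi / real n" for i
  proof -
    have "\<bar>\<phi> (Suc i) - \<phi> i\<bar> \<le> \<bar>pi * real (Suc i) / real n - pi * real i / real n\<bar>"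
    proof -
      have "\<bar>sin b - sin a\<bar> \<le> \<bar>b - a\<bar>" for a b :: real
      proof -
        have "\<bar>sin b - sin a\<bar> = 2 * \<bar>sin ((b - a) / 2)\<bar> * \<bar>cos ((b + a) / 2)\<bar>"
          by (simp add: sin_diff_sin abs_mult)
        also have "\<dots> \<le> 2 * \<bar>(b - a) / 2\<bar> * 1"
          by (intro mult_mono abs_sin_x_le_abs_x) auto
        finally show ?thesis by simp
      qed
      from this[of "pi * real (Suc i) / real n" "pi * real i / real n"] show ?thesis by (simp only: \<phi>_def)
    qed
    also have "\<dots> = pi / real n" by (simp add: diff_divide_distrib[symmetric] algebra_simps)
    finally show ?thesis .
  qed
  define w where "w i = \<nu> (x i) \<times> edge x i" for i
  define v where "v i = \<phi> i *\<^sub>R w i" for i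
  define s where "s i = (A (x i) (edge x i) \<bullet> w i)\<^sup>2" for i
  have v: "v 0 = 0" "v n = 0" "\<And>i. i \<le> n \<Longrightarrow> v i \<bullet> \<nu> (x i) = 0"
    by (auto simp: v_def w_def \<phi>_ends dot_cross_self)
  define l where "l i = \<nu> (x (Suc i)) \<bullet> (edge x (Suc i) - edge x i)" for i
  have first: "edge x (Suc i) - edge x i = l i *\<^sub>R \<nu> (x (Suc i))" if "Suc i < n" for i
    using minimal_chain_first_order[OF x that] by (simp add: l_def)
  \<comment> \<open>By the discrete geodesic equation the field at \<open>x (i + 1)\<close> can be computed from the edge that arrives there.\<close>
  have next_v: "v (Suc i) = \<phi> (Suc i) *\<^sub>R (\<nu> (x (Suc i)) \<times> edge x i)" if "i < n" for i
  proof (cases "Suc i < n")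
    case True
    have "w (Suc i) = \<nu> (x (Suc i)) \<times> (edge x i + l i *\<^sub>R \<nu> (x (Suc i)))"
      unfolding w_def using first[OF True] by (simp add: algebra_simps)
    then show ?thesis by (simp add: v_def cross_add_right cross_mult_right)
  next
    case False
    then have "Suc i = n" using that by simp
    then show ?thesis by (simp add: v_def \<phi>_ends)
  qed
  define RE where "RE = (3 * (pi / real n) * M\<^sup>2 + 2 * M * e + e\<^sup>2) * k\<^sup>2 + M^4 * k^3"
  define RV where "RV = 2 * m * M\<^sup>2 * k^3 + 2 * e * M * k\<^sup>2"
  have RV0: "RV \<ge> 0" using M(1) e k0 m_pos by (simp add: RV_def)
  have edge_bd: "(norm (edge v i))\<^sup>2 \<le> (\<phi> (Suc i) - \<phi> i)\<^sup>2 * q i + (\<phi> i)\<^sup>2 * s i + RE" if i: "i < n" for i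
  proof -
    have "edge v i = \<phi> (Suc i) *\<^sub>R (\<nu> (x (Suc i)) \<times> edge x i) - \<phi> i *\<^sub>R (\<nu> (x i) \<times> edge x i)"
      by (simp add: edge_def[of v] next_v[OF i]) (simp add: v_def w_def)
    moreover have "(norm (\<phi> (Suc i) *\<^sub>R (\<nu> (x (Suc i)) \<times> edge x i) - \<phi> i *\<^sub>R (\<nu> (x i) \<times> edge x i)))\<^sup>2
      \<le> (\<phi> (Suc i) - \<phi> i)\<^sup>2 * (norm (edge x i))\<^sup>2 + (\<phi> i)\<^sup>2 * (A (x i) (edge x i) \<bullet> (\<nu> (x i) \<times> edge x i))\<^sup>2
       + (3 * (pi / real n) * M\<^sup>2 + 2 * M * e + e\<^sup>2) * ((norm (edge x i))\<^sup>2)\<^sup>2 + M^4 * ((norm (edge x i))\<^sup>2)^3"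
    proof (rule edge_estimate)
      have i': "i \<le> n" "Suc i \<le> n" using i by auto
      note S = xS[OF i'(1)] xS[OF i'(2)]
      show "norm (\<nu> (x i)) = 1" "norm (\<nu> (x (Suc i))) = 1" using S normal_unit by auto
      show "\<nu> (x i) \<bullet> A (x i) (edge x i) = 0"
        using shape_symmetric[OF S(1), of "\<nu> (x i)" "edge x i"] shape_normal[OF S(1)] by simp
      show "norm (A (x i) (edge x i)) \<le> M * norm (edge x i)" by (rule M(2)[OF S(1)])
      show "norm (\<nu> (x (Suc i)) - \<nu> (x i) - A (x i) (edge x i)) \<le> e * norm (edge x i)"
        using ne[OF S] small(1)[OF i] by (simp add: edge_def)
      show "norm (\<nu> (x (Suc i)) - \<nu> (x i)) \<le> M * norm (edge x i)" using M(4)[OF S] by (simp add: edge_def)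
      show "\<bar>\<nu> (x i) \<bullet> edge x i\<bar> \<le> M * (norm (edge x i))\<^sup>2" using M(3)[OF S] by (simp add: edge_def)
      show "\<bar>\<nu> (x (Suc i)) \<bullet> edge x i\<bar> \<le> M * (norm (edge x i))\<^sup>2"
        using M(3)[OF S(2) S(1)] by (simp add: edge_def norm_minus_commute abs_minus_commute inner_diff_right)
    qed (use M(1) e \<phi>01 \<phi>_step i in auto)
    moreover have "(q i)\<^sup>2 \<le> k\<^sup>2" "(q i)^3 \<le> k^3" using qk[OF i] q0 by (auto intro: power_mono)
    then have "(3 * (pi / real n) * M\<^sup>2 + 2 * M * e + e\<^sup>2) * (q i)\<^sup>2 + M^4 * (q i)^3 \<le> RE"
      unfolding RE_def by (intro add_mono mult_left_mono) (use M(1) e in auto)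
    ultimately show ?thesis by (simp add: q_def s_def w_def)
  qed
  have vertex_bd: "m * ((\<phi> (Suc i))\<^sup>2 * (q (Suc i))\<^sup>2) + (\<phi> (Suc i))\<^sup>2 * s (Suc i) - RV
      \<le> - l i * (v (Suc i) \<bullet> A (x (Suc i)) (v (Suc i)))" if i: "i < n" for i
  proof (cases "Suc i < n")
    case True
    have i': "i \<le> n" "Suc i \<le> n" "Suc (Suc i) \<le> n" using True by auto
    note S = xS[OF i'(1)] xS[OF i'(2)] xS[OF i'(3)]
    have "- l i * (w (Suc i) \<bullet> A (x (Suc i)) (w (Suc i)))
       \<ge> m * (q (Suc i))\<^sup>2 + s (Suc i) - (2 * m * M\<^sup>2 * q (Suc i)^3 + e * M * q (Suc i) * (q (Suc i) + q i))"
      unfolding q_def s_def w_def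
    proof (rule vertex_estimate)
      show "norm (\<nu> (x (Suc i))) = 1" using S normal_unit by auto
      show "linear (A (x (Suc i)))" by (rule shape_linear[OF S(2)])
      show "A (x (Suc i)) v \<bullet> w = v \<bullet> A (x (Suc i)) w" for v w by (rule shape_symmetric[OF S(2)])
      show "A (x (Suc i)) (\<nu> (x (Suc i))) = 0" by (rule shape_normal[OF S(2)])
      show "norm (A (x (Suc i)) v) \<le> M * norm v" for v by (rule M(2)[OF S(2)])
      show "edge x (Suc i) - edge x i = l i *\<^sub>R \<nu> (x (Suc i))" by (rule first[OF True])
      show "\<bar>\<nu> (x (Suc i)) \<bullet> edge x (Suc i) + edge x (Suc i) \<bullet> A (x (Suc i)) (edge x (Suc i)) / 2\<bar>
          \<le> e * (norm (edge x (Suc i)))\<^sup>2"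
        using ct[OF S(2) S(3)] small(1)[OF True] by (simp add: edge_def)
      have "x i - x (Suc i) = - edge x i" by (simp add: edge_def)
      moreover have "A (x (Suc i)) (- edge x i) = - A (x (Suc i)) (edge x i)"
        using shape_linear[OF S(2)] by (rule linear_neg)
      ultimately show "\<bar>\<nu> (x (Suc i)) \<bullet> - edge x i + edge x i \<bullet> A (x (Suc i)) (edge x i) / 2\<bar> \<le> e * (norm (edge x i))\<^sup>2"
        using ct[OF S(2) S(1)] small(1)[OF i] by simp
      show "\<bar>\<nu> (x (Suc i)) \<bullet> edge x (Suc i)\<bar> \<le> M * (norm (edge x (Suc i)))\<^sup>2"
        using M(3)[OF S(2) S(3)] by (simp add: edge_def)
      show "m * norm v ^ 4 \<le> A (x (Suc i)) v \<bullet> v * (A (x (Suc i)) (\<nu> (x (Suc i)) \<times> v) \<bullet> (\<nu> (x (Suc i)) \<times> v)) -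
          (A (x (Suc i)) v \<bullet> (\<nu> (x (Suc i)) \<times> v))\<^sup>2" if "v \<bullet> \<nu> (x (Suc i)) = 0" for v
        by (rule curvature_ge[OF S(2) that])
    qed (use M(1) m_pos in auto)
    moreover have "2 * m * M\<^sup>2 * q (Suc i)^3 + e * M * q (Suc i) * (q (Suc i) + q i) \<le> RV"
    proof -
      have "q (Suc i)^3 \<le> k^3" using qk[OF True] q0 by (intro power_mono) auto
      moreover have "q (Suc i) * (q (Suc i) + q i) \<le> k * (k + k)"
        using qk[OF True] qk[OF i] q0 k0 by (intro mult_mono add_mono) auto
      ultimately have "2 * m * M\<^sup>2 * q (Suc i)^3 \<le> 2 * m * M\<^sup>2 * k^3"
         "e * M * (q (Suc i) * (q (Suc i) + q i)) \<le> e * M * (k * (k + k))"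
        using M(1) e m_pos by (auto intro!: mult_left_mono)
      then show ?thesis by (simp add: RV_def power2_eq_square mult.assoc)
    qed
    ultimately have "m * (q (Suc i))\<^sup>2 + s (Suc i) - RV \<le> - l i * (w (Suc i) \<bullet> A (x (Suc i)) (w (Suc i)))" by linarith
    then have "(\<phi> (Suc i))\<^sup>2 * (m * (q (Suc i))\<^sup>2 + s (Suc i) - RV)
        \<le> (\<phi> (Suc i))\<^sup>2 * (- l i * (w (Suc i) \<bullet> A (x (Suc i)) (w (Suc i))))" by (rule mult_left_mono) simp
    also have "\<dots> = - l i * (v (Suc i) \<bullet> A (x (Suc i)) (v (Suc i)))"
      using linear_scale[OF shape_linear[OF S(2)]] by (simp add: v_def power2_eq_square)
    finally have "(\<phi> (Suc i))\<^sup>2 * (m * (q (Suc i))\<^sup>2 + s (Suc i)) - (\<phi> (Suc i))\<^sup>2 * RV \<le> - l i * (v (Suc i) \<bullet> A (x (Suc i)) (v (Suc i)))"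
      by (simp add: algebra_simps)
    moreover have "(\<phi> (Suc i))\<^sup>2 * RV \<le> 1 * RV"
      using \<phi>01[of "Suc i"] i RV0 by (intro mult_right_mono) (auto simp: power_le_one)
    ultimately show ?thesis by (simp add: algebra_simps)
  next
    case False
    then have "Suc i = n" using i by simp
    then show ?thesis using \<phi>_ends v(2) RV0 by simp
  qed
  have shift: "(\<Sum>i<n. f (Suc i)) = (\<Sum>i<n. f i)" if "f 0 = 0" "f n = 0" for f :: "nat \<Rightarrow> real"
    using sum_lessThan_telescope[of f n] that by (simp add: sum_subtractf)
  have "(\<Sum>i<n. m * ((\<phi> i)\<^sup>2 * (q i)\<^sup>2) + (\<phi> i)\<^sup>2 * s i) - real n * RV
     = (\<Sum>i<n. m * ((\<phi> (Suc i))\<^sup>2 * (q (Suc i))\<^sup>2) + (\<phi> (Suc i))\<^sup>2 * s (Suc i)) - real n * RV"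
    using shift[of "\<lambda>i. m * ((\<phi> i)\<^sup>2 * (q i)\<^sup>2) + (\<phi> i)\<^sup>2 * s i"] by (simp add: \<phi>_ends)
  also have "\<dots> = (\<Sum>i<n. m * ((\<phi> (Suc i))\<^sup>2 * (q (Suc i))\<^sup>2) + (\<phi> (Suc i))\<^sup>2 * s (Suc i) - RV)"
    by (simp add: sum_subtractf)
  also have "\<dots> \<le> (\<Sum>i<n. - l i * (v (Suc i) \<bullet> A (x (Suc i)) (v (Suc i))))"
    by (intro sum_mono vertex_bd) auto
  also have "\<dots> \<le> (\<Sum>i<n. (norm (edge v i))\<^sup>2)"
    using minimal_chain_second_order[OF x v] by (simp add: l_def)
  also have "\<dots> \<le> (\<Sum>i<n. (\<phi> (Suc i) - \<phi> i)\<^sup>2 * q i + (\<phi> i)\<^sup>2 * s i + RE)"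
    by (intro sum_mono edge_bd) auto
  finally have "m * (\<Sum>i<n. (\<phi> i)\<^sup>2 * (q i)\<^sup>2) \<le> (\<Sum>i<n. (\<phi> (Suc i) - \<phi> i)\<^sup>2 * q i) + real n * (RE + RV)"
    by (simp add: sum.distrib sum_distrib_left algebra_simps)
  also have "RE + RV = (3 * (pi / real n) * M\<^sup>2 + 4 * M * e + e\<^sup>2) * k\<^sup>2 + (M^4 + 2 * m * M\<^sup>2) * k^3"
    by (simp add: RE_def RV_def algebra_simps)
  finally show ?thesis .
qed

text \<open>With \<open>X = n\<^sup>2 q\<close>, where \<open>q\<close> is one of the nearly equal squared edge lengths, the sine test becomes
\<open>m X\<^sup>2 \<le> pi\<^sup>2 X + T n\<close>, where \<open>T n\<close> is eventually below a prescribed \<open>\<eta>\<close> if the quality \<open>r\<close> of the contact is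
chosen small enough. The hypothesis on \<open>C\<close> is satisfied if a Lipschitz path on the surface joins the end points.\<close>

lemma minimal_chain_edge_bound:
  assumes C: "\<And>n. n \<ge> 1 \<Longrightarrow> \<exists>y. chain S a b n y \<and> energy n y \<le> C / real n" and e: "e > 0"
  shows "\<forall>\<^sub>F n in sequentially. \<forall>x. minimal_chain S a b n x \<longrightarrow>
    (\<forall>i<n. m * ((real n)\<^sup>2 * (norm (edge x i))\<^sup>2) \<le> pi\<^sup>2 + e)"
proof -
  obtain M where M: "M \<ge> 1" "\<And>x v. x \<in> S \<Longrightarrow> norm (A x v) \<le> M * norm v"
      "\<And>x y. x \<in> S \<Longrightarrow> y \<in> S \<Longrightarrow> \<bar>\<nu> x \<bullet> (y - x)\<bar> \<le> M * (norm (y - x))\<^sup>2"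
      "\<And>x y. x \<in> S \<Longrightarrow> y \<in> S \<Longrightarrow> norm (\<nu> y - \<nu> x) \<le> M * norm (y - x)"
    using uniform_bounds by metis
  define B where "B = M\<^sup>2"
  define K where "K = C * exp (8 * B * C)"
  define K2 where "K2 = 4 * B * K\<^sup>2"
  have B0: "B \<ge> 0" by (simp add: B_def)
  \<comment> \<open>If \<open>m X > pi\<^sup>2 + e\<close>, then \<open>m X\<^sup>2 - pi\<^sup>2 X > e X > e pi\<^sup>2 / m\<close>; this is the threshold that the error must not reach.\<close>
  define \<eta> where "\<eta> = e * pi\<^sup>2 / m"
  have \<eta>: "\<eta> > 0" using e m_pos by (simp add: \<eta>_def)
  define r where "r = min 1 (\<eta> / (4 * (4 * M + 1) * (K\<^sup>2 + 1)))"
  have pos: "4 * (4 * M + 1) * (K\<^sup>2 + 1) > 0" using M(1) by (intro mult_pos_pos) (auto intro: add_nonneg_pos)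
  have r: "r > 0" "r \<le> 1" using \<eta> pos by (auto simp: r_def)
  have r_small: "2 * (4 * M * r + r\<^sup>2) * K\<^sup>2 < \<eta>"
  proof -
    have "r\<^sup>2 \<le> r" using r by (simp add: power2_eq_square mult_left_le)
    then have "2 * (4 * M * r + r\<^sup>2) * K\<^sup>2 \<le> 2 * ((4 * M + 1) * r) * (K\<^sup>2 + 1)"
      using M(1) r by (intro mult_mono) (auto simp: algebra_simps)
    also have "\<dots> = r * (4 * (4 * M + 1) * (K\<^sup>2 + 1)) / 2" by simp
    also have "\<dots> \<le> (\<eta> / (4 * (4 * M + 1) * (K\<^sup>2 + 1))) * (4 * (4 * M + 1) * (K\<^sup>2 + 1)) / 2"
      by (intro divide_right_mono mult_right_mono) (use pos in \<open>auto simp: r_def\<close>)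
    also have "\<dots> = \<eta> / 2"
    proof -
      have "\<eta> / c * c / 2 = \<eta> / 2" if "c > 0" for c using that by simp
      from this[OF pos] show ?thesis .
    qed
    finally show ?thesis using \<eta> by simp
  qed
  obtain d1 where d1: "d1 > 0" "\<And>x y. x \<in> S \<Longrightarrow> y \<in> S \<Longrightarrow> norm (y - x) < d1 \<Longrightarrow>
      norm (\<nu> y - \<nu> x - A x (y - x)) \<le> r * norm (y - x)" using normal_expansion[OF r(1)] by blast
  obtain d2 where d2: "d2 > 0" "\<And>x y. x \<in> S \<Longrightarrow> y \<in> S \<Longrightarrow> norm (y - x) < d2 \<Longrightarrow>
      \<bar>\<nu> x \<bullet> (y - x) + (y - x) \<bullet> A x (y - x) / 2\<bar> \<le> r * (norm (y - x))\<^sup>2" using contact[OF r(1)] by blast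
  define d where "d = min d1 d2"
  have d: "d > 0" using d1 d2 by (simp add: d_def)
  define T where "T n = (2 * m * K * K2 + pi\<^sup>2 * K2) / real n
     + 2 * ((3 * (pi / real n) * M\<^sup>2 + 4 * M * r + r\<^sup>2) * K\<^sup>2 + (M^4 + 2 * m * M\<^sup>2) * (K^3 / (real n)\<^sup>2))" for n :: nat
  have "T \<longlonglongrightarrow> 0 + 2 * ((3 * 0 * M\<^sup>2 + 4 * M * r + r\<^sup>2) * K\<^sup>2 + (M^4 + 2 * m * M\<^sup>2) * 0)"
    unfolding T_def by (intro tendsto_intros lim_const_over_n tendsto_divide_0[OF tendsto_const]
        filterlim_at_top_imp_at_infinity filterlim_pow_at_top filterlim_real_sequentially) auto
  then have T: "\<forall>\<^sub>F n in sequentially. T n < \<eta>"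
    by (rule order_tendstoD) (use r_small in \<open>simp add: algebra_simps\<close>)
  have "(\<lambda>n. K / (real n)\<^sup>2) \<longlonglongrightarrow> 0"
    by (intro tendsto_divide_0[OF tendsto_const] filterlim_at_top_imp_at_infinity filterlim_pow_at_top filterlim_real_sequentially) auto
  then have D: "\<forall>\<^sub>F n in sequentially. K / (real n)\<^sup>2 < d\<^sup>2" by (rule order_tendstoD) (use d in simp)
  have N: "\<forall>\<^sub>F n in sequentially. n \<ge> 2 \<and> 4 * B * C \<le> real n"
    using eventually_ge_at_top[of "max 2 (nat \<lceil>4 * B * C\<rceil>)"] by eventually_elim linarith
  show ?thesis using T D N
  proof eventually_elim
    case (elim n)
    then have n: "n \<ge> 2" "4 * B * C \<le> real n" by auto
    show ?case
    proof (intro allI impI)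
      fix x j assume x: "minimal_chain S a b n x" and j: "j < n"
      define q where "q i = (norm (edge x i))\<^sup>2" for i
      define \<phi> where "\<phi> i = sin (pi * real i / real n)" for i :: nat
      have "(\<Sum>i<n. q i) \<le> C / real n"
      proof -
        obtain y where y: "chain S a b n y" "energy n y \<le> C / real n" using C[of n] n by auto
        then have "energy n x \<le> energy n y" using x by (auto simp: minimal_chain_def)
        then show ?thesis using y by (simp add: energy_def q_def)
      qed
      note near = nearly_equal_terms[of q B n C, OF _ B0 _ n(2) this]
      have stp: "\<bar>q (Suc i) - q i\<bar> \<le> B * (q (Suc i) + q i)\<^sup>2" if "Suc i < n" for i
        using edge_length_variation[OF x that M(3)] M(1) by (simp add: q_def B_def)
      have q0: "q i \<ge> 0" for i by (simp add: q_def)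
      have qK: "q i \<le> K / (real n)\<^sup>2" if "i < n" for i
        unfolding K_def by (rule near(1)[OF _ _ _ that that]) (use q0 n stp in auto)
      have qq: "\<bar>q i - q j\<bar> \<le> K2 / (real n)^3" if "i < n" for i
        unfolding K_def K2_def by (rule near(2)[OF _ _ _ that j]) (use q0 n stp in auto)
      define k where "k = K / (real n)\<^sup>2"
      define X where "X = (real n)\<^sup>2 * q j"
      have R0: "K2 / (real n)^3 \<ge> 0" using B0 by (simp add: K2_def)
      have "m * (\<Sum>i<n. (\<phi> i)\<^sup>2 * (q i)\<^sup>2) \<le> (\<Sum>i<n. (\<phi> (Suc i) - \<phi> i)\<^sup>2 * q i)
        + real n * ((3 * (pi / real n) * M\<^sup>2 + 4 * M * r + r\<^sup>2) * k\<^sup>2 + (M^4 + 2 * m * M\<^sup>2) * k^3)"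
        unfolding q_def \<phi>_def
      proof (rule minimal_chain_sine_test[OF x n(1) M, of r d])
        show "norm (edge x i) < d" if "i < n" for i
        proof (rule power2_less_imp_less)
          show "(norm (edge x i))\<^sup>2 < d\<^sup>2" using qK[OF that] elim(2) by (simp add: q_def)
        qed (use d in simp)
        show "(norm (edge x i))\<^sup>2 \<le> k" if "i < n" for i using qK[OF that] by (simp add: q_def k_def)
      qed (use r d1 d2 in \<open>auto simp: d_def\<close>)
      moreover have "m * ((real n / 2) * ((q j)\<^sup>2 - K2 / (real n)^3 * (2 * k))) \<le> m * (\<Sum>i<n. (\<phi> i)\<^sup>2 * (q i)\<^sup>2)"
      proof -
        have "(\<phi> i)\<^sup>2 * ((q j)\<^sup>2 - K2 / (real n)^3 * (2 * k)) \<le> (\<phi> i)\<^sup>2 * (q i)\<^sup>2" if "i < n" for i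
        proof (rule mult_left_mono)
          have "(q j)\<^sup>2 - (q i)\<^sup>2 = (q j - q i) * (q j + q i)" by (simp add: power2_eq_square algebra_simps)
          also have "\<dots> \<le> (K2 / (real n)^3) * (q j + q i)"
            using qq[OF that] q0[of i] q0[of j] by (intro mult_right_mono) (auto simp: abs_le_iff)
          also have "\<dots> \<le> (K2 / (real n)^3) * (2 * k)"
            using qK[OF that] qK[OF j] R0 by (intro mult_left_mono) (auto simp: k_def)
          finally show "(q j)\<^sup>2 - K2 / (real n)^3 * (2 * k) \<le> (q i)\<^sup>2" by simp
        qed simp
        then have "(\<Sum>i<n. (\<phi> i)\<^sup>2) * ((q j)\<^sup>2 - K2 / (real n)^3 * (2 * k)) \<le> (\<Sum>i<n. (\<phi> i)\<^sup>2 * (q i)\<^sup>2)"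
          unfolding sum_distrib_right by (intro sum_mono) auto
        moreover have "(\<Sum>i<n. (\<phi> i)\<^sup>2) = real n / 2" unfolding \<phi>_def by (rule sum_sin_squared[OF n(1)])
        ultimately show ?thesis using m_pos by (intro mult_left_mono) auto
      qed
      moreover have "(\<Sum>i<n. (\<phi> (Suc i) - \<phi> i)\<^sup>2 * q i) \<le> ((pi / real n)\<^sup>2 * (real n / 2)) * (q j + K2 / (real n)^3)"
      proof -
        have "(\<Sum>i<n. (\<phi> (Suc i) - \<phi> i)\<^sup>2 * q i) \<le> (\<Sum>i<n. (\<phi> (Suc i) - \<phi> i)\<^sup>2) * (q j + K2 / (real n)^3)"
          unfolding sum_distrib_right
        proof (intro sum_mono mult_left_mono)
          fix i assume "i \<in> {..<n}"
          then have "\<bar>q i - q j\<bar> \<le> K2 / (real n)^3" using qq by simp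
          then show "q i \<le> q j + K2 / (real n)^3" by linarith
        qed simp
        also have "\<dots> \<le> ((pi / real n)\<^sup>2 * (real n / 2)) * (q j + K2 / (real n)^3)"
          using sum_sin_diff_squared[OF n(1)] R0 q0[of j] unfolding \<phi>_def by (intro mult_right_mono) auto
        finally show ?thesis .
      qed
      ultimately have main: "m * ((real n / 2) * ((q j)\<^sup>2 - K2 / (real n)^3 * (2 * k)))
         \<le> ((pi / real n)\<^sup>2 * (real n / 2)) * (q j + K2 / (real n)^3)
          + real n * ((3 * (pi / real n) * M\<^sup>2 + 4 * M * r + r\<^sup>2) * k\<^sup>2 + (M^4 + 2 * m * M\<^sup>2) * k^3)"
        by linarith
      have n0: "real n > 0" using n by simp
      have mX: "m * X\<^sup>2 \<le> pi\<^sup>2 * X + T n"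
      proof -
        define E where "E = 3 * (pi / real n) * M\<^sup>2 + 4 * M * r + r\<^sup>2"
        define F where "F = M^4 + 2 * m * M\<^sup>2"
        have "2 * (real n)^3 * (m * ((real n / 2) * ((q j)\<^sup>2 - K2 / (real n)^3 * (2 * k))))
          \<le> 2 * (real n)^3 * (((pi / real n)\<^sup>2 * (real n / 2)) * (q j + K2 / (real n)^3)
          + real n * (E * k\<^sup>2 + F * k^3))"
          by (rule mult_left_mono) (use main in \<open>simp_all add: E_def F_def\<close>)
        moreover have "2 * (real n)^3 * (m * ((real n / 2) * ((q j)\<^sup>2 - K2 / (real n)^3 * (2 * k))))
          = m * X\<^sup>2 - 2 * m * K * K2 / real n"
          using n0 by (simp add: X_def k_def field_simps power_numeral_reduce)
        moreover have "2 * (real n)^3 * (((pi / real n)\<^sup>2 * (real n / 2)) * (q j + K2 / (real n)^3)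
          + real n * (E * k\<^sup>2 + F * k^3)) = pi\<^sup>2 * X + pi\<^sup>2 * K2 / real n + 2 * (E * K\<^sup>2 + F * (K^3 / (real n)\<^sup>2))"
          using n0 by (simp add: X_def k_def field_simps power_numeral_reduce)
        ultimately show ?thesis unfolding T_def E_def[symmetric] F_def[symmetric] by (simp add: add_divide_distrib)
      qed
      show "m * ((real n)\<^sup>2 * (norm (edge x j))\<^sup>2) \<le> pi\<^sup>2 + e"
      proof (rule ccontr)
        assume "\<not> ?thesis"
        then have gt: "m * X > pi\<^sup>2 + e" by (simp add: X_def q_def)
        then have "X > pi\<^sup>2 / m" using m_pos e by (simp add: field_simps)
        then have "e * X > \<eta>" using e m_pos by (simp add: \<eta>_def field_simps)
        moreover have "X > 0" using \<open>X > pi\<^sup>2 / m\<close> m_pos by (smt (verit) divide_nonneg_pos zero_le_power2)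
        then have "X * (m * X) \<ge> X * (pi\<^sup>2 + e)" using gt by (intro mult_left_mono) auto
        ultimately show False using mX elim(1) by (simp add: power2_eq_square algebra_simps)
      qed
    qed
  qed
qed
end

section \<open>Smooth functions and second derivatives\<close>

lemma Ck_on_SucD: "Ck_on (Suc k) f S \<Longrightarrow> Ck_on k f S"
proof (induction k arbitrary: f)
  case 0
  then obtain f' where "\<forall>x\<in>S. (f has_derivative f' x) (at x within S)" by auto
  then show ?case by (auto intro: has_derivative_continuous_on)
next
  case (Suc k)
  from Suc.prems obtain f' where "\<forall>x\<in>S. (f has_derivative f' x) (at x within S)"
    "\<forall>v. Ck_on (Suc k) (\<lambda>x. f' x v) S" by (subst (asm) Ck_on.simps) blast
  with Suc.IH show ?case by (subst Ck_on.simps) blast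
qed

lemma Ck_on_cong:
  assumes "\<And>x. x \<in> S \<Longrightarrow> f x = g x" "Ck_on k f S"
  shows "Ck_on k g S"
proof (cases k)
  case 0
  then show ?thesis using assms continuous_on_cong[of S S f g] by simp
next
  case (Suc j)
  with assms(2) obtain f' where f': "\<forall>x\<in>S. (f has_derivative f' x) (at x within S)" "\<forall>v. Ck_on j (\<lambda>x. f' x v) S" by auto
  have "(g has_derivative f' x) (at x within S)" if "x \<in> S" for x
    by (rule has_derivative_transform[OF that assms(1)[symmetric] bspec[OF f'(1) that]])
  with f'(2) Suc show ?thesis by auto
qed

lemma Ck_on_const: "Ck_on k (\<lambda>x. c) S"
proof (induction k arbitrary: c)
  case (Suc k)
  show ?case by (auto intro!: exI[of _ "\<lambda>x v. 0"] Suc)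
qed auto

lemma Ck_on_ident: "Ck_on k (\<lambda>x. x) S"
proof (cases k)
  case (Suc j)
  then show ?thesis by (auto intro!: exI[of _ "\<lambda>x v. v"] Ck_on_const)
qed (simp add: continuous_on_id)

lemma Ck_on_bounded_linear:
  assumes "bounded_linear h" "Ck_on k f S"
  shows "Ck_on k (\<lambda>x. h (f x)) S"
  using assms(2)
proof (induction k arbitrary: f)
  case 0
  then show ?case using bounded_linear.continuous_on[OF assms(1)] by simp
next
  case (Suc k)
  then obtain f' where f': "\<forall>x\<in>S. (f has_derivative f' x) (at x within S)" "\<forall>v. Ck_on k (\<lambda>x. f' x v) S" by auto
  have "\<forall>x\<in>S. ((\<lambda>x. h (f x)) has_derivative (\<lambda>v. h (f' x v))) (at x within S)"
    by (intro ballI bounded_linear.has_derivative[OF assms(1)] bspec[OF f'(1)])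
  then show ?case using f'(2) Suc.IH by (auto intro!: exI[of _ "\<lambda>x v. h (f' x v)"])
qed

lemma Ck_on_add:
  assumes "Ck_on k f S" "Ck_on k g S"
  shows "Ck_on k (\<lambda>x. f x + g x) S"
  using assms
proof (induction k arbitrary: f g)
  case 0
  then show ?case by (auto intro: continuous_intros)
next
  case (Suc k)
  then obtain f' g' where "\<forall>x\<in>S. (f has_derivative f' x) (at x within S)" "\<forall>v. Ck_on k (\<lambda>x. f' x v) S"
    "\<forall>x\<in>S. (g has_derivative g' x) (at x within S)" "\<forall>v. Ck_on k (\<lambda>x. g' x v) S" by auto
  then show ?case using Suc.IH
    by (auto intro!: exI[of _ "\<lambda>x v. f' x v + g' x v"] derivative_intros)
qed

lemma Ck_on_bilinear:
  assumes "bounded_bilinear mul" "Ck_on k f S" "Ck_on k g S"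
  shows "Ck_on k (\<lambda>x. mul (f x) (g x)) S"
  using assms(2,3)
proof (induction k arbitrary: f g)
  case 0
  then show ?case using bounded_bilinear.continuous_on[OF assms(1)] by simp
next
  case (Suc k)
  then obtain f' g' where d: "\<forall>x\<in>S. (f has_derivative f' x) (at x within S)" "\<forall>v. Ck_on k (\<lambda>x. f' x v) S"
    "\<forall>x\<in>S. (g has_derivative g' x) (at x within S)" "\<forall>v. Ck_on k (\<lambda>x. g' x v) S" by auto
  have fg: "Ck_on k f S" "Ck_on k g S" using Suc.prems Ck_on_SucD by auto
  have "\<forall>v. Ck_on k (\<lambda>x. mul (f x) (g' x v) + mul (f' x v) (g x)) S"
    using Suc.IH fg d by (auto intro!: Ck_on_add)
  moreover have "\<forall>x\<in>S. ((\<lambda>x. mul (f x) (g x)) has_derivative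
      (\<lambda>v. mul (f x) (g' x v) + mul (f' x v) (g x))) (at x within S)"
    by (intro ballI bounded_bilinear.FDERIV[OF assms(1)] bspec[OF d(1)] bspec[OF d(3)])
  ultimately show ?case
    by (auto intro!: exI[of _ "\<lambda>x v. mul (f x) (g' x v) + mul (f' x v) (g x)"])
qed

lemma Ck_on_inverse:
  fixes f :: "'a::real_normed_vector \<Rightarrow> real"
  assumes "Ck_on k f S" "\<And>x. x \<in> S \<Longrightarrow> f x \<noteq> 0"
  shows "Ck_on k (\<lambda>x. inverse (f x)) S"
  using assms(1)
proof (induction k)
  case 0
  then show ?case using assms(2) by (auto intro!: continuous_intros)
next
  case (Suc k)
  then obtain f' where d: "\<forall>x\<in>S. (f has_derivative f' x) (at x within S)" "\<forall>v. Ck_on k (\<lambda>x. f' x v) S" by auto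
  have i: "Ck_on k (\<lambda>x. inverse (f x)) S" using Suc Ck_on_SucD by blast
  have "Ck_on k (\<lambda>x. - (inverse (f x) * f' x v * inverse (f x))) S" for v
    by (intro Ck_on_bounded_linear[of uminus] bounded_linear_minus bounded_linear_ident
        Ck_on_bilinear[of "(*)"] bounded_bilinear_mult i d(2)[rule_format])
  moreover have "((\<lambda>x. inverse (f x)) has_derivative (\<lambda>v. - (inverse (f x) * f' x v * inverse (f x)))) (at x within S)"
    if "x \<in> S" for x
    using d(1) that assms(2) by (auto intro!: Deriv.has_derivative_inverse)
  ultimately show ?case by (auto intro!: exI[of _ "\<lambda>x v. - (inverse (f x) * f' x v * inverse (f x))"])
qed

lemma Ck_on_line:
  fixes f :: "'a::real_normed_vector \<Rightarrow> 'b::real_normed_vector" and I :: "real set"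
  assumes "Ck_on k f U" and U: "\<And>t. t \<in> I \<Longrightarrow> p + t *\<^sub>R u \<in> U"
  shows "Ck_on k (\<lambda>t. f (p + t *\<^sub>R u)) I"
  using assms(1)
proof (induction k arbitrary: f)
  case 0
  then show ?case
    by (auto intro!: continuous_on_compose2[of U f] continuous_intros U)
next
  case (Suc k)
  then obtain f' where d: "\<forall>x\<in>U. (f has_derivative f' x) (at x within U)" "\<forall>v. Ck_on k (\<lambda>x. f' x v) U" by auto
  have lin: "linear (f' x)" if "x \<in> U" for x using d that has_derivative_linear by blast
  have "((\<lambda>t. f (p + t *\<^sub>R u)) has_derivative (\<lambda>s. s *\<^sub>R f' (p + t *\<^sub>R u) u)) (at t within I)" if t: "t \<in> I" for t
  proof -
    have "((\<lambda>t. p + t *\<^sub>R u) has_derivative (\<lambda>s. s *\<^sub>R u)) (at t within I)"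
      by (auto intro!: derivative_eq_intros)
    moreover have "(f has_derivative f' (p + t *\<^sub>R u)) (at (p + t *\<^sub>R u) within (\<lambda>t. p + t *\<^sub>R u) ` I)"
      using d(1) U t by (auto intro: has_derivative_subset[of _ _ _ U])
    ultimately have "(f \<circ> (\<lambda>t. p + t *\<^sub>R u) has_derivative f' (p + t *\<^sub>R u) \<circ> (\<lambda>s. s *\<^sub>R u)) (at t within I)"
      by (rule diff_chain_within)
    then show ?thesis using linear_scale[OF lin[OF U[OF t]]] by (simp add: o_def)
  qed
  moreover have "Ck_on k (\<lambda>t. s *\<^sub>R f' (p + t *\<^sub>R u) u) I" for s
    by (intro Ck_on_bounded_linear[of "\<lambda>y. s *\<^sub>R y"] bounded_linear_scaleR_right Suc.IH[of "\<lambda>x. f' x u"] d(2)[rule_format])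
  ultimately show ?case by (auto intro!: exI[of _ "\<lambda>t s. s *\<^sub>R f' (p + t *\<^sub>R u) u"])
qed

text \<open>Schwarz's theorem for a gradient that is differentiable at the single point \<open>x\<close>: by the mean value theorem
the second difference of \<open>f\<close> in the directions \<open>v\<close> and \<open>w\<close> is \<open>s\<^sup>2 (H w \<bullet> v)\<close> up to an error of smaller order, and the second
difference is symmetric in \<open>v\<close> and \<open>w\<close>.\<close>

lemma symmetric_second_derivative:
  fixes f :: "'a::real_inner \<Rightarrow> real" and G :: "'a \<Rightarrow> 'a"
  assumes U: "open U" "x \<in> U" and f: "\<And>y. y \<in> U \<Longrightarrow> (f has_derivative (\<lambda>v. G y \<bullet> v)) (at y)"
    and G: "(G has_derivative H) (at x)"
  shows "H v \<bullet> w = v \<bullet> H w"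
proof -
  define c where "c = norm v + norm w"
  define \<Delta> where "\<Delta> s = f (x + s *\<^sub>R v + s *\<^sub>R w) - f (x + s *\<^sub>R v) - f (x + s *\<^sub>R w) + f x" for s
  have lin: "linear H" using G has_derivative_linear by blast
  have key: "\<exists>s0>0. \<forall>s. 0 < s \<and> s < s0 \<longrightarrow>
      \<bar>(f (x + s *\<^sub>R v + s *\<^sub>R w) - f (x + s *\<^sub>R v) - f (x + s *\<^sub>R w) + f x) - s\<^sup>2 * (H w \<bullet> v)\<bar> \<le> 2 * e * s\<^sup>2 * (norm v + norm w)\<^sup>2"
    if e: "e > 0" for e and v w
  proof -
    let ?c = "norm v + norm w + 1"
    obtain d1 where d1: "d1 > 0" "\<And>y. norm (y - x) < d1 \<Longrightarrow> norm (G y - G x - H (y - x)) \<le> e * norm (y - x)"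
      using G e unfolding has_derivative_at_alt by blast
    obtain d2 where d2: "d2 > 0" "ball x d2 \<subseteq> U" using U open_contains_ball by blast
    define s0 where "s0 = min d1 d2 / ?c"
    have c: "?c > 0" by (simp add: add_nonneg_pos)
    have "s0 > 0" using d1 d2 c by (simp add: s0_def)
    moreover have "\<bar>(f (x + s *\<^sub>R v + s *\<^sub>R w) - f (x + s *\<^sub>R v) - f (x + s *\<^sub>R w) + f x) - s\<^sup>2 * (H w \<bullet> v)\<bar> \<le> 2 * e * s\<^sup>2 * (norm v + norm w)\<^sup>2"
      if s: "0 < s" "s < s0" for s
    proof -
      have sc: "s * ?c < d1" "s * ?c < d2" using s c by (auto simp: s0_def pos_less_divide_eq min_mult_distrib_right min_less_iff_conj)
      have near: "norm ((t * s) *\<^sub>R v + r *\<^sub>R w) \<le> s * (norm v + norm w)" if "0 \<le> t" "t \<le> 1" "0 \<le> r" "r \<le> s" for t r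
      proof -
        have "norm ((t * s) *\<^sub>R v + r *\<^sub>R w) \<le> (t * s) * norm v + r * norm w"
          using norm_triangle_ineq[of "(t * s) *\<^sub>R v" "r *\<^sub>R w"] that s by simp
        also have "\<dots> \<le> s * norm v + s * norm w"
          using that s by (intro add_mono mult_right_mono) (auto simp: mult_left_le_one_le)
        finally show ?thesis by (simp add: distrib_left)
      qed
      have sc': "s * (norm v + norm w) < d1" "s * (norm v + norm w) < d2" using sc s by (auto simp: algebra_simps)
      have inU: "x + ((t * s) *\<^sub>R v + r *\<^sub>R w) \<in> U" if "0 \<le> t" "t \<le> 1" "0 \<le> r" "r \<le> s" for t r

      proof -
        have "x + ((t * s) *\<^sub>R v + r *\<^sub>R w) \<in> ball x d2"
        proof -
          have "dist x (x + a) = norm a" for a :: 'a by (simp add: dist_norm)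
          then show ?thesis using near[OF that] sc'(2) by (simp only: mem_ball)
        qed
        then show ?thesis using d2(2) by blast
      qed
      define \<phi> where "\<phi> t = f (x + ((t * s) *\<^sub>R v + s *\<^sub>R w)) - f (x + ((t * s) *\<^sub>R v + 0 *\<^sub>R w))" for t
      define \<phi>' where "\<phi>' t = s * ((G (x + ((t * s) *\<^sub>R v + s *\<^sub>R w)) - G (x + ((t * s) *\<^sub>R v + 0 *\<^sub>R w))) \<bullet> v)" for t
      have part: "((\<lambda>t. f (x + ((t * s) *\<^sub>R v + r *\<^sub>R w))) has_derivative (\<lambda>h. h * (s * (G (x + ((t * s) *\<^sub>R v + r *\<^sub>R w)) \<bullet> v)))) (at t)"
        if "0 \<le> t" "t \<le> 1" "0 \<le> r" "r \<le> s" for t r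
      proof -
        have "((\<lambda>t. x + ((t * s) *\<^sub>R v + r *\<^sub>R w)) has_derivative (\<lambda>h. (h * s) *\<^sub>R v)) (at t)"
          by (auto intro!: derivative_eq_intros)
        from diff_chain_at[OF this f[OF inU[OF that]]] show ?thesis by (simp add: o_def mult_ac)
      qed
      have "DERIV \<phi> t :> \<phi>' t" if "0 \<le> t" "t \<le> 1" for t
      proof -
        have "(\<phi> has_derivative (\<lambda>h. h * (s * (G (x + ((t * s) *\<^sub>R v + s *\<^sub>R w)) \<bullet> v)) - h * (s * (G (x + ((t * s) *\<^sub>R v + 0 *\<^sub>R w)) \<bullet> v)))) (at t)"
          unfolding \<phi>_def by (intro has_derivative_diff part) (use that s in auto)
        moreover have "(\<lambda>h. h * (s * (G (x + ((t * s) *\<^sub>R v + s *\<^sub>R w)) \<bullet> v)) - h * (s * (G (x + ((t * s) *\<^sub>R v + 0 *\<^sub>R w)) \<bullet> v))) = (*) (\<phi>' t)"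
          by (auto simp: \<phi>'_def inner_diff_left algebra_simps)
        ultimately show ?thesis by (simp add: has_field_derivative_def)
      qed
      then obtain t where t: "0 < t" "t < 1" "\<phi> 1 - \<phi> 0 = \<phi>' t" using MVT2[of 0 1 \<phi> \<phi>'] by auto
      let ?a = "(t * s) *\<^sub>R v + s *\<^sub>R w" and ?b = "(t * s) *\<^sub>R v + 0 *\<^sub>R w"
      have na: "norm ?a \<le> s * (norm v + norm w)" by (rule near) (use t s in auto)
      have nb: "norm ?b \<le> s * (norm v + norm w)" by (rule near) (use t s in auto)
      have ea: "norm (G (x + ?a) - G x - H ?a) \<le> e * (s * (norm v + norm w))"
      proof -
        have "norm (G (x + ?a) - G x - H ?a) \<le> e * norm ?a" using d1(2)[of "x + ?a"] na sc' by simp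
        also have "\<dots> \<le> e * (s * (norm v + norm w))" using na e by (intro mult_left_mono) auto
        finally show ?thesis .
      qed
      have eb: "norm (G (x + ?b) - G x - H ?b) \<le> e * (s * (norm v + norm w))"
      proof -
        have "norm (G (x + ?b) - G x - H ?b) \<le> e * norm ?b" using d1(2)[of "x + ?b"] nb sc' by simp
        also have "\<dots> \<le> e * (s * (norm v + norm w))" using nb e by (intro mult_left_mono) auto
        finally show ?thesis .
      qed
      have Hw: "H ?a - H ?b = s *\<^sub>R H w" using lin by (simp add: linear_add linear_scale)
      have "norm (G (x + ?a) - G (x + ?b) - s *\<^sub>R H w) \<le> 2 * e * s * (norm v + norm w)"
      proof -
        have "G (x + ?a) - G (x + ?b) - s *\<^sub>R H w = (G (x + ?a) - G x - H ?a) - (G (x + ?b) - G x - H ?b)"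
          unfolding Hw[symmetric] by simp
        then have "norm (G (x + ?a) - G (x + ?b) - s *\<^sub>R H w)
           \<le> norm (G (x + ?a) - G x - H ?a) + norm (G (x + ?b) - G x - H ?b)" by (simp only: norm_triangle_ineq4)
        then show ?thesis using ea eb by simp
      qed
      then have "\<bar>(G (x + ?a) - G (x + ?b) - s *\<^sub>R H w) \<bullet> v\<bar> \<le> (2 * e * s * (norm v + norm w)) * (norm v + norm w)"
        by (intro order_trans[OF Cauchy_Schwarz_ineq2] mult_mono) (use e s in auto)
      then have "s * \<bar>(G (x + ?a) - G (x + ?b) - s *\<^sub>R H w) \<bullet> v\<bar> \<le> s * ((2 * e * s * (norm v + norm w)) * (norm v + norm w))"
        using s by (intro mult_left_mono) auto
      moreover have "\<phi>' t - s\<^sup>2 * (H w \<bullet> v) = s * ((G (x + ?a) - G (x + ?b) - s *\<^sub>R H w) \<bullet> v)"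
        by (simp add: \<phi>'_def inner_diff_left power2_eq_square algebra_simps)
      ultimately have "\<bar>\<phi>' t - s\<^sup>2 * (H w \<bullet> v)\<bar> \<le> 2 * e * s\<^sup>2 * (norm v + norm w)\<^sup>2"
        using s by (simp add: abs_mult power2_eq_square mult_ac)
      moreover have "f (x + s *\<^sub>R v + s *\<^sub>R w) - f (x + s *\<^sub>R v) - f (x + s *\<^sub>R w) + f x = \<phi> 1 - \<phi> 0"
        by (simp add: \<phi>_def add.assoc)
      ultimately show ?thesis using t(3) by simp
    qed
    ultimately show ?thesis by blast
  qed
  have "\<bar>H w \<bullet> v - H v \<bullet> w\<bar> \<le> e" if e: "e > 0" for e
  proof -
    define e' where "e' = e / (4 * (c\<^sup>2 + 1))"
    have c1: "c\<^sup>2 + 1 > 0" by (simp add: add_nonneg_pos)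
    have e': "e' > 0" using e c1 by (simp add: e'_def)
    obtain s1 where s1: "s1 > 0" "\<And>s. 0 < s \<Longrightarrow> s < s1 \<Longrightarrow> \<bar>\<Delta> s - s\<^sup>2 * (H w \<bullet> v)\<bar> \<le> 2 * e' * s\<^sup>2 * c\<^sup>2"
      using key[OF e', of v w] unfolding \<Delta>_def c_def by blast
    obtain s2 where s2: "s2 > 0" "\<And>s. 0 < s \<Longrightarrow> s < s2 \<Longrightarrow> \<bar>\<Delta> s - s\<^sup>2 * (H v \<bullet> w)\<bar> \<le> 2 * e' * s\<^sup>2 * c\<^sup>2"
      using key[OF e', of w v] unfolding \<Delta>_def c_def by (auto simp: algebra_simps)
    define s where "s = min s1 s2 / 2"
    have s: "0 < s" "s < s1" "s < s2" using s1 s2 by (auto simp: s_def)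
    have "\<bar>s\<^sup>2 * (H w \<bullet> v) - s\<^sup>2 * (H v \<bullet> w)\<bar> \<le> 4 * e' * s\<^sup>2 * c\<^sup>2"
      using s1(2)[of s] s2(2)[of s] s by linarith
    moreover have "\<bar>s\<^sup>2 * (H w \<bullet> v) - s\<^sup>2 * (H v \<bullet> w)\<bar> = s\<^sup>2 * \<bar>H w \<bullet> v - H v \<bullet> w\<bar>"
      by (simp add: right_diff_distrib[symmetric] abs_mult)
    ultimately have "s\<^sup>2 * \<bar>H w \<bullet> v - H v \<bullet> w\<bar> \<le> s\<^sup>2 * (4 * e' * c\<^sup>2)" by (simp add: mult_ac)
    then have "\<bar>H w \<bullet> v - H v \<bullet> w\<bar> \<le> 4 * e' * c\<^sup>2" using s by simp
    also have "\<dots> \<le> 4 * e' * (c\<^sup>2 + 1)" using e' by simp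
    also have "\<dots> = e"
    proof -
      have "4 * (e / (4 * k)) * k = e" if "k > 0" for k using that by simp
      from this[OF c1] show ?thesis by (simp only: e'_def)
    qed
    finally show ?thesis .
  qed
  then have "\<bar>H w \<bullet> v - H v \<bullet> w\<bar> \<le> 0" by (rule field_le_epsilon) simp
  then show ?thesis by (simp add: inner_commute)
qed

lemma uniform_linearization:
  fixes f :: "'a::euclidean_space \<Rightarrow> 'b::real_normed_vector"
  assumes U: "open U" "S \<subseteq> U" and S: "compact S"
    and f: "\<And>x. x \<in> U \<Longrightarrow> (f has_derivative D x) (at x)"
    and D: "\<And>v. continuous_on U (\<lambda>x. D x v)" and e: "e > 0"
  obtains d where "d > 0" "\<And>x. x \<in> S \<Longrightarrow> ball x d \<subseteq> U"
    "\<And>x y. x \<in> S \<Longrightarrow> norm (y - x) < d \<Longrightarrow> norm (f y - f x - D x (y - x)) \<le> e * norm (y - x)"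
proof -
  obtain r where r: "r > 0" "(\<Union>x\<in>S. cball x r) \<subseteq> U"
    using compact_subset_open_imp_cball_epsilon_subset[OF S U] by blast
  define K where "K = {x + y |x y. x \<in> S \<and> y \<in> cball 0 r}"
  have K: "compact K" unfolding K_def by (intro compact_sums S) simp
  have Kmem: "y \<in> K" if "x \<in> S" "norm (y - x) \<le> r" for x y
  proof -
    have "y = x + (y - x)" "y - x \<in> cball 0 r" using that by auto
    then show ?thesis unfolding K_def using that(1) by blast
  qed
  have KU: "K \<subseteq> U"
  proof
    fix z assume "z \<in> K"
    then obtain x y where "z = x + y" "x \<in> S" "norm y \<le> r" by (auto simp: K_def)
    then have "z \<in> cball x r" "x \<in> S" by (auto simp: dist_norm)
    then show "z \<in> U" using r(2) by blast
  qed
  define e' where "e' = e / real DIM('a)"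
  have e': "e' > 0" using e by (simp add: e'_def)
  have "\<exists>d>0. \<forall>x\<in>K. \<forall>y\<in>K. dist y x < d \<longrightarrow> dist (D y b) (D x b) < e'" for b
    using compact_uniformly_continuous[OF continuous_on_subset[OF D KU] K, of b] e' unfolding uniformly_continuous_on_def by blast
  then obtain db where db: "\<And>b. db b > 0" "\<And>b x y. x \<in> K \<Longrightarrow> y \<in> K \<Longrightarrow> dist y x < db b \<Longrightarrow> dist (D y b) (D x b) < e'"
    by metis
  define d where "d = Min (insert r (db ` Basis))"
  have d: "d > 0" "d \<le> r" using r db by (auto simp: d_def)
  have d_le: "d \<le> db b" if "b \<in> Basis" for b unfolding d_def by (rule Min_le) (use that in auto)
  have lin: "linear (D x)" if "x \<in> U" for x using f[OF that] has_derivative_linear by blast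
  show ?thesis
  proof (rule that[OF d(1)])
    fix x assume x: "x \<in> S"
    show bU: "ball x d \<subseteq> U" using r(2) x d(2) by (force simp: dist_norm)
    fix y assume y: "norm (y - x) < d"
    have "norm (f y - f x - D x (y - x)) \<le> norm (y - x) * e"
    proof (rule differentiable_bound_linearization[where S = "ball x d" and f' = D])
      show "x + t *\<^sub>R (y - x) \<in> ball x d" if "t \<in> {0..1}" for t
      proof -
        have "norm (t *\<^sub>R (y - x)) \<le> 1 * norm (y - x)" using that unfolding norm_scaleR by (intro mult_right_mono) auto
        then show ?thesis using y by (simp add: dist_norm)
      qed
      show "(f has_derivative D z) (at z within ball x d)" if "z \<in> ball x d" for z
        using f bU that has_derivative_at_withinI by blast
      show "x \<in> ball x d" using d by simp
      show "onorm (D z - D x) \<le> e" if z: "z \<in> ball x d" for z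
      proof (rule onorm_le)
        fix v
        have zU: "z \<in> U" "x \<in> U" using bU z x U by auto
        have zK: "z \<in> K" "x \<in> K" using Kmem[OF x] z d(2) r by (auto simp: dist_norm norm_minus_commute)
        have "norm (D z b - D x b) \<le> e'" if "b \<in> Basis" for b
          using db(2)[OF zK(2,1), of b] z d_le[OF that] by (auto simp: dist_norm norm_minus_commute)
        then have "norm (\<Sum>b\<in>Basis. (v \<bullet> b) *\<^sub>R (D z b - D x b)) \<le> (\<Sum>b\<in>(Basis::'a set). norm v * e')"
          by (intro sum_norm_le) (auto intro!: mult_mono Basis_le_norm)
        also have "\<dots> = e * norm v" by (simp add: e'_def)
        also have "(\<Sum>b\<in>Basis. (v \<bullet> b) *\<^sub>R (D z b - D x b)) = (D z - D x) v"
        proof -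
          have "D y v = (\<Sum>b\<in>Basis. (v \<bullet> b) *\<^sub>R D y b)" if "y \<in> U" for y
            by (subst euclidean_representation[of v, symmetric]) (simp add: linear_sum[OF lin[OF that]] linear_scale[OF lin[OF that]])
          then show ?thesis using zU by (simp add: scaleR_diff_right sum_subtractf)
        qed
        finally show "norm ((D z - D x) v) \<le> e * norm v" .
      qed
    qed
    then show "norm (f y - f x - D x (y - x)) \<le> e * norm (y - x)" by (simp add: mult.commute)
  qed
qed

section \<open>Gradient, normal and shape operator of a smooth norm\<close>

lemma gradient_eqI:
  assumes "(f has_derivative (\<lambda>v. d \<bullet> v)) (at x)"
  shows "gradient f x = d"
proof -
  have g: "GDERIV f x :> d" using assms by (simp add: gderiv_def inner_commute)
  have "d' = d" if "GDERIV f x :> d'" for d'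
  proof -
    have "(\<lambda>h. h \<bullet> d') = (\<lambda>h. h \<bullet> d)"
      by (rule has_derivative_unique) (use that g in \<open>simp_all add: gderiv_def\<close>)
    then have "\<forall>h. h \<bullet> d' = h \<bullet> d" by (simp add: fun_eq_iff)
    then show ?thesis by (simp only: vector_eq_ldot)
  qed
  with g show ?thesis unfolding gradient_def by (rule the_equality)
qed

lemma has_derivative_normalize:
  fixes g :: "'a::real_normed_vector \<Rightarrow> 'b::real_inner"
  assumes g: "(g has_derivative g') (at x)" and nz: "g x \<noteq> 0"
  shows "((\<lambda>y. (1 / norm (g y)) *\<^sub>R g y) has_derivative
    (\<lambda>v. (1 / norm (g x)) *\<^sub>R (g' v - (sgn (g x) \<bullet> g' v) *\<^sub>R sgn (g x)))) (at x)"
proof -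
  have n: "((\<lambda>y. norm (g y)) has_derivative (\<lambda>v. g' v \<bullet> sgn (g x))) (at x)"
    using diff_chain_at[OF g has_derivative_norm[OF nz]] by (simp add: o_def)
  have "((\<lambda>y. inverse (norm (g y)) *\<^sub>R g y) has_derivative
    (\<lambda>v. inverse (norm (g x)) *\<^sub>R g' v + (- (inverse (norm (g x)) * (g' v \<bullet> sgn (g x)) * inverse (norm (g x)))) *\<^sub>R g x)) (at x)"
    by (intro has_derivative_scaleR Deriv.has_derivative_inverse n g) (use nz in simp)
  moreover have "inverse (norm (g x)) *\<^sub>R g' v + (- (inverse (norm (g x)) * (g' v \<bullet> sgn (g x)) * inverse (norm (g x)))) *\<^sub>R g x
      = (1 / norm (g x)) *\<^sub>R (g' v - (sgn (g x) \<bullet> g' v) *\<^sub>R sgn (g x))" for v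
  proof -
    have "sgn (g x) = inverse (norm (g x)) *\<^sub>R g x" by (rule sgn_div_norm)
    then have "(inverse (norm (g x)) * k * inverse (norm (g x))) *\<^sub>R g x = (inverse (norm (g x)) * k) *\<^sub>R sgn (g x)" for k
      by simp
    then show ?thesis by (simp add: divide_inverse scaleR_diff_right inner_commute)
  qed
  ultimately show ?thesis by (simp add: divide_inverse)
qed

text \<open>The number in the definition of \<open>plane_det\<close> exists and is unique. Both sides are alternating bilinear functions on the
plane, so it suffices to compare them on a basis; all cross products of vectors of the plane are multiples of \<open>a\<close>.\<close>

lemma plane_det_cross:
  fixes a :: "real^3" and L :: "real^3 \<Rightarrow> real^3"
  assumes a: "norm a = 1" and L: "linear L" and La: "\<And>v. a \<bullet> L v = 0"
    and T: "T = {v. a \<bullet> v = 0}" and uv: "u \<in> T" "v \<in> T"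
  shows "L u \<times> L v = plane_det T L *\<^sub>R (u \<times> v)"
proof -
  have aa: "a \<bullet> a = 1" using a by (simp add: power2_norm_eq_inner[symmetric])
  have par: "x \<times> y = (a \<bullet> (x \<times> y)) *\<^sub>R a" if "a \<bullet> x = 0" "a \<bullet> y = 0" for x y
  proof -
    have "a \<times> (x \<times> y) = 0" by (simp add: Lagrange that)
    then have "a \<times> (a \<times> (x \<times> y)) = 0" by (simp only: cross_zero_right)
    moreover have "a \<times> (a \<times> w) = (a \<bullet> w) *\<^sub>R a - w" for w using aa by (simp add: Lagrange)
    ultimately show ?thesis by simp
  qed
  have "a \<noteq> 0" using a by auto
  then obtain i where "a \<times> axis i 1 \<noteq> 0" using cross_basis_nonzero by blast
  \<comment> \<open>The vectors \<open>p\<close>, \<open>r\<close>, \<open>a\<close> form an oriented orthonormal basis.\<close>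
  define p where "p = sgn (a \<times> axis i 1)"
  define r where "r = a \<times> p"
  have p: "a \<bullet> p = 0" "p \<bullet> p = 1"
    using \<open>a \<times> axis i 1 \<noteq> 0\<close> by (simp_all add: p_def sgn_div_norm dot_cross_self power2_norm_eq_inner[symmetric] norm_sgn dot_square_norm)
  have r: "a \<bullet> r = 0" "p \<times> r = a"
    by (simp_all add: r_def dot_cross_self Lagrange p inner_commute)
  have expand: "v = (p \<bullet> v) *\<^sub>R p + (r \<bullet> v) *\<^sub>R r" if "a \<bullet> v = 0" for v
  proof -
    have 1: "p \<times> v = (r \<bullet> v) *\<^sub>R a"
    proof -
      have "a \<bullet> (p \<times> v) = r \<bullet> v" by (simp add: r_def cross3_simps)
      then show ?thesis using par[OF p(1) that] by simp
    qed
    have 2: "p \<times> (p \<times> v) = (p \<bullet> v) *\<^sub>R p - v" by (simp add: Lagrange p)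
    have 3: "p \<times> ((r \<bullet> v) *\<^sub>R a) = - ((r \<bullet> v) *\<^sub>R r)"
      by (simp add: cross_mult_right r_def cross_skew[of p a])
    have "(p \<bullet> v) *\<^sub>R p - v = - ((r \<bullet> v) *\<^sub>R r)" using 2 unfolding 1 3 by (rule sym)
    then have "- ((p \<bullet> v) *\<^sub>R p - v) = (r \<bullet> v) *\<^sub>R r" by (simp only: minus_minus)
    then show ?thesis by (simp add: diff_eq_eq add.commute)
  qed
  define k where "k = a \<bullet> (L p \<times> L r)"
  have all: "L u \<times> L v = k *\<^sub>R (u \<times> v)" if "a \<bullet> u = 0" "a \<bullet> v = 0" for u v
  proof -
    have bil: "f u \<times> f v = ((p \<bullet> u) * (r \<bullet> v) - (r \<bullet> u) * (p \<bullet> v)) *\<^sub>R (f p \<times> f r)" if "linear f" for f :: "real^3 \<Rightarrow> real^3"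
    proof -
      have fe: "f w = (p \<bullet> w) *\<^sub>R f p + (r \<bullet> w) *\<^sub>R f r" if "a \<bullet> w = 0" for w
      proof -
        have "f w = f ((p \<bullet> w) *\<^sub>R p + (r \<bullet> w) *\<^sub>R r)" by (rule arg_cong[OF expand[OF that]])
        then show ?thesis by (simp only: linear_add[OF \<open>linear f\<close>] linear_scale[OF \<open>linear f\<close>])
      qed
      have "(\<alpha> *\<^sub>R x + \<beta> *\<^sub>R y) \<times> (\<gamma> *\<^sub>R x + \<delta> *\<^sub>R y) = (\<alpha> * \<delta> - \<beta> * \<gamma>) *\<^sub>R (x \<times> y)"
        for \<alpha> \<beta> \<gamma> \<delta> and x y :: "real^3"
        by (simp add: cross_add_left cross_add_right cross_mult_left cross_mult_right cross_skew[of y x]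
            scaleR_diff_left mult.commute)
      then show ?thesis by (simp only: fe[OF \<open>a \<bullet> u = 0\<close>] fe[OF \<open>a \<bullet> v = 0\<close>])
    qed
    have "L p \<times> L r = k *\<^sub>R (p \<times> r)" using par[OF La La, of p r] by (simp add: k_def r)
    then show ?thesis using bil[OF L] bil[OF linear_id] by (simp add: mult.commute)
  qed
  have "plane_det T L = k"
    unfolding plane_det_def
  proof (rule the_equality)
    show "\<forall>u\<in>T. \<forall>v\<in>T. L u \<times> L v = k *\<^sub>R (u \<times> v)" using all T by auto
    fix k' assume "\<forall>u\<in>T. \<forall>v\<in>T. L u \<times> L v = k' *\<^sub>R (u \<times> v)"
    then have "L p \<times> L r = k' *\<^sub>R a" using T p r by auto
    moreover have "L p \<times> L r = k *\<^sub>R a" using all[OF p(1) r(1)] r by simp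
    ultimately show "k' = k" using \<open>a \<noteq> 0\<close> by simp
  qed
  then show ?thesis using all uv T by auto
qed

locale smooth_norm_space =
  fixes N :: "real^3 \<Rightarrow> real"
  assumes smooth_norm: "smooth_norm N"
begin

text \<open>\<open>D\<nu> x\<close> is the derivative of the unit normal, and \<open>A x\<close> is the shape operator of the sphere. The former does not
annihilate the normal (it annihilates the radial direction), so it is precomposed with the projection; this does not change it on the tangent plane, and makes \<open>A x\<close> symmetric.\<close>

definition G :: "real^3 \<Rightarrow> real^3" where "G = gradient N"
definition H :: "real^3 \<Rightarrow> real^3 \<Rightarrow> real^3" where "H x = frechet_derivative G (at x)"
definition \<nu> :: "real^3 \<Rightarrow> real^3" where "\<nu> x = (1 / norm (G x)) *\<^sub>R G x"
definition P :: "real^3 \<Rightarrow> real^3 \<Rightarrow> real^3" where "P x v = v - (\<nu> x \<bullet> v) *\<^sub>R \<nu> x"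
definition D\<nu> :: "real^3 \<Rightarrow> real^3 \<Rightarrow> real^3" where "D\<nu> x v = (1 / norm (G x)) *\<^sub>R P x (H x v)"
definition A :: "real^3 \<Rightarrow> real^3 \<Rightarrow> real^3" where "A x v = D\<nu> x (P x v)"

abbreviation "S \<equiv> unit_sphere N"

lemma norm_laws: "0 \<le> N x" "N x = 0 \<longleftrightarrow> x = 0" "N (a *\<^sub>R x) = \<bar>a\<bar> * N x" "N (x + y) \<le> N x + N y"
  using smooth_norm unfolding smooth_norm_def is_norm_def by auto

lemma N_minus: "N (- x) = N x" using norm_laws(3)[of "-1" x] by simp

lemma N_diff: "N y \<ge> N x - N (x - y)" using norm_laws(4)[of y "x - y"] by simp

lemma N_Ck: "Ck_on k N (- {0})" using smooth_norm by (simp add: smooth_norm_def smooth_on_def)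

lemma S_nz: "x \<in> S \<Longrightarrow> x \<noteq> 0" using norm_laws(2)[of x] by (auto simp: unit_sphere_def)

lemma derivatives:
  shows N_deriv: "x \<noteq> 0 \<Longrightarrow> (N has_derivative (\<lambda>v. G x \<bullet> v)) (at x)"
    and G_deriv: "x \<noteq> 0 \<Longrightarrow> (G has_derivative H x) (at x)"
    and H_cont: "continuous_on (- {0}) (\<lambda>x. H x v)"
proof -
  have at: "at x within - {0} = at x" if "x \<noteq> 0" for x :: "real^3"
    by (rule at_within_open) (use that in auto)
  obtain f' where f': "\<And>x. x \<noteq> 0 \<Longrightarrow> (N has_derivative f' x) (at x)" "\<And>v. Ck_on 1 (\<lambda>x. f' x v) (- {0})"
    using N_Ck[of "Suc 1"] by (subst (asm) Ck_on.simps) (auto simp: at)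
  have "\<exists>f2. (\<forall>x. x \<noteq> 0 \<longrightarrow> ((\<lambda>x. f' x v) has_derivative f2 x) (at x)) \<and> (\<forall>w. continuous_on (- {0}) (\<lambda>x. f2 x w))" for v
    using f'(2)[of v] by (auto simp: at One_nat_def)
  then obtain f2 where f2: "\<And>v x. x \<noteq> 0 \<Longrightarrow> ((\<lambda>x. f' x v) has_derivative f2 v x) (at x)"
     "\<And>v w. continuous_on (- {0}) (\<lambda>x. f2 v x w)" by metis
  define g where "g x = (\<Sum>b\<in>Basis. f' x b *\<^sub>R b)" for x
  have lin: "linear (f' x)" if "x \<noteq> 0" for x using f'(1)[OF that] has_derivative_linear by blast
  have g: "f' x v = g x \<bullet> v" if "x \<noteq> 0" for x v
  proof -
    have "f' x v = (\<Sum>b\<in>Basis. (v \<bullet> b) * f' x b)"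
      by (subst euclidean_representation[of v, symmetric])
        (simp add: linear_sum[OF lin[OF that]] linear_scale[OF lin[OF that]])
    moreover have "g x \<bullet> v = (\<Sum>b\<in>Basis. f' x b * (b \<bullet> v))" by (simp add: g_def inner_sum_left)
    ultimately show ?thesis by (simp add: inner_commute mult.commute)
  qed
  have Nd: "(N has_derivative (\<lambda>v. g x \<bullet> v)) (at x)" if "x \<noteq> 0" for x
  proof -
    have "f' x = (\<lambda>v. g x \<bullet> v)" using g[OF that] by auto
    then show ?thesis using f'(1)[OF that] by simp
  qed
  have Gg: "G x = g x" if "x \<noteq> 0" for x unfolding G_def by (rule gradient_eqI[OF Nd[OF that]])
  show "(N has_derivative (\<lambda>v. G x \<bullet> v)) (at x)" if "x \<noteq> 0" using Nd[OF that] Gg[OF that] by simp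
  define h where "h x v = (\<Sum>b\<in>Basis. f2 b x v *\<^sub>R b)" for x v
  have Gd: "(G has_derivative h x) (at x)" if "x \<noteq> 0" for x
  proof (rule has_derivative_transform_within_open[where s = "- {0}"])
    show "(g has_derivative h x) (at x)"
      unfolding g_def h_def by (intro has_derivative_sum has_derivative_scaleR_left f2(1) that)
  qed (use that Gg in auto)
  then have Hh: "H x = h x" if "x \<noteq> 0" for x unfolding H_def using that frechet_derivative_at by metis
  show "(G has_derivative H x) (at x)" if "x \<noteq> 0" using Gd Hh that by simp
  have "continuous_on (- {0}) (\<lambda>x. h x v)" unfolding h_def by (intro continuous_intros f2(2))
  then show "continuous_on (- {0}) (\<lambda>x. H x v)" by (rule continuous_on_eq) (use Hh in auto)
qed

lemma H_linear: "x \<noteq> 0 \<Longrightarrow> linear (H x)" using G_deriv has_derivative_linear by blast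

lemma H_sym: "x \<noteq> 0 \<Longrightarrow> H x v \<bullet> w = v \<bullet> H x w"
  by (rule symmetric_second_derivative[of "- {0}" x N G]) (use N_deriv G_deriv in auto)

lemma G_cont: "continuous_on (- {0}) G"
  by (rule has_derivative_continuous_on[where f' = H]) (auto intro!: has_derivative_at_withinI G_deriv)

lemma N_cont_nz: "continuous_on (- {0}) N"
  by (rule has_derivative_continuous_on[where f' = "\<lambda>x v. G x \<bullet> v"]) (auto intro!: has_derivative_at_withinI N_deriv)

text \<open>Euler's relation for functions that are homogeneous of degree one. It shows that the gradient does not vanish, so
that the unit normal is defined, and that the radial direction is transversal to the tangent plane.\<close>

lemma euler: "x \<noteq> 0 \<Longrightarrow> G x \<bullet> x = N x"
proof -
  assume x: "x \<noteq> 0"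
  have "((\<lambda>t. t *\<^sub>R x) has_derivative (\<lambda>h. h *\<^sub>R x)) (at 1)" by (auto intro!: derivative_eq_intros)
  moreover have "(N has_derivative (\<lambda>v. G x \<bullet> v)) (at (1 *\<^sub>R x))" using N_deriv[OF x] by simp
  ultimately have "((\<lambda>t. N (t *\<^sub>R x)) has_derivative (\<lambda>h. G x \<bullet> (h *\<^sub>R x))) (at 1)"
    using diff_chain_at[of "\<lambda>t. t *\<^sub>R x" "\<lambda>h. h *\<^sub>R x" 1 N "\<lambda>v. G x \<bullet> v"] by (simp add: o_def)
  moreover have "((\<lambda>t. N (t *\<^sub>R x)) has_derivative (\<lambda>h. h * N x)) (at 1)"
  proof (rule has_derivative_transform_within_open[where s = "{0<..}"])
    show "((\<lambda>t. t * N x) has_derivative (\<lambda>h. h * N x)) (at 1)" by (auto intro!: derivative_eq_intros)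
  qed (auto simp: norm_laws)
  ultimately have "(\<lambda>h. G x \<bullet> (h *\<^sub>R x)) = (\<lambda>h. h * N x)" by (rule has_derivative_unique)
  then show ?thesis by (metis mult_1 scaleR_one)
qed

lemma norm_equiv:
  obtains \<alpha> where "\<alpha> > 0" "\<And>x. \<alpha> * norm x \<le> N x"
proof -
  have "continuous_on (sphere 0 1) N" by (rule continuous_on_subset[OF N_cont_nz]) auto
  moreover have "axis 1 1 \<in> sphere (0::real^3) 1" by simp
  ultimately obtain z where z: "z \<in> sphere 0 1" "\<And>y. y \<in> sphere 0 1 \<Longrightarrow> N z \<le> N y"
    using continuous_attains_inf[of "sphere (0::real^3) 1" N] by auto
  have "N z > 0" using z(1) norm_laws(1,2)[of z] by (smt (verit) norm_zero mem_sphere_0)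
  moreover have "N z * norm x \<le> N x" for x
  proof (cases "x = 0")
    case False
    then have "N z \<le> N ((1 / norm x) *\<^sub>R x)" by (intro z) simp
    then show ?thesis using False by (simp add: norm_laws field_simps)
  qed (simp add: norm_laws)
  ultimately show ?thesis using that by blast
qed

text \<open>Continuity at the origin, where the norm has no derivative, follows from comparison with the Euclidean norm.\<close>

lemma N_cont: "continuous_on UNIV N"
proof -
  have "isCont N x" for x
  proof (cases "x = 0")
    case False then show ?thesis using N_deriv has_derivative_continuous by blast
  next
    case True
    define c where "c = (\<Sum>b\<in>(Basis::(real^3) set). N b)"
    have Nsum: "N (sum f B) \<le> (\<Sum>b\<in>B. N (f b))" if "finite B" for f :: "real^3 \<Rightarrow> real^3" and B
      using that by (induction B rule: finite_induct) (auto simp: norm_laws(2)[THEN iffD2] intro: order_trans[OF norm_laws(4)])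
    have "N x \<le> norm x * c" for x
    proof -
      have "N x = N (\<Sum>b\<in>Basis. (x \<bullet> b) *\<^sub>R b)" by (simp add: euclidean_representation)
      also have "\<dots> \<le> (\<Sum>b\<in>Basis. N ((x \<bullet> b) *\<^sub>R b))" by (rule Nsum) simp
      also have "\<dots> \<le> (\<Sum>b\<in>Basis. norm x * N b)"
        by (intro sum_mono) (auto simp: norm_laws(3) intro!: mult_right_mono Basis_le_norm norm_laws(1))
      finally show ?thesis by (simp add: c_def sum_distrib_left)
    qed
    then have le: "norm (N x) \<le> norm x * c" for x using norm_laws(1)[of x] by simp
    have "(N \<longlongrightarrow> 0) (at 0)"
      by (rule tendsto_0_le[where f = "\<lambda>x. x" and K = c]) (use le in \<open>auto intro!: always_eventually\<close>)
    then show ?thesis using True norm_laws(2)[of 0] by (simp add: isCont_def)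
  qed
  then show ?thesis by (simp add: continuous_at_imp_continuous_on)
qed

lemma S_compact: "compact S"
proof -
  obtain \<alpha> where \<alpha>: "\<alpha> > 0" "\<And>x. \<alpha> * norm x \<le> N x" using norm_equiv by blast
  have "norm x \<le> 1 / \<alpha>" if "x \<in> S" for x using \<alpha>(2)[of x] that \<alpha>(1) by (simp add: unit_sphere_def field_simps)
  then have "bounded S" by (meson boundedI)
  moreover have "closed S"
  proof -
    have "S = N -` {1}" by (auto simp: unit_sphere_def)
    then show ?thesis using continuous_closed_vimage[of "{1}" N] N_cont by (simp add: continuous_on_eq_continuous_at)
  qed
  ultimately show ?thesis by (simp add: compact_eq_bounded_closed)
qed

lemma S_ne: "S \<noteq> {}"
proof -
  have a: "axis 1 1 \<noteq> (0::real^3)" by (metis axis_eq_0_iff zero_neq_one)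
  then have "N (axis 1 1) > 0" using norm_laws(1,2) by (metis less_eq_real_def)
  then have "(1 / N (axis 1 1)) *\<^sub>R axis 1 1 \<in> S" by (simp add: unit_sphere_def norm_laws)
  then show ?thesis by blast
qed

lemma G_nz: "x \<noteq> 0 \<Longrightarrow> G x \<noteq> 0" using euler[of x] norm_laws(2)[of x] by auto

lemma \<nu>_unit: "x \<noteq> 0 \<Longrightarrow> norm (\<nu> x) = 1" using G_nz by (simp add: \<nu>_def)

lemma \<nu>_inner_\<nu>: "x \<noteq> 0 \<Longrightarrow> \<nu> x \<bullet> \<nu> x = 1" using \<nu>_unit[of x] by (simp add: power2_norm_eq_inner[symmetric])

lemma \<nu>_sgn: "\<nu> x = sgn (G x)" by (simp add: \<nu>_def sgn_div_norm divide_inverse)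

lemma \<nu>_deriv: "x \<noteq> 0 \<Longrightarrow> (\<nu> has_derivative D\<nu> x) (at x)"
  using has_derivative_normalize[OF G_deriv G_nz, of x]
  unfolding \<nu>_def[abs_def] D\<nu>_def[abs_def] P_def \<nu>_sgn[symmetric] by (simp add: \<nu>_sgn[symmetric] \<nu>_def)

lemma P_linear: "linear (P x)"
  by (rule linearI) (simp_all add: P_def inner_add_right scaleR_add_left scaleR_diff_right)

lemma P_sym: "P x v \<bullet> w = v \<bullet> P x w"
  by (simp add: P_def inner_diff_left inner_diff_right inner_commute)

lemma \<nu>_P: "x \<noteq> 0 \<Longrightarrow> \<nu> x \<bullet> P x v = 0" by (simp add: P_def inner_diff_right \<nu>_inner_\<nu>)

lemma P_\<nu>: "x \<noteq> 0 \<Longrightarrow> P x (\<nu> x) = 0" by (simp add: P_def \<nu>_inner_\<nu>)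

lemma P_tangent: "\<nu> x \<bullet> v = 0 \<Longrightarrow> P x v = v" by (simp add: P_def)

lemma norm_P: "x \<noteq> 0 \<Longrightarrow> norm (P x v) \<le> norm v"
proof -
  assume x: "x \<noteq> 0"
  have "(norm (P x v))\<^sup>2 = (norm v)\<^sup>2 - (\<nu> x \<bullet> v)\<^sup>2"
  proof -
    have "(v - k *\<^sub>R a) \<bullet> (v - k *\<^sub>R a) = v \<bullet> v - 2 * k * (a \<bullet> v) + k * k * (a \<bullet> a)" for k and a :: "real^3"
      by (simp add: inner_diff_left inner_diff_right inner_commute)
    from this[of "\<nu> x \<bullet> v" "\<nu> x"] show ?thesis
      unfolding power2_norm_eq_inner P_def by (simp add: \<nu>_inner_\<nu>[OF x] power2_eq_square)
  qed
  then have "(norm (P x v))\<^sup>2 \<le> (norm v)\<^sup>2" by simp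
  then show ?thesis by (rule power2_le_imp_le) simp
qed

lemma A_linear: "x \<noteq> 0 \<Longrightarrow> linear (A x)" and D\<nu>_linear: "x \<noteq> 0 \<Longrightarrow> linear (D\<nu> x)"
proof -
  assume x: "x \<noteq> 0"
  show D: "linear (D\<nu> x)" using \<nu>_deriv[OF x] has_derivative_linear by blast
  show "linear (A x)" using linear_compose[OF P_linear D, of x] by (simp add: A_def[abs_def] o_def)
qed

lemma A_sym: "x \<noteq> 0 \<Longrightarrow> A x v \<bullet> w = v \<bullet> A x w"
  by (simp add: A_def D\<nu>_def P_sym H_sym)

lemma A_\<nu>: "x \<noteq> 0 \<Longrightarrow> A x (\<nu> x) = 0"
  using linear_0[OF D\<nu>_linear] by (simp add: A_def P_\<nu>)

lemma \<nu>_D\<nu>: "x \<noteq> 0 \<Longrightarrow> \<nu> x \<bullet> D\<nu> x v = 0" by (simp add: D\<nu>_def \<nu>_P)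

lemma \<nu>_cont: "continuous_on (- {0}) \<nu>"
  by (rule has_derivative_continuous_on[where f' = D\<nu>]) (auto intro!: has_derivative_at_withinI \<nu>_deriv)

lemma H_app_cont:
  assumes "continuous_on (- {0}) f"
  shows "continuous_on (- {0}) (\<lambda>x. H x (f x))"
proof -
  have "H x (f x) = (\<Sum>b\<in>Basis. (f x \<bullet> b) *\<^sub>R H x b)" if "x \<noteq> 0" for x
    by (subst euclidean_representation[of "f x", symmetric])
      (simp add: linear_sum[OF H_linear[OF that]] linear_scale[OF H_linear[OF that]])
  note expand = this
  have "continuous_on (- {0}) (\<lambda>x. \<Sum>b\<in>Basis. (f x \<bullet> b) *\<^sub>R H x b)"
    by (intro continuous_intros assms H_cont)
  then show ?thesis by (rule continuous_on_eq) (use expand in auto)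
qed

lemma D\<nu>_app_cont:
  assumes "continuous_on (- {0}) f"
  shows "continuous_on (- {0}) (\<lambda>x. D\<nu> x (f x))"
  unfolding D\<nu>_def P_def using G_nz
  by (intro continuous_intros H_app_cont assms \<nu>_cont G_cont) auto

lemma gradient_hessian_bounds:
  obtains M g0 where "M \<ge> 1" "\<And>x v. x \<in> S \<Longrightarrow> norm (H x v) \<le> M * norm v" "g0 > 0" "\<And>x. x \<in> S \<Longrightarrow> g0 \<le> norm (G x)"
proof -
  have sub: "S \<subseteq> - {0}" using S_nz by auto
  have "\<exists>B. \<forall>x\<in>S. norm (H x b) \<le> B" for b
  proof -
    have "compact ((\<lambda>x. H x b) ` S)"
      by (rule compact_continuous_image[OF continuous_on_subset[OF H_cont sub] S_compact])
    then show ?thesis using compact_imp_bounded bounded_iff by (metis imageI)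
  qed
  then obtain B where B: "\<And>b x. x \<in> S \<Longrightarrow> norm (H x b) \<le> B b" by metis
  define M where "M = 1 + (\<Sum>b\<in>(Basis::(real^3) set). \<bar>B b\<bar>)"
  have "norm (H x v) \<le> M * norm v" if x: "x \<in> S" for x v
  proof -
    have "H x v = (\<Sum>b\<in>Basis. (v \<bullet> b) *\<^sub>R H x b)"
      by (subst euclidean_representation[of v, symmetric])
        (simp add: linear_sum[OF H_linear[OF S_nz[OF x]]] linear_scale[OF H_linear[OF S_nz[OF x]]])
    also have "norm \<dots> \<le> (\<Sum>b\<in>Basis. norm v * \<bar>B b\<bar>)"
      using B[OF x] by (intro sum_norm_le) (auto intro!: mult_mono Basis_le_norm intro: order_trans[OF _ abs_ge_self])
    also have "\<dots> \<le> M * norm v" by (simp add: M_def sum_distrib_left algebra_simps)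
    finally show ?thesis .
  qed
  moreover have "M \<ge> 1" by (simp add: M_def sum_nonneg)
  moreover have "continuous_on S (\<lambda>x. norm (G x))"
    by (intro continuous_intros continuous_on_subset[OF G_cont sub])
  then obtain z where "z \<in> S" "\<And>x. x \<in> S \<Longrightarrow> norm (G z) \<le> norm (G x)"
    using continuous_attains_inf[OF S_compact S_ne] by metis
  moreover from this have "norm (G z) > 0" using G_nz S_nz by simp
  ultimately show ?thesis using that by blast
qed

text \<open>For two points of the sphere the values of the norm agree, so Taylor's formula leaves only the first and second order terms.
Its remainder is controlled, uniformly in the base point, by that of the gradient.\<close>

lemma gradient_contact:
  assumes e: "e > 0"
  obtains d where "d > 0" "\<And>x y. x \<in> S \<Longrightarrow> y \<in> S \<Longrightarrow> norm (y - x) < d \<Longrightarrow>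
    \<bar>G x \<bullet> (y - x) + (y - x) \<bullet> H x (y - x) / 2\<bar> \<le> e * (norm (y - x))\<^sup>2"
    "\<And>x y. x \<in> S \<Longrightarrow> norm (y - x) < d \<Longrightarrow> norm (G y - G x - H x (y - x)) \<le> e * norm (y - x)"
proof -
  have sub: "S \<subseteq> - {0}" using S_nz by auto
  have opn: "open (- {0::real^3})" by auto
  obtain d where d: "d > 0" "\<And>x. x \<in> S \<Longrightarrow> ball x d \<subseteq> - {0}"
    "\<And>x y. x \<in> S \<Longrightarrow> norm (y - x) < d \<Longrightarrow> norm (G y - G x - H x (y - x)) \<le> e * norm (y - x)"
  proof (rule uniform_linearization[OF opn sub S_compact _ H_cont e])
    show "(G has_derivative H x) (at x)" if "x \<in> - {0}" for x using G_deriv that by simp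
  qed blast
  show ?thesis
  proof (rule that[OF d(1) _ d(3)])
    fix x y assume x: "x \<in> S" and y: "y \<in> S" and yd: "norm (y - x) < d"
    define h where "h = y - x"
    \<comment> \<open>The remainder of Taylor's formula of order two along the chord.\<close>
    define \<psi> where "\<psi> t = N (x + t *\<^sub>R h) - t * (G x \<bullet> h) - t\<^sup>2 * (h \<bullet> H x h / 2)" for t
    define \<psi>' where "\<psi>' t = (G (x + t *\<^sub>R h) - G x - H x (t *\<^sub>R h)) \<bullet> h" for t
    have near: "norm (t *\<^sub>R h) \<le> norm h" if "0 \<le> t" "t \<le> 1" for t
      using that by (simp add: mult_left_le_one_le)
    have "DERIV \<psi> t :> \<psi>' t" if t: "0 \<le> t" "t \<le> 1" for t
    proof -
      have "x + t *\<^sub>R h \<in> ball x d"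
      proof -
        have "dist x (x + a) = norm a" for a :: "real^3" by (simp add: dist_norm)
        then show ?thesis using near[OF t] yd by (simp only: mem_ball h_def)
      qed
      then have nz: "x + t *\<^sub>R h \<noteq> 0" using d(2)[OF x] by auto
      have "((\<lambda>t. x + t *\<^sub>R h) has_derivative (\<lambda>s. s *\<^sub>R h)) (at t)" by (auto intro!: derivative_eq_intros)
      from diff_chain_at[OF this N_deriv[OF nz]]
      have "DERIV (\<lambda>t. N (x + t *\<^sub>R h)) t :> G (x + t *\<^sub>R h) \<bullet> h"
        unfolding has_field_derivative_def by (simp add: o_def mult_commute_abs)
      then have "DERIV \<psi> t :> G (x + t *\<^sub>R h) \<bullet> h - G x \<bullet> h - 2 * t * (h \<bullet> H x h / 2)"
        unfolding \<psi>_def by (auto intro!: derivative_eq_intros)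
      moreover have "\<psi>' t = G (x + t *\<^sub>R h) \<bullet> h - G x \<bullet> h - 2 * t * (h \<bullet> H x h / 2)"
        using linear_scale[OF H_linear[OF S_nz[OF x]]] by (simp add: \<psi>'_def inner_diff_left inner_diff_right inner_commute)
      ultimately show ?thesis by simp
    qed
    then obtain t where t: "0 < t" "t < 1" "\<psi> 1 - \<psi> 0 = \<psi>' t" using MVT2[of 0 1 \<psi> \<psi>'] by auto
    have "\<bar>\<psi>' t\<bar> \<le> norm (G (x + t *\<^sub>R h) - G x - H x (t *\<^sub>R h)) * norm h"
      unfolding \<psi>'_def by (rule Cauchy_Schwarz_ineq2)
    also have "\<dots> \<le> (e * norm (t *\<^sub>R h)) * norm h"
      using d(3)[OF x, of "x + t *\<^sub>R h"] near[of t] t yd by (intro mult_right_mono) (auto simp: h_def)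
    also have "\<dots> \<le> (e * norm h) * norm h" using near[of t] t e by (intro mult_right_mono mult_left_mono) auto
    finally have "\<bar>\<psi>' t\<bar> \<le> e * (norm h)\<^sup>2" by (simp add: power2_eq_square mult.assoc)
    moreover have "\<psi> 1 - \<psi> 0 = - (G x \<bullet> h + h \<bullet> H x h / 2)"
      using x y by (simp add: \<psi>_def h_def unit_sphere_def)
    ultimately show "\<bar>G x \<bullet> (y - x) + (y - x) \<bullet> H x (y - x) / 2\<bar> \<le> e * (norm (y - x))\<^sup>2"
      using t(3) by (simp add: h_def abs_minus_commute abs_le_iff)
  qed
qed

section \<open>Curvature of the unit sphere of a norm\<close>

text \<open>The derivative at \<open>x\<close> of the radial projection onto the unit sphere.\<close>

definition D\<rho> :: "real^3 \<Rightarrow> real^3 \<Rightarrow> real^3" where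
  "D\<rho> x v = (1 / N x) *\<^sub>R v - ((G x \<bullet> v) / (N x)\<^sup>2) *\<^sub>R x"

lemma radial_deriv:
  assumes "x \<noteq> 0"
  shows "((\<lambda>y. (1 / N y) *\<^sub>R y) has_derivative D\<rho> x) (at x)"
proof -
  have nz: "N x \<noteq> 0" using assms norm_laws(2) by simp
  have "((\<lambda>y. inverse (N y) *\<^sub>R y) has_derivative (\<lambda>v. inverse (N x) *\<^sub>R v + (- (inverse (N x) * (G x \<bullet> v) * inverse (N x))) *\<^sub>R x)) (at x)"
    by (intro has_derivative_scaleR Deriv.has_derivative_inverse N_deriv has_derivative_ident nz assms)
  moreover have "inverse (N x) *\<^sub>R v + (- (inverse (N x) * (G x \<bullet> v) * inverse (N x))) *\<^sub>R x
     = D\<rho> x v" for v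
    by (simp add: D\<rho>_def divide_inverse power2_eq_square mult_ac)
  ultimately show ?thesis by (simp only: divide_inverse mult_1)
qed

lemma radial_in_S: "x \<noteq> 0 \<Longrightarrow> (1 / N x) *\<^sub>R x \<in> S"
  using norm_laws(1,2)[of x] by (simp add: unit_sphere_def norm_laws(3))

lemma tangent_plane_eq: "x \<noteq> 0 \<Longrightarrow> tangent_plane N x = {v. \<nu> x \<bullet> v = 0}"
  using G_nz[of x] by (simp add: tangent_plane_def euclid_inner_def G_def[symmetric] \<nu>_def)

lemma gauss_map_eq: "c > 0 \<Longrightarrow> gauss_map c N x = (1 / c) *\<^sub>R \<nu> x"
proof -
  assume c: "c > 0"
  have "euclid_norm c v = c * norm v" for v
    using c by (simp add: euclid_norm_def euclid_inner_def real_sqrt_mult norm_eq_sqrt_inner)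
  then show ?thesis by (simp add: gauss_map_def \<nu>_def G_def[symmetric])
qed

lemma gauss_map_frechet: "c > 0 \<Longrightarrow> q \<noteq> 0 \<Longrightarrow>
  frechet_derivative (gauss_map c N) (at q) = (\<lambda>v. (1 / c) *\<^sub>R D\<nu> q v)"
proof -
  assume c: "c > 0" and q: "q \<noteq> 0"
  have "((\<lambda>x. (1 / c) *\<^sub>R \<nu> x) has_derivative (\<lambda>v. (1 / c) *\<^sub>R D\<nu> q v)) (at q)"
    by (intro has_derivative_scaleR_right \<nu>_deriv q)
  then have "(gauss_map c N has_derivative (\<lambda>v. (1 / c) *\<^sub>R D\<nu> q v)) (at q)"
    using gauss_map_eq[OF c] by presburger
  then show ?thesis using frechet_derivative_at by metis
qed

text \<open>Since \<open>v\<close> and \<open>w\<close> are orthogonal of equal length, the inner product of \<open>A v \<times> A w = k (v \<times> w)\<close> with \<open>v \<times> w\<close> is \<open>k |v|\<^sup>4\<close>, and it is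
expanded by the identity of Binet and Cauchy. The factor \<open>c\<^sup>2\<close> converts the curvature of the re-scaled structure into that of the
standard one, in which \<open>A\<close> is computed.\<close>

lemma curvature_formula:
  assumes c: "c > 0" and q: "q \<noteq> 0" and v: "\<nu> q \<bullet> v = 0"
  defines "w \<equiv> \<nu> q \<times> v"
  shows "(A q v \<bullet> v) * (A q w \<bullet> w) - (A q v \<bullet> w)\<^sup>2 = c\<^sup>2 * gaussian_curvature c N q * norm v ^ 4"
proof -
  have w: "\<nu> q \<bullet> w = 0" "v \<bullet> w = 0" by (simp_all add: w_def dot_cross_self)
  have nw: "norm w = norm v"
  proof -
    have "(norm w)\<^sup>2 = (norm v)\<^sup>2" by (simp add: w_def norm_cross \<nu>_unit[OF q] v)
    then show ?thesis by simp
  qed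
  let ?T = "tangent_plane N q" and ?L = "\<lambda>v. (1 / c) *\<^sub>R D\<nu> q v"
  have "linear ?L" by (intro linear_compose_scale_right D\<nu>_linear q)
  then have "?L v \<times> ?L w = plane_det ?T ?L *\<^sub>R (v \<times> w)"
    by (intro plane_det_cross[OF \<nu>_unit[OF q]]) (use v w q \<nu>_D\<nu> tangent_plane_eq in auto)
  then have "(?L v \<times> ?L w) \<bullet> (v \<times> w) = gaussian_curvature c N q * (norm (v \<times> w))\<^sup>2"
    by (simp add: gaussian_curvature_def gauss_map_frechet[OF c q] power2_norm_eq_inner)
  moreover have "(norm (v \<times> w))\<^sup>2 = norm v ^ 4" by (simp add: norm_cross w nw)
  moreover have "(?L v \<times> ?L w) \<bullet> (v \<times> w) = (1 / c\<^sup>2) * ((A q v \<bullet> v) * (A q w \<bullet> w) - (A q v \<bullet> w)\<^sup>2)"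
  proof -
    have "D\<nu> q v = A q v" "D\<nu> q w = A q w" using P_tangent v w by (simp_all add: A_def)
    moreover have "A q w \<bullet> v = A q v \<bullet> w" using A_sym[OF q, of w v] by (simp add: inner_commute)
    ultimately show ?thesis by (simp add: dot_cross cross_mult_left cross_mult_right power2_eq_square)
  qed
  ultimately have "(A q v \<bullet> v) * (A q w \<bullet> w) - (A q v \<bullet> w)\<^sup>2 = c\<^sup>2 * (gaussian_curvature c N q * norm v ^ 4)"
    using c by (simp add: field_simps)
  then show ?thesis by simp
qed

lemma curvature_scale: "c > 0 \<Longrightarrow> q \<noteq> 0 \<Longrightarrow> gaussian_curvature 1 N q = c\<^sup>2 * gaussian_curvature c N q"
proof -
  assume c: "c > 0" and q: "q \<noteq> 0"
  have "\<nu> q \<noteq> 0" using \<nu>_unit[OF q] by auto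
  then obtain i where i: "\<nu> q \<times> axis i 1 \<noteq> 0" using cross_basis_nonzero by blast
  have t: "\<nu> q \<bullet> (\<nu> q \<times> axis i 1) = 0" by (simp add: dot_cross_self)
  from curvature_formula[OF c q t] curvature_formula[OF zero_less_one q t] i show ?thesis by simp
qed

text \<open>Dividing \<open>curvature_formula\<close> by \<open>|v|\<^sup>4\<close> shows continuity, if \<open>v\<close> can be chosen continuously and without zeros. There is no such
tangent field on a sphere, so the formula is summed over \<open>v = \<nu> \<times> b\<close> for all basis vectors \<open>b\<close>, not all of which are
parallel to the normal.\<close>

lemma curvature_cont: "continuous_on (- {0}) (gaussian_curvature 1 N)"
proof -
  define n where "n q b = (let v = \<nu> q \<times> b; w = \<nu> q \<times> v in (A q v \<bullet> v) * (A q w \<bullet> w) - (A q v \<bullet> w)\<^sup>2)" for q b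
  define D where "D q = (\<Sum>b\<in>(Basis::(real^3) set). norm (\<nu> q \<times> b) ^ 4)" for q
  have D: "D q > 0" if q: "q \<noteq> 0" for q
  proof -
    have "\<nu> q \<noteq> 0" using \<nu>_unit[OF q] by auto
    then obtain i where i: "\<nu> q \<times> axis i 1 \<noteq> 0" using cross_basis_nonzero by blast
    then show ?thesis unfolding D_def by (intro sum_pos2[of _ "axis i 1"]) (auto simp: axis_in_Basis_iff)
  qed
  have K: "(\<Sum>b\<in>Basis. n q b) / D q = gaussian_curvature 1 N q" if q: "q \<noteq> 0" for q
  proof -
    have "n q b = gaussian_curvature 1 N q * norm (\<nu> q \<times> b) ^ 4" for b
      using curvature_formula[OF zero_less_one q, of "\<nu> q \<times> b"] by (simp add: n_def Let_def dot_cross_self)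
    then have "(\<Sum>b\<in>Basis. n q b) = gaussian_curvature 1 N q * D q" by (simp add: D_def sum_distrib_left)
    then show ?thesis using D[OF q] by simp
  qed
  have c1: "continuous_on (- {0}) (\<lambda>q. \<nu> q \<times> b)" for b by (intro continuous_on_cross continuous_intros \<nu>_cont)
  have c2: "continuous_on (- {0}) (\<lambda>q. \<nu> q \<times> (\<nu> q \<times> b))" for b by (intro continuous_on_cross c1 \<nu>_cont)
  have A: "continuous_on (- {0}) (\<lambda>q. A q (f q))" if "continuous_on (- {0}) f" for f
    unfolding A_def by (rule D\<nu>_app_cont) (unfold P_def, intro continuous_intros \<nu>_cont that)
  have "continuous_on (- {0}) (\<lambda>q. (\<Sum>b\<in>Basis. n q b) / D q)"
    unfolding n_def Let_def D_def[abs_def]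
    by (intro continuous_intros c1 c2 A) (use D in \<open>auto simp: D_def less_le\<close>)
  then show ?thesis by (rule continuous_on_eq) (use K in auto)
qed

lemma curvature_lower_bound:
  assumes adm: "admissible_norm N" and c: "c > 0" and m: "m = (INF q\<in>S. gaussian_curvature c N q)"
  shows "m > 0" "\<And>q. q \<in> S \<Longrightarrow> m \<le> gaussian_curvature c N q"
proof -
  have pos: "gaussian_curvature c N q > 0" if "q \<in> S" for q
    using adm that c curvature_scale[OF c S_nz[OF that]] by (auto simp: admissible_norm_def zero_less_mult_iff)
  have "continuous_on S (gaussian_curvature 1 N)"
    by (rule continuous_on_subset[OF curvature_cont]) (use S_nz in auto)
  then obtain z where z: "z \<in> S" "\<And>q. q \<in> S \<Longrightarrow> gaussian_curvature 1 N z \<le> gaussian_curvature 1 N q"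
    using continuous_attains_inf[OF S_compact S_ne] by blast
  have min: "gaussian_curvature c N z \<le> gaussian_curvature c N q" if "q \<in> S" for q
    using z(2)[OF that] c curvature_scale[OF c S_nz[OF that]] curvature_scale[OF c S_nz[OF z(1)]] by simp
  have "gaussian_curvature c N z \<le> m" unfolding m by (rule cINF_greatest[OF S_ne min])
  then show "m > 0" using pos[OF z(1)] by simp
  have "bdd_below (gaussian_curvature c N ` S)" using pos by (auto intro!: bdd_belowI2[of _ 0] less_imp_le)
  then show "m \<le> gaussian_curvature c N q" if "q \<in> S" for q unfolding m by (rule cINF_lower[OF _ that])
qed

text \<open>The second order term in \<open>gradient_contact\<close> is at most quadratic in the chord, because the Hessian is bounded on the
compact sphere; hence so is the first order term.\<close>

lemma near_tangent:
  obtains C d where "C \<ge> 1" "d > 0" "\<And>x y. x \<in> S \<Longrightarrow> y \<in> S \<Longrightarrow> norm (y - x) < d \<Longrightarrow>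
    \<bar>G x \<bullet> (y - x)\<bar> \<le> C * (norm (y - x))\<^sup>2 \<and> \<bar>\<nu> x \<bullet> (y - x)\<bar> \<le> C * (norm (y - x))\<^sup>2"
proof -
  obtain M g0 where M: "M \<ge> 1" "\<And>x v. x \<in> S \<Longrightarrow> norm (H x v) \<le> M * norm v" "g0 > 0" "\<And>x. x \<in> S \<Longrightarrow> g0 \<le> norm (G x)"
    using gradient_hessian_bounds by metis
  obtain d where d: "d > 0" "\<And>x y. x \<in> S \<Longrightarrow> y \<in> S \<Longrightarrow> norm (y - x) < d \<Longrightarrow>
    \<bar>G x \<bullet> (y - x) + (y - x) \<bullet> H x (y - x) / 2\<bar> \<le> 1 * (norm (y - x))\<^sup>2" using gradient_contact[of 1] by (metis zero_less_one)
  define C where "C = (1 + M) + (1 + M) / g0"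
  have C: "C \<ge> 1 + M" "C \<ge> (1 + M) / g0" using M by (auto simp: C_def)
  show ?thesis
  proof (rule that[OF _ d(1), of C])
    show "C \<ge> 1" using C M by simp
    fix x y assume xy: "x \<in> S" "y \<in> S" "norm (y - x) < d"
    define h where "h = y - x"
    have "\<bar>h \<bullet> H x h\<bar> \<le> norm h * (M * norm h)"
      by (rule order_trans[OF Cauchy_Schwarz_ineq2]) (intro mult_left_mono M xy, simp)
    then have a: "\<bar>h \<bullet> H x h\<bar> \<le> M * (norm h)\<^sup>2" by (simp add: power2_eq_square mult_ac)
    have b: "\<bar>G x \<bullet> h + h \<bullet> H x h / 2\<bar> \<le> (norm h)\<^sup>2" using d(2)[OF xy] by (simp add: h_def)
    have "M * (norm h)\<^sup>2 \<ge> 0" using M by simp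
    then have Gh: "\<bar>G x \<bullet> h\<bar> \<le> (1 + M) * (norm h)\<^sup>2" using a b unfolding distrib_right by linarith
    also have "\<dots> \<le> C * (norm h)\<^sup>2" by (intro mult_right_mono C) simp
    finally have 1: "\<bar>G x \<bullet> h\<bar> \<le> C * (norm h)\<^sup>2" .
    have "\<bar>\<nu> x \<bullet> h\<bar> = \<bar>G x \<bullet> h\<bar> / norm (G x)" by (simp add: \<nu>_def abs_mult)
    also have "\<dots> \<le> ((1 + M) * (norm h)\<^sup>2) / g0"
      using Gh M(1,3) M(4)[OF xy(1)] by (intro frac_le) auto
    also have "\<dots> = ((1 + M) / g0) * (norm h)\<^sup>2" by simp
    also have "\<dots> \<le> C * (norm h)\<^sup>2" by (intro mult_right_mono C) simp
    finally show "\<bar>G x \<bullet> (y - x)\<bar> \<le> C * (norm (y - x))\<^sup>2 \<and> \<bar>\<nu> x \<bullet> (y - x)\<bar> \<le> C * (norm (y - x))\<^sup>2"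
      using 1 by (simp add: h_def)
  qed
qed

text \<open>The contact properties of \<open>G\<close> and \<open>\<nu>\<close> hold with the full Hessian and with \<open>D\<nu>\<close>. Replacing these by \<open>A\<close> costs terms that contain the normal
component of the chord, and by \<open>near_tangent\<close> these are of higher order. A curve with prescribed tangent \<open>v\<close> is the radial
projection of the tangent line \<open>x + s v\<close>.\<close>

lemma curved_surface_unit_sphere:
  assumes c: "c > 0" and m: "m > 0" "\<And>q. q \<in> S \<Longrightarrow> m \<le> gaussian_curvature c N q"
  shows "curved_surface S \<nu> A (c\<^sup>2 * m)"
proof (rule curved_surface.intro)
  obtain M g0 where M: "M \<ge> 1" "\<And>x v. x \<in> S \<Longrightarrow> norm (H x v) \<le> M * norm v" "g0 > 0" "\<And>x. x \<in> S \<Longrightarrow> g0 \<le> norm (G x)"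
    using gradient_hessian_bounds by metis
  obtain C dC where C: "C \<ge> 1" "dC > 0" "\<And>x y. x \<in> S \<Longrightarrow> y \<in> S \<Longrightarrow> norm (y - x) < dC \<Longrightarrow>
      \<bar>G x \<bullet> (y - x)\<bar> \<le> C * (norm (y - x))\<^sup>2 \<and> \<bar>\<nu> x \<bullet> (y - x)\<bar> \<le> C * (norm (y - x))\<^sup>2" using near_tangent by metis
  show "c\<^sup>2 * m > 0" using c m by simp
  have D_bound: "norm (D\<nu> x v) \<le> (M / g0) * norm v" if x: "x \<in> S" for x v
  proof -
    have "norm (D\<nu> x v) \<le> (1 / norm (G x)) * norm (H x v)"
      unfolding D\<nu>_def norm_scaleR using norm_P[OF S_nz[OF x], of "H x v"] by (intro mult_mono) auto
    also have "\<dots> \<le> (1 / g0) * (M * norm v)"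
      using M x by (intro mult_mono M frac_le) auto
    finally show ?thesis by simp
  qed
  show "\<exists>M. \<forall>x\<in>S. \<forall>v. norm (A x v) \<le> M * norm v"
  proof (intro exI ballI allI)
    fix x v assume x: "x \<in> S"
    have "norm (A x v) \<le> (M / g0) * norm (P x v)" unfolding A_def by (rule D_bound[OF x])
    also have "\<dots> \<le> (M / g0) * norm v" using norm_P[OF S_nz[OF x]] M by (intro mult_left_mono) auto
    finally show "norm (A x v) \<le> (M / g0) * norm v" .
  qed
  show "norm (\<nu> x) = 1" if "x \<in> S" for x using \<nu>_unit S_nz that by blast
  show "linear (A x)" if "x \<in> S" for x using A_linear S_nz that by blast
  show "A x v \<bullet> w = v \<bullet> A x w" if "x \<in> S" for x v w using A_sym S_nz that by blast
  show "A x (\<nu> x) = 0" if "x \<in> S" for x using A_\<nu> S_nz that by blast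
  show "(c\<^sup>2 * m) * norm v ^ 4 \<le> (A x v \<bullet> v) * (A x (\<nu> x \<times> v) \<bullet> (\<nu> x \<times> v)) - (A x v \<bullet> (\<nu> x \<times> v))\<^sup>2"
    if x: "x \<in> S" and v: "v \<bullet> \<nu> x = 0" for x v
  proof -
    have "\<nu> x \<bullet> v = 0" using v by (simp add: inner_commute)
    then show ?thesis using m(2)[OF x]
      by (subst curvature_formula[OF c S_nz[OF x]]) (auto intro!: mult_right_mono mult_left_mono)
  qed
  show "\<exists>y. y 0 = x \<and> (\<forall>s. y s \<in> S) \<and> (y has_vector_derivative v) (at (0::real))"
    if x: "x \<in> S" and v: "v \<bullet> \<nu> x = 0" for x v
  proof (intro exI conjI allI)
    have x0: "x \<noteq> 0" by (rule S_nz[OF x])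
    have Nx: "N x = 1" using x by (simp add: unit_sphere_def)
    have Gv: "G x \<bullet> v = 0" using v G_nz[OF x0] by (simp add: \<nu>_def inner_commute)
    let ?y = "\<lambda>s. (1 / N (x + s *\<^sub>R v)) *\<^sub>R (x + s *\<^sub>R v)"
    show "?y 0 = x" by (simp add: Nx)
    show "?y s \<in> S" for s
    proof (rule radial_in_S)
      have "G x \<bullet> (x + s *\<^sub>R v) = 1" using euler[OF x0] Nx Gv by (simp add: inner_add_right)
      then show "x + s *\<^sub>R v \<noteq> 0" by auto
    qed
    have "((\<lambda>s. x + s *\<^sub>R v) has_derivative (\<lambda>s. s *\<^sub>R v)) (at 0)" by (auto intro!: derivative_eq_intros)
    moreover have "((\<lambda>y. (1 / N y) *\<^sub>R y) has_derivative D\<rho> x) (at (x + 0 *\<^sub>R v))"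
      using radial_deriv[OF x0] by simp
    ultimately have "((\<lambda>y. (1 / N y) *\<^sub>R y) \<circ> (\<lambda>s. x + s *\<^sub>R v) has_derivative
        D\<rho> x \<circ> (\<lambda>s. s *\<^sub>R v)) (at 0)"
      by (rule diff_chain_at)
    then show "(?y has_vector_derivative v) (at 0)"
      unfolding has_vector_derivative_def by (simp add: o_def D\<rho>_def Nx Gv)
  qed
  fix e :: real assume e: "e > 0"
  show "\<exists>d>0. \<forall>x\<in>S. \<forall>y\<in>S. norm (y - x) < d \<longrightarrow> norm (\<nu> y - \<nu> x - A x (y - x)) \<le> e * norm (y - x)"
  proof -
    have sub: "S \<subseteq> - {0}" using S_nz by auto
    have opn: "open (- {0::real^3})" by auto
    have e2: "e / 2 > 0" using e by simp
    obtain d where d: "d > 0"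
      "\<And>x y. x \<in> S \<Longrightarrow> norm (y - x) < d \<Longrightarrow> norm (\<nu> y - \<nu> x - D\<nu> x (y - x)) \<le> (e / 2) * norm (y - x)"
    proof (rule uniform_linearization[where f = \<nu> and D = D\<nu>, OF opn sub S_compact _ _ e2])
      show "(\<nu> has_derivative D\<nu> x) (at x)" if "x \<in> - {0}" for x using \<nu>_deriv that by simp
      show "continuous_on (- {0}) (\<lambda>x. D\<nu> x v)" for v by (intro D\<nu>_app_cont continuous_intros)
    qed blast
    define k where "k = C * (M / g0)"
    have k: "k > 0" using C M by (simp add: k_def)
    define d' where "d' = min d (min dC (e / (2 * k)))"
    have "d' > 0" using d C k e by (simp add: d'_def)
    moreover have "norm (\<nu> y - \<nu> x - A x (y - x)) \<le> e * norm (y - x)"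
      if x: "x \<in> S" and y: "y \<in> S" and yd: "norm (y - x) < d'" for x y
    proof -
      define h where "h = y - x"
      have hd: "norm h < d" "norm h < dC" "norm h < e / (2 * k)" using yd by (auto simp: d'_def h_def)
      have "A x h = D\<nu> x h - (\<nu> x \<bullet> h) *\<^sub>R D\<nu> x (\<nu> x)"
        unfolding A_def P_def by (simp add: linear_diff[OF D\<nu>_linear[OF S_nz[OF x]]] linear_scale[OF D\<nu>_linear[OF S_nz[OF x]]])
      then have "norm (\<nu> y - \<nu> x - A x h) \<le> norm (\<nu> y - \<nu> x - D\<nu> x h) + \<bar>\<nu> x \<bullet> h\<bar> * norm (D\<nu> x (\<nu> x))"
        by (metis (no_types, lifting) add_diff_eq diff_diff_eq2 diff_add_eq norm_scaleR norm_triangle_ineq)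
      also have "\<dots> \<le> (e / 2) * norm h + (C * (norm h)\<^sup>2) * (M / g0)"
      proof (intro add_mono mult_mono)
        show "norm (\<nu> y - \<nu> x - D\<nu> x h) \<le> (e / 2) * norm h" using d(2)[OF x] hd by (simp add: h_def)
        show "\<bar>\<nu> x \<bullet> h\<bar> \<le> C * (norm h)\<^sup>2" using C(3)[OF x y] hd by (simp add: h_def)
        show "norm (D\<nu> x (\<nu> x)) \<le> M / g0" using D_bound[OF x, of "\<nu> x"] \<nu>_unit[OF S_nz[OF x]] by simp
      qed (use C in auto)
      also have "(C * (norm h)\<^sup>2) * (M / g0) = (k * norm h) * norm h" by (simp add: k_def power2_eq_square)
      also have "\<dots> \<le> (e / 2) * norm h"
      proof (rule mult_right_mono)
        show "k * norm h \<le> e / 2" using hd(3) k by (simp add: field_simps)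
      qed simp
      finally show ?thesis by (simp add: h_def)
    qed
    ultimately show ?thesis by blast
  qed
  show "\<exists>d>0. \<forall>x\<in>S. \<forall>y\<in>S. norm (y - x) < d \<longrightarrow>
     \<bar>\<nu> x \<bullet> (y - x) + (y - x) \<bullet> A x (y - x) / 2\<bar> \<le> e * (norm (y - x))\<^sup>2"
  proof -
    have "e * g0 / 2 > 0" using e M by simp
    then obtain d where d: "d > 0" "\<And>x y. x \<in> S \<Longrightarrow> y \<in> S \<Longrightarrow> norm (y - x) < d \<Longrightarrow>
        \<bar>G x \<bullet> (y - x) + (y - x) \<bullet> H x (y - x) / 2\<bar> \<le> (e * g0 / 2) * (norm (y - x))\<^sup>2"
      using gradient_contact by metis
    define k where "k = 3 * M * C"
    have k: "k > 0" using C M by (simp add: k_def)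
    define d' where "d' = min d (min dC (e * g0 / k))"
    have "d' > 0" using d C k e M by (simp add: d'_def)
    moreover have "\<bar>\<nu> x \<bullet> (y - x) + (y - x) \<bullet> A x (y - x) / 2\<bar> \<le> e * (norm (y - x))\<^sup>2"
      if x: "x \<in> S" and y: "y \<in> S" and yd: "norm (y - x) < d'" for x y
    proof -
      define h where "h = y - x"
      \<comment> \<open>The normal component of the chord.\<close>
      define a where "a = \<nu> x \<bullet> h"
      note x0 = S_nz[OF x]
      have hd: "norm h < d" "norm h < dC" "norm h < e * g0 / k" using yd by (auto simp: d'_def h_def)
      have a1: "\<bar>a\<bar> \<le> C * (norm h)\<^sup>2" using C(3)[OF x y] hd by (simp add: h_def a_def)
      have a2: "\<bar>a\<bar> \<le> norm h" using Cauchy_Schwarz_ineq2[of "\<nu> x" h] \<nu>_unit[OF x0] by (simp add: a_def)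
      have hP: "h = P x h + a *\<^sub>R \<nu> x" by (simp add: P_def a_def)
      have "h \<bullet> H x h = P x h \<bullet> H x (P x h) + a * (2 * (\<nu> x \<bullet> H x (P x h)) + a * (\<nu> x \<bullet> H x (\<nu> x)))"
      proof -
        have "P x h \<bullet> H x (\<nu> x) = \<nu> x \<bullet> H x (P x h)" using H_sym[OF x0, of "P x h" "\<nu> x"] by (simp add: inner_commute)
        then have "(p + a *\<^sub>R \<nu> x) \<bullet> (H x p + a *\<^sub>R H x (\<nu> x)) = p \<bullet> H x p + a * (2 * (\<nu> x \<bullet> H x p) + a * (\<nu> x \<bullet> H x (\<nu> x)))"
          if "p = P x h" for p using that by (simp add: inner_add_left inner_add_right algebra_simps)
        moreover have "H x h = H x (P x h) + a *\<^sub>R H x (\<nu> x)"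
          by (subst hP) (simp only: linear_add[OF H_linear[OF x0]] linear_scale[OF H_linear[OF x0]])
        ultimately show ?thesis using hP by metis
      qed
      moreover have "\<bar>a * (2 * (\<nu> x \<bullet> H x (P x h)) + a * (\<nu> x \<bullet> H x (\<nu> x)))\<bar> \<le> (C * (norm h)\<^sup>2) * (3 * M * norm h)"
        unfolding abs_mult
      proof (rule mult_mono[OF a1])
        have "\<bar>\<nu> x \<bullet> H x (P x h)\<bar> \<le> M * norm h"
        proof -
          have "\<bar>\<nu> x \<bullet> H x (P x h)\<bar> \<le> norm (H x (P x h))"
            using Cauchy_Schwarz_ineq2[of "\<nu> x" "H x (P x h)"] \<nu>_unit[OF x0] by simp
          also have "\<dots> \<le> M * norm (P x h)" by (rule M(2)[OF x])
          also have "\<dots> \<le> M * norm h" using norm_P[OF x0] M by (intro mult_left_mono) auto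
          finally show ?thesis .
        qed
        moreover have "\<bar>a * (\<nu> x \<bullet> H x (\<nu> x))\<bar> \<le> norm h * M"
          unfolding abs_mult
        proof (rule mult_mono[OF a2])
          have "\<bar>\<nu> x \<bullet> H x (\<nu> x)\<bar> \<le> norm (H x (\<nu> x))"
            using Cauchy_Schwarz_ineq2[of "\<nu> x" "H x (\<nu> x)"] \<nu>_unit[OF x0] by simp
          then show "\<bar>\<nu> x \<bullet> H x (\<nu> x)\<bar> \<le> M" using M(2)[OF x, of "\<nu> x"] \<nu>_unit[OF x0] by simp
        qed auto
        moreover have "3 * M * norm h = 2 * (M * norm h) + norm h * M" by simp
        ultimately show "\<bar>2 * (\<nu> x \<bullet> H x (P x h)) + a * (\<nu> x \<bullet> H x (\<nu> x))\<bar> \<le> 3 * M * norm h"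
          by linarith
      qed (use C in auto)
      moreover have "(C * (norm h)\<^sup>2) * (3 * M * norm h) \<le> (e * g0) * (norm h)\<^sup>2"
      proof -
        have "k * norm h \<le> e * g0" using hd(3) k by (simp add: field_simps)
        then have "(k * norm h) * (norm h)\<^sup>2 \<le> (e * g0) * (norm h)\<^sup>2" by (rule mult_right_mono) simp
        then show ?thesis by (simp add: k_def mult_ac)
      qed
      moreover have "\<bar>G x \<bullet> h + h \<bullet> H x h / 2\<bar> \<le> (e * g0 / 2) * (norm h)\<^sup>2"
        using d(2)[OF x y] hd by (simp add: h_def)
      ultimately have "\<bar>G x \<bullet> h + P x h \<bullet> H x (P x h) / 2\<bar> \<le> (e * g0) * (norm h)\<^sup>2"
        by (smt (verit) field_sum_of_halves divide_divide_eq_left times_divide_eq_left)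
      moreover have "\<nu> x \<bullet> h + h \<bullet> A x h / 2 = (G x \<bullet> h + P x h \<bullet> H x (P x h) / 2) / norm (G x)"
      proof -
        have "h \<bullet> A x h = (P x h \<bullet> H x (P x h)) / norm (G x)" by (simp add: A_def D\<nu>_def P_sym[symmetric])
        then show ?thesis by (simp add: \<nu>_def add_divide_distrib)
      qed
      ultimately have "\<bar>\<nu> x \<bullet> h + h \<bullet> A x h / 2\<bar> \<le> ((e * g0) * (norm h)\<^sup>2) / norm (G x)"
        by (simp add: abs_divide divide_right_mono)
      also have "\<dots> \<le> ((e * g0) * (norm h)\<^sup>2) / g0"
        using M(3) M(4)[OF x] e by (intro divide_left_mono mult_pos_pos) auto
      also have "\<dots> = e * (norm h)\<^sup>2" using M(3) by simp
      finally show ?thesis by (simp add: h_def)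
    qed
    ultimately show ?thesis by blast
  qed
qed

section \<open>Minkowski length of projected chains\<close>

lemma smooth_on_projected_line:
  assumes "\<And>t. t \<in> I \<Longrightarrow> p + t *\<^sub>R u \<noteq> 0"
  shows "smooth_on (\<lambda>t. (1 / N (p + t *\<^sub>R u)) *\<^sub>R (p + t *\<^sub>R u)) I"
  unfolding smooth_on_def divide_inverse mult_1
proof
  fix k
  have "Ck_on k (\<lambda>t. N (p + t *\<^sub>R u)) I" by (rule Ck_on_line[OF N_Ck]) (use assms in auto)
  then have "Ck_on k (\<lambda>t. inverse (N (p + t *\<^sub>R u))) I"
    by (rule Ck_on_inverse) (use assms norm_laws(2) in auto)
  moreover have "Ck_on k (\<lambda>t. p + t *\<^sub>R u) I" by (rule Ck_on_line[OF Ck_on_ident[of _ UNIV]]) simp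
  ultimately show "Ck_on k (\<lambda>t. inverse (N (p + t *\<^sub>R u)) *\<^sub>R (p + t *\<^sub>R u)) I"
    by (rule Ck_on_bilinear[OF bounded_bilinear_scaleR])
qed

text \<open>For a short chord the point \<open>z\<close> to be projected has norm close to \<open>1\<close>, and the radial part of the derivative contains the factor
\<open>G z \<bullet> u\<close>, which is quadratic in the chord \<open>u\<close> because chords are almost tangential. The projection thus lengthens the
chord by a factor \<open>1 + C |u|\<close> at most.\<close>

lemma projected_chord_speed:
  assumes c: "c > 0" "\<And>x. N x \<le> c * norm x"
  obtains C d where "C \<ge> 0" "d > 0" "\<And>x y t. x \<in> S \<Longrightarrow> y \<in> S \<Longrightarrow> norm (y - x) < d \<Longrightarrow> 0 \<le> t \<Longrightarrow> t \<le> 1 \<Longrightarrow>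
    x + t *\<^sub>R (y - x) \<noteq> 0 \<and>
    norm (D\<rho> (x + t *\<^sub>R (y - x)) (y - x))
    \<le> norm (y - x) * (1 + C * norm (y - x))"
proof -
  obtain M g0 where M: "M \<ge> 1" "\<And>x v. x \<in> S \<Longrightarrow> norm (H x v) \<le> M * norm v" "g0 > 0" "\<And>x. x \<in> S \<Longrightarrow> g0 \<le> norm (G x)"
    using gradient_hessian_bounds by metis
  obtain C0 d0 where C0: "C0 \<ge> 1" "d0 > 0" "\<And>x y. x \<in> S \<Longrightarrow> y \<in> S \<Longrightarrow> norm (y - x) < d0 \<Longrightarrow>
      \<bar>G x \<bullet> (y - x)\<bar> \<le> C0 * (norm (y - x))\<^sup>2 \<and> \<bar>\<nu> x \<bullet> (y - x)\<bar> \<le> C0 * (norm (y - x))\<^sup>2" using near_tangent by metis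
  obtain d1 where d1: "d1 > 0" "\<And>x y. x \<in> S \<Longrightarrow> norm (y - x) < d1 \<Longrightarrow> norm (G y - G x - H x (y - x)) \<le> 1 * norm (y - x)"
    using gradient_contact[of 1] by (metis zero_less_one)
  obtain \<alpha> where \<alpha>: "\<alpha> > 0" "\<And>x. \<alpha> * norm x \<le> N x" using norm_equiv by blast
  define C1 where "C1 = M + 1 + C0"
  define C where "C = 2 * c + 2 * C1 / \<alpha>"
  define d where "d = min d0 (min d1 (1 / (2 * c)))"
  have C1: "C1 \<ge> 0" using M C0 by (simp add: C1_def)
  show ?thesis
  proof (rule that[of C d])
    show "C \<ge> 0" using c C1 \<alpha> by (simp add: C_def)
    show "d > 0" using C0 d1 c by (simp add: d_def)
    fix x y and t :: real assume x: "x \<in> S" and y: "y \<in> S" and yd: "norm (y - x) < d" and t: "0 \<le> t" "t \<le> 1"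
    define u where "u = y - x"
    define z where "z = x + t *\<^sub>R u"
    have ud: "norm u < d0" "norm u < d1" "norm u < 1 / (2 * c)" using yd by (auto simp: d_def u_def)
    have cu: "c * norm u < 1 / 2" using ud(3) c by (simp add: field_simps)
    have tu: "norm (t *\<^sub>R u) \<le> norm u" using t by (simp add: mult_left_le_one_le)
    have Nz: "N z \<ge> 1 - c * norm u"
    proof -
      have "N x \<le> N z + N (t *\<^sub>R (- u))" using norm_laws(4)[of z "t *\<^sub>R (- u)"] by (simp add: z_def)
      moreover have "N (t *\<^sub>R (- u)) \<le> c * norm u"
      proof -
        have "N (t *\<^sub>R (- u)) \<le> c * norm (t *\<^sub>R u)" using c(2)[of "t *\<^sub>R (- u)"] by simp
        also have "\<dots> \<le> c * norm u" using tu c by (intro mult_left_mono) auto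
        finally show ?thesis .
      qed
      ultimately show ?thesis using x by (simp add: unit_sphere_def)
    qed
    then have Nz2: "N z \<ge> 1 / 2" using cu by linarith
    then have z0: "z \<noteq> 0" using norm_laws(2)[of z] by auto
    have inv: "1 / N z \<le> 1 + 2 * (c * norm u)"
    proof -
      have "(1 + 2 * s) * (1 - s) \<ge> 1" if "0 \<le> s" "s < 1 / 2" for s :: real
      proof -
        have "(1 + 2 * s) * (1 - s) = 1 + s * (1 - 2 * s)" by (simp add: algebra_simps)
        moreover have "s * (1 - 2 * s) \<ge> 0" using that by (intro mult_nonneg_nonneg) auto
        ultimately show ?thesis by linarith
      qed
      from this[of "c * norm u"] have "1 \<le> (1 + 2 * (c * norm u)) * (1 - c * norm u)" using cu c by simp
      also have "\<dots> \<le> (1 + 2 * (c * norm u)) * N z" using Nz c by (intro mult_left_mono) auto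
      finally show ?thesis using Nz2 by (simp add: pos_divide_le_eq)
    qed
    have zN: "norm z / (N z)\<^sup>2 \<le> 2 / \<alpha>"
    proof -
      have "norm z \<le> N z / \<alpha>" using \<alpha> by (simp add: pos_le_divide_eq mult.commute)
      then have "norm z / (N z)\<^sup>2 \<le> (N z / \<alpha>) / (N z)\<^sup>2" by (rule divide_right_mono) simp
      also have "\<dots> = (1 / N z) / \<alpha>" using Nz2 by (simp add: power2_eq_square)
      also have "\<dots> \<le> 2 / \<alpha>"
      proof (rule divide_right_mono)
        show "1 / N z \<le> 2" using Nz2 by (simp add: divide_simps)
      qed (use \<alpha> in simp)
      finally show ?thesis .
    qed
    have Gz: "\<bar>G z \<bullet> u\<bar> \<le> C1 * (norm u)\<^sup>2"
    proof -
      have "norm (G z - G x) \<le> norm (G z - G x - H x (t *\<^sub>R u)) + norm (H x (t *\<^sub>R u))"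
        by (metis diff_add_cancel norm_triangle_ineq)
      also have "\<dots> \<le> 1 * norm (t *\<^sub>R u) + M * norm (t *\<^sub>R u)"
      proof (rule add_mono)
        show "norm (G z - G x - H x (t *\<^sub>R u)) \<le> 1 * norm (t *\<^sub>R u)"
          using d1(2)[OF x, of z] tu ud(2) by (simp add: z_def)
        show "norm (H x (t *\<^sub>R u)) \<le> M * norm (t *\<^sub>R u)" by (rule M(2)[OF x])
      qed
      also have "\<dots> = (M + 1) * norm (t *\<^sub>R u)" by (simp add: algebra_simps)
      also have "\<dots> \<le> (M + 1) * norm u" using tu M by (intro mult_left_mono) auto
      finally have "norm (G z - G x) \<le> (M + 1) * norm u" .
      then have "norm (G z - G x) * norm u \<le> ((M + 1) * norm u) * norm u" by (rule mult_right_mono) simp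
      then have "\<bar>(G z - G x) \<bullet> u\<bar> \<le> (M + 1) * (norm u)\<^sup>2"
        using Cauchy_Schwarz_ineq2[of "G z - G x" u] by (simp add: power2_eq_square mult.assoc)
      moreover have "\<bar>G x \<bullet> u\<bar> \<le> C0 * (norm u)\<^sup>2" using C0(3)[OF x y] ud by (simp add: u_def)
      moreover have "G z \<bullet> u = (G z - G x) \<bullet> u + G x \<bullet> u" by (simp add: inner_diff_left)
      ultimately show ?thesis unfolding C1_def distrib_right by linarith
    qed
    have "norm (D\<rho> z u) \<le> norm ((1 / N z) *\<^sub>R u) + norm (((G z \<bullet> u) / (N z)\<^sup>2) *\<^sub>R z)"
      unfolding D\<rho>_def by (rule norm_triangle_ineq4)
    also have "\<dots> = (1 / N z) * norm u + \<bar>G z \<bullet> u\<bar> * (norm z / (N z)\<^sup>2)"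
      using Nz2 by simp
    also have "\<dots> \<le> (1 + 2 * (c * norm u)) * norm u + (C1 * (norm u)\<^sup>2) * (2 / \<alpha>)"
      by (intro add_mono mult_mono inv zN Gz) (use C1 c in auto)
    also have "\<dots> = norm u * (1 + C * norm u)" by (simp add: C_def power2_eq_square algebra_simps)
    finally show "x + t *\<^sub>R (y - x) \<noteq> 0 \<and>
    norm (D\<rho> (x + t *\<^sub>R (y - x)) (y - x))
    \<le> norm (y - x) * (1 + C * norm (y - x))" using z0 by (simp add: z_def u_def)
  qed
qed

lemma mink_length_nonneg: "mink_length N a b \<sigma> \<ge> 0"
  unfolding mink_length_def
proof (cases "(\<lambda>t. N (vector_derivative \<sigma> (at t))) integrable_on {a..b}")
  case True
  then show "0 \<le> integral {a..b} (\<lambda>t. N (vector_derivative \<sigma> (at t)))"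
    by (rule integral_nonneg) (use norm_laws(1) in auto)
qed (simp add: not_integrable_integral)

lemma mink_dist_le:
  assumes "a \<le> b" "piecewise_smooth a b \<sigma>" "\<sigma> ` {a..b} \<subseteq> S" "\<sigma> a = p" "\<sigma> b = q"
  shows "mink_dist N p q \<le> mink_length N a b \<sigma>"
  unfolding mink_dist_def
proof (rule cInf_lower)
  show "bdd_below {mink_length N a b \<sigma> |a b \<sigma>. a \<le> b \<and> piecewise_smooth a b \<sigma> \<and> \<sigma> ` {a..b} \<subseteq> S \<and> \<sigma> a = p \<and> \<sigma> b = q}"
    by (rule bdd_belowI[of _ 0]) (use mink_length_nonneg in auto)
qed (use assms in blast)

text \<open>The curve runs through the projected chord from \<open>x i\<close> to \<open>x (i + 1)\<close> during the time interval from \<open>i\<close> to \<open>i + 1\<close>. The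
hypothesis on \<open>C\<close> and \<open>d\<close> is the conclusion of \<open>projected_chord_speed\<close>.\<close>

lemma mink_dist_le_chain:
  assumes c: "c > 0" "\<And>x. N x \<le> c * norm x" and n: "n \<ge> 1" and x: "chain S p q n x"
    and C: "C \<ge> 0" "\<And>x y t. x \<in> S \<Longrightarrow> y \<in> S \<Longrightarrow> norm (y - x) < d \<Longrightarrow> 0 \<le> t \<Longrightarrow> t \<le> 1 \<Longrightarrow>
    x + t *\<^sub>R (y - x) \<noteq> 0 \<and>
    norm (D\<rho> (x + t *\<^sub>R (y - x)) (y - x))
    \<le> norm (y - x) * (1 + C * norm (y - x))"
    and h: "\<And>i. i < n \<Longrightarrow> norm (edge x i) \<le> h" "h < d" "h \<ge> 0"
  shows "mink_dist N p q \<le> real n * (c * (h * (1 + C * h)))"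
proof -
  have xS: "x i \<in> S" if "i \<le> n" for i using x that by (simp add: chain_def)
  \<comment> \<open>The minimum assigns the final time \<open>n\<close> to the last chord.\<close>
  define idx where "idx t = min (nat \<lfloor>t\<rfloor>) (n - 1)" for t :: real
  define y where "y t = x (idx t) + (t - real (idx t)) *\<^sub>R edge x (idx t)" for t
  define \<sigma> where "\<sigma> t = (1 / N (y t)) *\<^sub>R y t" for t
  have y: "y t = x i + (t - real i) *\<^sub>R edge x i" if "i < n" "real i \<le> t" "t \<le> real (Suc i)" for t i
  proof (cases "t < real (Suc i)")
    case True
    then have "nat \<lfloor>t\<rfloor> = i" using that by linarith
    then have "idx t = i" using that by (simp add: idx_def)
    then show ?thesis by (simp add: y_def)
  next
    case False
    then have t: "t = real (Suc i)" using that by simp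
    show ?thesis
    proof (cases "Suc i < n")
      case True
      then have "idx t = Suc i" using t by (simp add: idx_def)
      then show ?thesis by (simp add: y_def t edge_def)
    next
      case False
      then have "idx t = i" using t that by (simp add: idx_def)
      then show ?thesis by (simp add: y_def)
    qed
  qed
  have loc: "\<exists>i<n. real i \<le> t \<and> t \<le> real (Suc i)" if "t \<in> {0..real n}" for t
  proof (cases "t < real n")
    case True
    then have "nat \<lfloor>t\<rfloor> < n" "real (nat \<lfloor>t\<rfloor>) \<le> t" "t \<le> real (Suc (nat \<lfloor>t\<rfloor>))" using that by (auto, linarith+)
    then show ?thesis by blast
  next
    case False
    then show ?thesis using that n by (intro exI[of _ "n - 1"]) auto
  qed
  have edge_bd: "edge x i = x (Suc i) - x i" "norm (x (Suc i) - x i) < d" if "i < n" for i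
    using h(1)[OF that] h(2) by (auto simp: edge_def)
  note speed = C(2)[OF xS xS edge_bd(2)]
  have y0: "y t \<noteq> 0" if t: "t \<in> {0..real n}" for t
  proof -
    obtain i where i: "i < n" "real i \<le> t" "t \<le> real (Suc i)" using loc[OF t] by blast
    show ?thesis using speed[of i "t - real i"] i unfolding y[OF i] edge_def by auto
  qed
  have piece: "smooth_on \<sigma> {real i..real (Suc i)}" if i: "i < n" for i
  proof -
    define p where "p = x i - real i *\<^sub>R edge x i"
    have yp: "y t = p + t *\<^sub>R edge x i" if "t \<in> {real i..real (Suc i)}" for t
      using y[OF i] that by (simp add: p_def algebra_simps)
    have sub: "t \<in> {0..real n}" if "t \<in> {real i..real (Suc i)}" for t
    proof -
      have "real (Suc i) \<le> real n" using i by linarith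
      then show ?thesis using that by auto
    qed
    have "smooth_on (\<lambda>t. (1 / N (p + t *\<^sub>R edge x i)) *\<^sub>R (p + t *\<^sub>R edge x i)) {real i..real (Suc i)}"
      by (rule smooth_on_projected_line) (use yp y0 sub in metis)
    then show ?thesis unfolding smooth_on_def
      using Ck_on_cong[of "{real i..real (Suc i)}" "\<lambda>t. (1 / N (p + t *\<^sub>R edge x i)) *\<^sub>R (p + t *\<^sub>R edge x i)" \<sigma>] yp
      by (auto simp: \<sigma>_def)
  qed
  have ps: "piecewise_smooth 0 (real n) \<sigma>"
    unfolding piecewise_smooth_def by (intro exI[of _ n] exI[of _ real]) (use piece in auto)
  have img: "\<sigma> ` {0..real n} \<subseteq> S" using radial_in_S y0 by (auto simp: \<sigma>_def)
  have ends: "\<sigma> 0 = p" "\<sigma> (real n) = q"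
  proof -
    have "y 0 = x 0" using y[of 0 0] n by simp
    moreover have "y (real n) = x n" using y[of "n - 1" "real n"] n by (simp add: edge_def of_nat_diff)
    moreover have "N (x 0) = 1" "N (x n) = 1" using xS[of 0] xS[of n] by (auto simp: unit_sphere_def)
    ultimately show "\<sigma> 0 = p" "\<sigma> (real n) = q" using x by (auto simp: \<sigma>_def chain_def)
  qed
  define B where "B = c * (h * (1 + C * h))"
  have B0: "B \<ge> 0" using c C(1) h(3) by (simp add: B_def)
  have deriv: "N (vector_derivative \<sigma> (at t)) \<le> B" if t: "t \<in> {0..real n} - real ` {..n}" for t
  proof -
    obtain i where i: "i < n" "real i \<le> t" "t \<le> real (Suc i)" using loc[of t] t by blast
    have "real i \<in> real ` {..n}" "real (Suc i) \<in> real ` {..n}" using i(1) by (auto simp del: of_nat_Suc)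
    then have ne: "t \<noteq> real i" "t \<noteq> real (Suc i)" using t by blast+
    have ti: "t \<in> {real i<..<real (Suc i)}" using i ne by auto
    define u where "u = edge x i"
    define f where "f s = x i + (s - real i) *\<^sub>R u" for s
    define z where "z = f t"
    have z: "z \<noteq> 0" "norm (D\<rho> z u) \<le> norm u * (1 + C * norm u)"
      using speed[of i "t - real i"] i unfolding z_def f_def u_def edge_def by auto
    have "(f has_derivative (\<lambda>s. s *\<^sub>R u)) (at t)" unfolding f_def[abs_def] by (auto intro!: derivative_eq_intros)
    moreover have "((\<lambda>y. (1 / N y) *\<^sub>R y) has_derivative D\<rho> z) (at (f t))"
      using radial_deriv[OF z(1)] by (simp add: z_def)
    ultimately have "((\<lambda>y. (1 / N y) *\<^sub>R y) \<circ> f has_derivative D\<rho> z \<circ> (\<lambda>s. s *\<^sub>R u)) (at t)"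
      by (rule diff_chain_at)
    then have "((\<lambda>y. (1 / N y) *\<^sub>R y) \<circ> f has_vector_derivative (D\<rho> z u)) (at t)"
      unfolding has_vector_derivative_def by (simp add: o_def D\<rho>_def scaleR_diff_right mult.commute)
    then have "(\<sigma> has_vector_derivative (D\<rho> z u)) (at t)"
    proof (rule has_vector_derivative_transform_within_open[where S = "{real i<..<real (Suc i)}"])
      show "((\<lambda>y. (1 / N y) *\<^sub>R y) \<circ> f) s = \<sigma> s" if "s \<in> {real i<..<real (Suc i)}" for s
        using y[OF i(1), of s] that by (simp add: \<sigma>_def f_def u_def)
    qed (use ti in auto)
    then have "vector_derivative \<sigma> (at t) = D\<rho> z u"
      by (rule vector_derivative_at)
    then have "N (vector_derivative \<sigma> (at t)) \<le> c * (norm u * (1 + C * norm u))"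
      using c(2)[of "D\<rho> z u"] z(2) c(1) by (smt (verit) mult_left_mono)
    also have "\<dots> \<le> B" unfolding B_def
      using h(1)[OF i(1)] c C(1) h(3) by (intro mult_left_mono mult_mono add_mono) (auto simp: u_def)
    finally show ?thesis .
  qed
  have "mink_length N 0 (real n) \<sigma> \<le> real n * B"
  proof (cases "(\<lambda>t. N (vector_derivative \<sigma> (at t))) integrable_on {0..real n}")
    case True
    define g where "g t = (if t \<in> real ` {..n} then 0 else N (vector_derivative \<sigma> (at t)))" for t
    have neg: "negligible (real ` {..n})" by (intro negligible_finite) simp
    have ge: "g t = N (vector_derivative \<sigma> (at t))" if "t \<in> {0..real n} - real ` {..n}" for t
      using that by (auto simp: g_def)
    have gi: "g integrable_on {0..real n}" by (rule integrable_spike[OF True neg ge])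
    have "mink_length N 0 (real n) \<sigma> = integral {0..real n} g"
      unfolding mink_length_def by (rule integral_spike[OF neg ge])
    also have "\<dots> \<le> integral {0..real n} (\<lambda>t. B)"
    proof (rule integral_le[OF gi])
      show "g t \<le> B" if "t \<in> {0..real n}" for t using deriv[of t] that B0 by (auto simp: g_def)
    qed (rule integrable_const_ivl)
    also have "\<dots> = real n * B" by simp
    finally show ?thesis .
  next
    case False
    then show ?thesis using B0 by (simp add: mink_length_def not_integrable_integral)
  qed
  then show ?thesis using mink_dist_le[OF _ ps img ends] by (simp add: B_def)
qed

text \<open>Projecting a Euclidean half circle from \<open>p\<close> to \<open>-p\<close> radially gives a Lipschitz path on the sphere; \<open>n\<close> equal steps in time have
lengths of order \<open>1 / n\<close>, and hence an energy of order \<open>1 / n\<close>.\<close>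

lemma antipodal_chain:
  assumes p: "p \<in> S" and c: "c > 0" "\<And>x. N x \<le> c * norm x"
  obtains C where "\<And>n. n \<ge> 1 \<Longrightarrow> \<exists>y. chain S p (- p) n y \<and> energy n y \<le> C / real n"
proof -
  obtain \<alpha> where \<alpha>: "\<alpha> > 0" "\<And>x. \<alpha> * norm x \<le> N x" using norm_equiv by blast
  have p0: "p \<noteq> 0" by (rule S_nz[OF p])
  obtain i where i: "p \<times> axis i 1 \<noteq> 0" using cross_basis_nonzero[OF p0] by blast
  define R where "R = norm p"
  define e where "e = (R / norm (p \<times> axis i 1)) *\<^sub>R (p \<times> axis i 1)"
  have e: "p \<bullet> e = 0" "norm e = R" using i by (simp_all add: e_def dot_cross_self R_def)
  have R: "R > 0" using p0 by (simp add: R_def)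
  define y where "y t = cos (pi * t) *\<^sub>R p + sin (pi * t) *\<^sub>R e" for t
  have ny: "norm (y t) = R" for t
  proof -
    have "(norm (y t))\<^sup>2 = (cos (pi * t))\<^sup>2 * R\<^sup>2 + (sin (pi * t))\<^sup>2 * R\<^sup>2"
    proof -
      have "(norm (a *\<^sub>R p + b *\<^sub>R e))\<^sup>2 = a\<^sup>2 * R\<^sup>2 + b\<^sup>2 * R\<^sup>2" for a b
      proof -
        have "p \<bullet> p = R\<^sup>2" "e \<bullet> e = R\<^sup>2" using e by (simp_all add: R_def power2_norm_eq_inner[symmetric])
        then show ?thesis using e(1) unfolding power2_norm_eq_inner
          by (simp add: inner_add_left inner_add_right inner_commute power2_eq_square)
      qed
      then show ?thesis by (simp add: y_def)
    qed
    also have "\<dots> = R\<^sup>2" by (simp add: distrib_right[symmetric])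
    finally show ?thesis using R by simp
  qed
  have lip: "norm (y s - y t) \<le> 2 * R * pi * \<bar>s - t\<bar>" for s t
  proof -
    have "norm (y s - y t) \<le> 2 * R * pi * norm (s - t)"
    proof (rule differentiable_bound[of UNIV y "\<lambda>t h. h *\<^sub>R ((- (pi * sin (pi * t))) *\<^sub>R p + (pi * cos (pi * t)) *\<^sub>R e)"])
      show "(y has_derivative (\<lambda>h. h *\<^sub>R ((- (pi * sin (pi * t))) *\<^sub>R p + (pi * cos (pi * t)) *\<^sub>R e))) (at t within UNIV)" for t
        unfolding y_def[abs_def] by (auto intro!: derivative_eq_intros simp: algebra_simps)
      show "onorm (\<lambda>h. h *\<^sub>R ((- (pi * sin (pi * t))) *\<^sub>R p + (pi * cos (pi * t)) *\<^sub>R e)) \<le> 2 * R * pi" for t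
      proof (rule onorm_le)
        fix h :: real
        have "norm ((- (pi * sin (pi * t))) *\<^sub>R p + (pi * cos (pi * t)) *\<^sub>R e) \<le> pi * R + pi * R"
        proof (rule order_trans[OF norm_triangle_ineq], rule add_mono)
          show "norm ((- (pi * sin (pi * t))) *\<^sub>R p) \<le> pi * R"
            using R by (simp add: R_def abs_mult mult_right_mono)
          show "norm ((pi * cos (pi * t)) *\<^sub>R e) \<le> pi * R"
            using R by (simp add: e abs_mult mult_right_mono)
        qed
        then have "\<bar>h\<bar> * norm ((- (pi * sin (pi * t))) *\<^sub>R p + (pi * cos (pi * t)) *\<^sub>R e) \<le> \<bar>h\<bar> * (pi * R + pi * R)"
          by (rule mult_left_mono) simp
        then show "norm (h *\<^sub>R ((- (pi * sin (pi * t))) *\<^sub>R p + (pi * cos (pi * t)) *\<^sub>R e)) \<le> 2 * R * pi * norm h"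
          by (simp add: mult_ac)
      qed
    qed auto
    then show ?thesis by simp
  qed
  define r where "r z = (1 / N z) *\<^sub>R z" for z
  define L where "L = 1 / (\<alpha> * R) + R * c / (\<alpha> * R)\<^sup>2"
  have aR: "\<alpha> * R > 0" using \<alpha> R by simp
  have rlip: "norm (r a - r b) \<le> L * norm (a - b)" if "norm a = R" "norm b = R" for a b
  proof -
    have Na: "N a \<ge> \<alpha> * R" "N b \<ge> \<alpha> * R" using \<alpha>(2)[of a] \<alpha>(2)[of b] that by auto
    then have pos: "N a > 0" "N b > 0" using aR by linarith+
    have "\<bar>N b - N a\<bar> \<le> N (a - b)" using N_diff[of a b] N_diff[of b a] N_minus[of "a - b"] by simp
    then have d: "\<bar>N b - N a\<bar> \<le> c * norm (a - b)" using c(2)[of "a - b"] by linarith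
    have "r a - r b = (1 / N a) *\<^sub>R (a - b) + ((N b - N a) / (N a * N b)) *\<^sub>R b"
    proof -
      have "1 / N a - 1 / N b = (N b - N a) / (N a * N b)" using pos by (simp add: field_simps)
      then have "((N b - N a) / (N a * N b)) *\<^sub>R b = (1 / N a) *\<^sub>R b - (1 / N b) *\<^sub>R b"
        by (metis scaleR_diff_left)
      then show ?thesis by (simp add: r_def scaleR_diff_right)
    qed
    then have "norm (r a - r b) \<le> (1 / N a) * norm (a - b) + (\<bar>N b - N a\<bar> / (N a * N b)) * R"
      using norm_triangle_ineq[of "(1 / N a) *\<^sub>R (a - b)" "((N b - N a) / (N a * N b)) *\<^sub>R b"] pos that
      by (simp add: abs_mult)
    also have "\<dots> \<le> (1 / (\<alpha> * R)) * norm (a - b) + ((c * norm (a - b)) / (\<alpha> * R)\<^sup>2) * R"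
    proof (intro add_mono mult_right_mono)
      show "1 / N a \<le> 1 / (\<alpha> * R)" using Na aR by (intro frac_le) auto
      show "\<bar>N b - N a\<bar> / (N a * N b) \<le> (c * norm (a - b)) / (\<alpha> * R)\<^sup>2"
        unfolding power2_eq_square using Na aR d by (intro frac_le mult_mono) auto
    qed (use R in auto)
    also have "\<dots> = L * norm (a - b)" by (simp add: L_def algebra_simps)
    finally show ?thesis .
  qed
  have L0: "L \<ge> 0" using \<alpha> R c by (simp add: L_def)
  define C where "C = (L * (2 * R * pi))\<^sup>2"
  have "\<exists>x. chain S p (- p) n x \<and> energy n x \<le> C / real n" if n: "n \<ge> 1" for n
  proof (intro exI conjI)
    define x where "x i = r (y (real i / real n))" for i
    have y0: "y t \<noteq> 0" for t using ny[of t] R by auto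
    have Np: "N p = 1" using p by (simp add: unit_sphere_def)
    show "chain S p (- p) n x"
      unfolding chain_def
    proof (intro conjI allI impI)
      show "x 0 = p" "x n = - p" using n Np by (simp_all add: x_def r_def y_def N_minus)
      show "x i \<in> S" for i unfolding x_def r_def by (rule radial_in_S[OF y0])
    qed
    have "norm (edge x i) \<le> L * (2 * R * pi) / real n" for i
    proof -
      have "norm (edge x i) \<le> L * norm (y (real (Suc i) / real n) - y (real i / real n))"
        unfolding edge_def x_def by (intro rlip ny)
      also have "\<dots> \<le> L * (2 * R * pi * \<bar>real (Suc i) / real n - real i / real n\<bar>)"
        by (intro mult_left_mono lip L0)
      also have "\<bar>real (Suc i) / real n - real i / real n\<bar> = 1 / real n"
        by (simp add: diff_divide_distrib[symmetric])
      finally show ?thesis by simp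
    qed
    then have "(norm (edge x i))\<^sup>2 \<le> C / (real n)\<^sup>2" for i
      using power_mono[of "norm (edge x i)" "L * (2 * R * pi) / real n" 2] by (simp add: C_def power_divide)
    then have "energy n x \<le> (\<Sum>i<n. C / (real n)\<^sup>2)" unfolding energy_def by (intro sum_mono)
    also have "\<dots> = C / real n" using n by (simp add: power2_eq_square)
    finally show "energy n x \<le> C / real n" .
  qed
  then show ?thesis using that by blast
qed

text \<open>Minimal chains with \<open>n\<close> edges have edges of length at most \<open>L / n\<close>, where \<open>c L\<close> exceeds \<open>pi / sqrt m\<close> as little as desired. Projecting
them costs a factor that tends to \<open>1\<close> as \<open>n\<close> grows.\<close>

lemma antipodal_mink_dist:
  assumes c: "c > 0" "\<And>x. N x \<le> c * norm x" and m: "m > 0" "\<And>q. q \<in> S \<Longrightarrow> m \<le> gaussian_curvature c N q"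
    and p: "p \<in> S"
  shows "mink_dist N p (- p) \<le> pi / sqrt m"
proof -
  interpret curved_surface S \<nu> A "c\<^sup>2 * m" by (rule curved_surface_unit_sphere[OF c(1) m])
  obtain C where C: "\<And>n. n \<ge> 1 \<Longrightarrow> \<exists>y. chain S p (- p) n y \<and> energy n y \<le> C / real n"
    using antipodal_chain[OF p c] by blast
  obtain K d where K: "K \<ge> 0" "d > 0" "\<And>x y t. x \<in> S \<Longrightarrow> y \<in> S \<Longrightarrow> norm (y - x) < d \<Longrightarrow> 0 \<le> t \<Longrightarrow> t \<le> 1 \<Longrightarrow>
    x + t *\<^sub>R (y - x) \<noteq> 0 \<and>
    norm (D\<rho> (x + t *\<^sub>R (y - x)) (y - x))
    \<le> norm (y - x) * (1 + K * norm (y - x))"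
    using projected_chord_speed[OF c] by metis
  have pm: "- p \<in> S" using p by (simp add: unit_sphere_def N_minus)
  have "mink_dist N p (- p) * sqrt m \<le> sqrt (pi\<^sup>2 + e)" if e: "e > 0" for e
  proof -
    define L where "L = sqrt ((pi\<^sup>2 + e) / (c\<^sup>2 * m))"
    have L2: "L\<^sup>2 = (pi\<^sup>2 + e) / (c\<^sup>2 * m)" using e m c by (simp add: L_def)
    have L0: "L \<ge> 0" using e m c by (simp add: L_def)
    have ev: "\<forall>\<^sub>F n in sequentially. L / real n < d"
      using order_tendstoD(2)[OF lim_const_over_n K(2), of L] by simp
    have edges: "\<forall>\<^sub>F n in sequentially. \<forall>x. minimal_chain S p (- p) n x \<longrightarrow>
        (\<forall>i<n. (c\<^sup>2 * m) * ((real n)\<^sup>2 * (norm (edge x i))\<^sup>2) \<le> pi\<^sup>2 + e)"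
      by (rule minimal_chain_edge_bound[OF _ e]) (rule C)
    have "\<forall>\<^sub>F n in sequentially. mink_dist N p (- p) \<le> c * L * (1 + K * (L / real n))"
      using edges ev eventually_ge_at_top[of "1::nat"]
    proof eventually_elim
      case (elim n)
      obtain x where x: "minimal_chain S p (- p) n x" using minimal_chain_exists[OF S_compact p pm elim(3)] by blast
      have "mink_dist N p (- p) \<le> real n * (c * (L / real n * (1 + K * (L / real n))))"
      proof (rule mink_dist_le_chain[OF c elim(3) _ K(1,3), of p "- p" x])
        show "chain S p (- p) n x" using x by (simp add: minimal_chain_def)
        show "norm (edge x i) \<le> L / real n" if "i < n" for i
        proof (rule power2_le_imp_le)
          have "(c\<^sup>2 * m) * ((real n)\<^sup>2 * (norm (edge x i))\<^sup>2) \<le> pi\<^sup>2 + e" using elim(1) x that by blast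
          then have "(norm (edge x i))\<^sup>2 \<le> ((pi\<^sup>2 + e) / (c\<^sup>2 * m)) / (real n)\<^sup>2"
            using c m elim(3) by (simp add: field_simps)
          then show "(norm (edge x i))\<^sup>2 \<le> (L / real n)\<^sup>2" by (simp add: power_divide L2)
        qed (use L0 in simp)
      qed (use elim L0 in auto)
      also have "\<dots> = c * L * (1 + K * (L / real n))" using elim(3) by simp
      finally show ?case .
    qed
    moreover have "(\<lambda>n. c * L * (1 + K * (L / real n))) \<longlonglongrightarrow> c * L * (1 + K * 0)"
      by (intro tendsto_intros lim_const_over_n)
    ultimately have "mink_dist N p (- p) \<le> c * L" using tendsto_lowerbound by fastforce
    also have "c * L = sqrt (pi\<^sup>2 + e) / sqrt m" using c m by (simp add: L_def real_sqrt_divide real_sqrt_mult)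
    finally show ?thesis using m by (simp add: field_simps)
  qed
  then have "mink_dist N p (- p) * sqrt m \<le> pi"
  proof -
    assume *: "\<And>e. e > 0 \<Longrightarrow> mink_dist N p (- p) * sqrt m \<le> sqrt (pi\<^sup>2 + e)"
    have "mink_dist N p (- p) * sqrt m \<le> pi + e" if e: "e > 0" for e
    proof -
      have "mink_dist N p (- p) * sqrt m \<le> sqrt (pi\<^sup>2 + (2 * pi * e + e\<^sup>2))"
        by (rule *) (use e in \<open>simp add: add_pos_pos\<close>)
      also have "pi\<^sup>2 + (2 * pi * e + e\<^sup>2) = (pi + e)\<^sup>2" by (simp add: power2_sum)
      finally show ?thesis using e by (simp add: add_nonneg_nonneg)
    qed
    then show ?thesis by (rule field_le_epsilon)
  qed
  then show ?thesis using m by (simp add: field_simps)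
qed
end

theorem theorem6p2:
  fixes N :: "real^3 \<Rightarrow> real" and c m :: real
  assumes smooth: "smooth_norm N"
    and admissible: "admissible_norm N"
    and scale_pos: "0 < c"
    and unit_euclid_ball_inside: "euclid_cball c 1 \<subseteq> unit_ball N"
    and unit_euclid_ball_largest: "\<And>r. euclid_cball c r \<subseteq> unit_ball N \<Longrightarrow> r \<le> 1"
    and m_def: "m = (INF q\<in>unit_sphere N. gaussian_curvature c N q)"
  shows "perimeter N \<le> 2 * pi / sqrt m"
proof -
  interpret smooth_norm_space N by unfold_locales (rule smooth)
  have Nc: "N x \<le> c * norm x" for x
  proof (cases "x = 0")
    case True
    then show ?thesis using norm_laws(2)[of x] by simp
  next
    case False
    define v where "v = (1 / (c * norm x)) *\<^sub>R x"
    have "euclid_norm c v = 1" unfolding v_def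
      using False scale_pos by (simp add: euclid_norm_def euclid_inner_def power_divide power_mult_distrib
          dot_square_norm power2_eq_square)
    then have "v \<in> euclid_cball c 1" by (simp add: euclid_cball_def)
    then have "v \<in> unit_ball N" using unit_euclid_ball_inside by blast
    then have "N v \<le> 1" by (simp add: unit_ball_def)
    then show ?thesis using False scale_pos by (simp add: v_def norm_laws(3) field_simps)
  qed
  note m = curvature_lower_bound[OF admissible scale_pos m_def]
  have "(SUP p\<in>S. mink_dist N p (- p)) \<le> pi / sqrt m"
    by (rule cSUP_least[OF S_ne antipodal_mink_dist[OF scale_pos Nc m]])
  then show ?thesis by (simp add: perimeter_def)
qed

end
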